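(* Let $\mathcal{C}$ be a quasiminimal class. The notion of independence $\perp^{\operatorname{cl},H}$ in $H$-structures associated to $\mathcal{C}$ satisfies invariance, normality, monotonicity, transitivity, symmetry, finite character and extension.
   Context: **Quasiminimal classes.** Let $\mathcal{L}$ be a countable language. $\operatorname{tp}$ denotes the quantifier-free $\mathcal{L}$-type of a (possibly infinite, enumerated) tuple; in the structures below it is identified with the $\mathcal{L}_{\omega_1\omega}$-type. An $\mathcal{L}$-structure $M$ equipped with a pregeometry $\operatorname{cl}$ is a *quasiminimal pregeometry structure* if: (QM1) if $\operatorname{tp}(a,\vec b)=\operatorname{tp}(a',\vec b')$ then $a\in\operatorname{cl}(\vec b)$ iff $a'\in\operatorname{cl}(\vec b')$; (QM2) $M$ is infinite-dimensional with respect to $\operatorname{cl}$; (QM3) $\operatorname{cl}(A)$ is countable for every finite $A\subseteq M$; (QM4) if $A,A'\subseteq M$ are countable closed subsets enumerated so that $\operatorname{tp}(A)=\operatorname{tp}(A')$, $a\in M\setminus A$ and $a'\in M\setminus A'$, then $\operatorname{tp}(A,a)=\operatorname{tp}(A',a')$; (QM5) if $A,A'\subseteq M$ are countable closed subsets or empty, enumerated so that $\operatorname{tp}(A)=\operatorname{tp}(A')$, $\vec b,\vec b'$ are finite tuples with $\operatorname{tp}(A,\vec b)=\operatorname{tp}(A',\vec b')$ and $a\in\operatorname{cl}(A,\vec b)$, then there is $a'\in M$ with $\operatorname{tp}(A,\vec b,a)=\operatorname{tp}(A',\vec b',a')$. It is a *weakly quasiminimal pregeometry structure* if all axioms except possibly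 QM2 hold. An embedding $\theta:M_1\to M_2$ of such structures is *closed* if $\theta(\operatorname{cl}_{M_1}(A))=\operatorname{cl}_{M_2}(\theta(A))$ for all $A\subseteq M_1$. A *quasiminimal class* $\mathcal{C}$ is the smallest class of $\mathcal{L}$-structures containing a given quasiminimal pregeometry structure and closed under isomorphism, closed substructures, and unions of chains of closed embeddings; each member is a weakly quasiminimal pregeometry structure with its pregeometry $\operatorname{cl}$. $\dim(\vec a/B)$ is the dimension of $\vec a$ in the localized pregeometry $\operatorname{cl}_B(X)=\operatorname{cl}(X\cup B)$, and $\vec a\perp^{\operatorname{cl}}_C B$ means $\dim(\vec a/B\cup C)=\dim(\vec a/C)$. **$H$-structures.** Let $H$ be a new unary predicate, $\mathcal{L}_H=\mathcal{L}\cup\{H\}$, $M\in\mathcal{C}$. $(M,H)$ is *dense-codense* if for all $b_1,\dots,b_n\in M$: (density) some $a\in H(M)$ realizes the unique generic type over $\operatorname{cl}(b_1,\dots,b_n)$, i.e. $a\notin\operatorname{cl}(b_1,\dots,b_n)$; (codensity) there is $a\in M$ with $a\notin\operatorname{cl}(\{b_1,\dots,b_n\}\cup H(M))$. It is an *$H$-structure* if in addition any distinct elements of $H(M)$ are $\operatorname{cl}$-independent. $\operatorname{tp}_H(\vec a/B)$ denotes the $(\mathcal{L}_H)_{\omega_1\omega}$-type of $\vec a$ over $B$ in $(M,H)$. With $H(B)=B\cap H(M)$, a set $B$ is *$H$-independent* if $\dim(\vec b/H(B))=\dim(\vec b/H(M))$ for all finite tuples $\vec b$ in $B$. **$H$-basis.**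 For $B\subseteq M$ closed ($\operatorname{cl}(B)=B$) and $H$-independent and a finite tuple $\vec a$, $HB(\vec a/B)$ is the smallest finite $H_0\subset H(M)$ with $\dim(\vec a/BH(M))=\dim(\vec a/BH_0)$. For a set $A$, $HB(A)$ is the smallest $H_0\subseteq H(M)$ with $\dim(\vec a/H_0)=\dim(\vec a/H(M))$ for all finite tuples $\vec a$ in $A$. For general $B$, $HB(\vec a/B):=HB(\vec a/\operatorname{cl}(B\cup HB(B)))$. **Independence.** $\vec a\perp^{\operatorname{cl},H}_C B$ means: $\vec a\perp^{\operatorname{cl}}_{C\cup H(M)}B$ and $HB(\vec a/\operatorname{cl}(C))=HB(\vec a/\operatorname{cl}(C\cup B))$. For a set $A$, $A\perp^{\operatorname{cl},H}_C B$ means $\vec a\perp^{\operatorname{cl},H}_C B$ for all finite tuples $\vec a$ in $A$. **The properties** (standard meanings, for subsets and tuples of an $H$-structure $(M,H)$; write $\perp$ for $\perp^{\operatorname{cl},H}$). Invariance: $\perp$ is preserved by automorphisms of $(M,H)$. Normality: $A\perp_C B$ implies $A\perp_C B\cup C$. Monotonicity: $A\perp_C B$, $A'\subseteq A$, $B'\subseteq B$ imply $A'\perp_C B'$. Transitivity: for $B\subseteq C\subseteq D$, $A\perp_B D$ iff $A\perp_B C$ and $A\perp_C D$. Symmetry: $A\perp_C B$ implies $B\perp_C A$. Finite character: $A\perp_C B$ iff $\vec a\perp_C\vec b$ for all finite tuples $\vec a$ in $A$, $\vec b$ in $B$. Extension: if $\kappa$ is an infinite cardinal with $\dim(H(M))=\dim(M/H(M))=\kappa$,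 $\vec a$ is a finite tuple in $M$, and $B\subseteq C\subseteq M$ with $|B|,|C|<\kappa$, then there is $\vec c$ in $M$ with $\operatorname{tp}_H(\vec c/B)=\operatorname{tp}_H(\vec a/B)$ and $\vec c\perp_B C$. *)

theory Defs
  imports "HOL-Library.Countable_Set"
begin

unbundle cardinal_syntax

section \<open>Languages, structures and formulas\<close>

record ('f, 'r) lang =
  fsyms :: "'f set"
  rsyms :: "'r set"
  farity :: "'f \<Rightarrow> nat"
  rarity :: "'r \<Rightarrow> nat"

definition countable_lang :: "('f, 'r) lang \<Rightarrow> bool" where
  "countable_lang L \<longleftrightarrow> countable (fsyms L) \<and> countable (rsyms L)"

record ('f, 'r, 'u) fostruct =
  univ :: "'u set"
  fint :: "'f \<Rightarrow> 'u list \<Rightarrow> 'u"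
  rint :: "'r \<Rightarrow> 'u list \<Rightarrow> bool"

text \<open>Only the values of \<open>fint\<close> and \<open>rint\<close> at symbols of the language, applied to argument
  lists of the correct length from the universe, are relevant.\<close>

definition argtuples :: "('f, 'r, 'u, 'z) fostruct_scheme \<Rightarrow> nat \<Rightarrow> 'u list set" where
  "argtuples M n = {xs. length xs = n \<and> set xs \<subseteq> univ M}"

definition is_structure :: "('f, 'r) lang \<Rightarrow> ('f, 'r, 'u, 'z) fostruct_scheme \<Rightarrow> bool" where
  "is_structure L M \<longleftrightarrow>
     (\<forall>f\<in>fsyms L. \<forall>xs\<in>argtuples M (farity L f). fint M f xs \<in> univ M)"

definition fo_embedding ::
  "('f, 'r) lang \<Rightarrow> ('f, 'r, 'u, 'y) fostruct_scheme \<Rightarrow> ('f, 'r, 'u, 'z) fostruct_scheme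
    \<Rightarrow> ('u \<Rightarrow> 'u) \<Rightarrow> bool" where
  "fo_embedding L M N \<theta> \<longleftrightarrow>
     is_structure L M \<and> is_structure L N \<and>
     \<theta> ` univ M \<subseteq> univ N \<and> inj_on \<theta> (univ M) \<and>
     (\<forall>f\<in>fsyms L. \<forall>xs\<in>argtuples M (farity L f). \<theta> (fint M f xs) = fint N f (map \<theta> xs)) \<and>
     (\<forall>R\<in>rsyms L. \<forall>xs\<in>argtuples M (rarity L R). rint M R xs \<longleftrightarrow> rint N R (map \<theta> xs))"

definition fo_iso ::
  "('f, 'r) lang \<Rightarrow> ('f, 'r, 'u, 'y) fostruct_scheme \<Rightarrow> ('f, 'r, 'u, 'z) fostruct_scheme
    \<Rightarrow> ('u \<Rightarrow> 'u) \<Rightarrow> bool" where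
  "fo_iso L M N \<theta> \<longleftrightarrow> fo_embedding L M N \<theta> \<and> \<theta> ` univ M = univ N"

datatype ('f, 'v) trm = Var 'v | Fn 'f "('f, 'v) trm list"

text \<open>Formulas of \<open>L\<^sub>\<omega>\<^sub>1\<^sub>\<omega>\<close>, with variables from an arbitrary type. \<open>CConj\<close> is the countable
  conjunction; the binary \<open>And\<close> is kept so that finitary formulas form a syntactic fragment.\<close>

datatype ('f, 'r, 'v) fm =
    Eq "('f, 'v) trm" "('f, 'v) trm"
  | Rel 'r "('f, 'v) trm list"
  | Neg "('f, 'r, 'v) fm"
  | And "('f, 'r, 'v) fm" "('f, 'r, 'v) fm"
  | CConj "nat \<Rightarrow> ('f, 'r, 'v) fm"
  | Ex 'v "('f, 'r, 'v) fm"

primrec wf_trm :: "('f, 'r) lang \<Rightarrow> ('f, 'v) trm \<Rightarrow> bool" where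
  "wf_trm L (Var x) \<longleftrightarrow> True"
| "wf_trm L (Fn f ts) \<longleftrightarrow>
     f \<in> fsyms L \<and> length ts = farity L f \<and> list_all id (map (wf_trm L) ts)"

primrec wf_fm :: "('f, 'r) lang \<Rightarrow> ('f, 'r, 'v) fm \<Rightarrow> bool" where
  "wf_fm L (Eq s t) \<longleftrightarrow> wf_trm L s \<and> wf_trm L t"
| "wf_fm L (Rel R ts) \<longleftrightarrow>
     R \<in> rsyms L \<and> length ts = rarity L R \<and> (\<forall>t\<in>set ts. wf_trm L t)"
| "wf_fm L (Neg \<phi>) \<longleftrightarrow> wf_fm L \<phi>"
| "wf_fm L (And \<phi> \<psi>) \<longleftrightarrow> wf_fm L \<phi> \<and> wf_fm L \<psi>"
| "wf_fm L (CConj \<Phi>) \<longleftrightarrow> (\<forall>n. wf_fm L (\<Phi> n))"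
| "wf_fm L (Ex x \<phi>) \<longleftrightarrow> wf_fm L \<phi>"

text \<open>Finitary and quantifier-free.\<close>

primrec qf :: "('f, 'r, 'v) fm \<Rightarrow> bool" where
  "qf (Eq s t) \<longleftrightarrow> True"
| "qf (Rel R ts) \<longleftrightarrow> True"
| "qf (Neg \<phi>) \<longleftrightarrow> qf \<phi>"
| "qf (And \<phi> \<psi>) \<longleftrightarrow> qf \<phi> \<and> qf \<psi>"
| "qf (CConj \<Phi>) \<longleftrightarrow> False"
| "qf (Ex x \<phi>) \<longleftrightarrow> False"

primrec fv :: "('f, 'r, 'v) fm \<Rightarrow> 'v set" where
  "fv (Eq s t) = set2_trm s \<union> set2_trm t"
| "fv (Rel R ts) = (\<Union>t\<in>set ts. set2_trm t)"
| "fv (Neg \<phi>) = fv \<phi>"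
| "fv (And \<phi> \<psi>) = fv \<phi> \<union> fv \<psi>"
| "fv (CConj \<Phi>) = (\<Union>n. fv (\<Phi> n))"
| "fv (Ex x \<phi>) = fv \<phi> - {x}"

primrec tval :: "('f, 'r, 'u, 'z) fostruct_scheme \<Rightarrow> ('v \<Rightarrow> 'u) \<Rightarrow> ('f, 'v) trm \<Rightarrow> 'u" where
  "tval M v (Var x) = v x"
| "tval M v (Fn f ts) = fint M f (map (tval M v) ts)"

primrec sat :: "('f, 'r, 'u, 'z) fostruct_scheme \<Rightarrow> ('f, 'r, 'v) fm \<Rightarrow> ('v \<Rightarrow> 'u) \<Rightarrow> bool" where
  "sat M (Eq s t) = (\<lambda>v. tval M v s = tval M v t)"
| "sat M (Rel R ts) = (\<lambda>v. rint M R (map (tval M v) ts))"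
| "sat M (Neg \<phi>) = (\<lambda>v. \<not> sat M \<phi> v)"
| "sat M (And \<phi> \<psi>) = (\<lambda>v. sat M \<phi> v \<and> sat M \<psi> v)"
| "sat M (CConj \<Phi>) = (\<lambda>v. \<forall>n. sat M (\<Phi> n) v)"
| "sat M (Ex x \<phi>) = (\<lambda>v. \<exists>d\<in>univ M. sat M \<phi> (v(x := d)))"


section \<open>Types\<close>

text \<open>The quantifier-free type of the tuple \<open>v\<close> indexed by the (possibly infinite) set \<open>J\<close>.
  The formulas \<open>x\<^sub>j = x\<^sub>j\<close> belong to it exactly for \<open>j \<in> J\<close>, so tuples of equal type have the same
  index set; in particular finite tuples of equal type have the same length.\<close>

definition qf_type ::
  "('f, 'r) lang \<Rightarrow> ('f, 'r, 'u, 'z) fostruct_scheme \<Rightarrow> 'i set \<Rightarrow> ('i \<Rightarrow> 'u)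
    \<Rightarrow> ('f, 'r, 'i) fm set" where
  "qf_type L M J v = {\<phi>. wf_fm L \<phi> \<and> qf \<phi> \<and> fv \<phi> \<subseteq> J \<and> sat M \<phi> v}"

definition tp ::
  "('f, 'r) lang \<Rightarrow> ('f, 'r, 'u, 'z) fostruct_scheme \<Rightarrow> 'u list \<Rightarrow> ('f, 'r, nat) fm set" where
  "tp L M as = qf_type L M {..<length as} (nth as)"

text \<open>The type of \<open>(A, as)\<close>, where the set \<open>A = e ` I\<close> is enumerated by \<open>e\<close> along \<open>I\<close>.\<close>

definition tp_enum ::
  "('f, 'r) lang \<Rightarrow> ('f, 'r, 'u, 'z) fostruct_scheme \<Rightarrow> nat set \<Rightarrow> (nat \<Rightarrow> 'u) \<Rightarrow> 'u list
    \<Rightarrow> ('f, 'r, nat + nat) fm set" where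
  "tp_enum L M I e as = qf_type L M (I <+> {..<length as}) (case_sum e (nth as))"

text \<open>The \<open>L\<^sub>\<omega>\<^sub>1\<^sub>\<omega>\<close>-type of a finite tuple over \<open>B\<close>: the variable \<open>Inl i\<close> stands for the \<open>i\<close>-th entry
  of the tuple and \<open>Inr b\<close> serves as a name for the parameter \<open>b \<in> B\<close>. Formulas have finitely many
  free variables (and then so have all of their subformulas).\<close>

definition inf_type_over ::
  "('f, 'r) lang \<Rightarrow> ('f, 'r, 'u, 'z) fostruct_scheme \<Rightarrow> 'u list \<Rightarrow> 'u set
    \<Rightarrow> ('f, 'r, nat + 'u) fm set" where
  "inf_type_over L M as B =
     {\<phi>. wf_fm L \<phi> \<and> finite (fv \<phi>) \<and> fv \<phi> \<subseteq> {..<length as} <+> B \<and>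
         sat M \<phi> (case_sum (nth as) id)}"


section \<open>Pregeometries\<close>

definition pregeometry :: "'u set \<Rightarrow> ('u set \<Rightarrow> 'u set) \<Rightarrow> bool" where
  "pregeometry S c \<longleftrightarrow>
     (\<forall>A. A \<subseteq> S \<longrightarrow> A \<subseteq> c A \<and> c A \<subseteq> S \<and> c (c A) = c A) \<and>
     (\<forall>A B. A \<subseteq> B \<and> B \<subseteq> S \<longrightarrow> c A \<subseteq> c B) \<and>
     (\<forall>A x. A \<subseteq> S \<and> x \<in> c A \<longrightarrow> (\<exists>F. finite F \<and> F \<subseteq> A \<and> x \<in> c F)) \<and>
     (\<forall>A x y. A \<subseteq> S \<and> x \<in> S \<and> y \<in> S \<and> x \<in> c (insert y A) \<and> x \<notin> c A \<longrightarrow> y \<in> c (insert x A))"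

definition cl_independent :: "('u set \<Rightarrow> 'u set) \<Rightarrow> 'u set \<Rightarrow> bool" where
  "cl_independent c I \<longleftrightarrow> (\<forall>x\<in>I. x \<notin> c (I - {x}))"

definition pg_basis :: "('u set \<Rightarrow> 'u set) \<Rightarrow> 'u set \<Rightarrow> 'u set \<Rightarrow> bool" where
  "pg_basis c X I \<longleftrightarrow> I \<subseteq> X \<and> cl_independent c I \<and> X \<subseteq> c I"

text \<open>Dimensions are cardinals, compared by \<open>=o\<close>. In a pregeometry all bases of a set are
  equinumerous, so the choice of the basis does not matter.\<close>

definition pgdim :: "('u set \<Rightarrow> 'u set) \<Rightarrow> 'u set \<Rightarrow> 'u rel" where
  "pgdim c X = |SOME I. pg_basis c X I|"

definition localize :: "('u set \<Rightarrow> 'u set) \<Rightarrow> 'u set \<Rightarrow> 'u set \<Rightarrow> 'u set" where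
  "localize c B = (\<lambda>X. c (X \<union> B))"

definition dim_over :: "('u set \<Rightarrow> 'u set) \<Rightarrow> 'u set \<Rightarrow> 'u set \<Rightarrow> 'u rel" where
  "dim_over c X B = pgdim (localize c B) X"

definition cl_indep :: "('u set \<Rightarrow> 'u set) \<Rightarrow> 'u list \<Rightarrow> 'u set \<Rightarrow> 'u set \<Rightarrow> bool" where
  "cl_indep c as C B \<longleftrightarrow> dim_over c (set as) (B \<union> C) =o dim_over c (set as) C"


section \<open>Quasiminimal pregeometry structures and quasiminimal classes\<close>

text \<open>Structures equipped with a closure operator; only the closures of subsets of the universe
  are relevant.\<close>

record ('f, 'r, 'u) pgstruct = "('f, 'r, 'u) fostruct" +
  cl :: "'u set \<Rightarrow> 'u set"

definition closed_in :: "('f, 'r, 'u) pgstruct \<Rightarrow> 'u set \<Rightarrow> bool" where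
  "closed_in M A \<longleftrightarrow> A \<subseteq> univ M \<and> cl M A = A"

definition QM1 :: "('f, 'r) lang \<Rightarrow> ('f, 'r, 'u) pgstruct \<Rightarrow> bool" where
  "QM1 L M \<longleftrightarrow>
     (\<forall>a\<in>univ M. \<forall>a'\<in>univ M. \<forall>bs bs'. set bs \<subseteq> univ M \<and> set bs' \<subseteq> univ M \<and>
        tp L M (a # bs) = tp L M (a' # bs') \<longrightarrow>
        (a \<in> cl M (set bs) \<longleftrightarrow> a' \<in> cl M (set bs')))"

definition QM2 :: "('f, 'r, 'u) pgstruct \<Rightarrow> bool" where
  "QM2 M \<longleftrightarrow> cinfinite (pgdim (cl M) (univ M))"

definition QM3 :: "('f, 'r, 'u) pgstruct \<Rightarrow> bool" where
  "QM3 M \<longleftrightarrow> (\<forall>A. finite A \<and> A \<subseteq> univ M \<longrightarrow> countable (cl M A))"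

text \<open>Countable sets are enumerated along index sets \<open>I \<subseteq> \<nat>\<close>, which accommodates finite
  and empty sets.\<close>

definition QM4 :: "('f, 'r) lang \<Rightarrow> ('f, 'r, 'u) pgstruct \<Rightarrow> bool" where
  "QM4 L M \<longleftrightarrow>
     (\<forall>(I :: nat set) e e' a a'.
        closed_in M (e ` I) \<and> closed_in M (e' ` I) \<and>
        tp_enum L M I e [] = tp_enum L M I e' [] \<and>
        a \<in> univ M - e ` I \<and> a' \<in> univ M - e' ` I \<longrightarrow>
        tp_enum L M I e [a] = tp_enum L M I e' [a'])"

definition QM5 :: "('f, 'r) lang \<Rightarrow> ('f, 'r, 'u) pgstruct \<Rightarrow> bool" where
  "QM5 L M \<longleftrightarrow>
     (\<forall>(I :: nat set) e e' bs bs' a.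
        (closed_in M (e ` I) \<or> e ` I = {}) \<and> (closed_in M (e' ` I) \<or> e' ` I = {}) \<and>
        tp_enum L M I e [] = tp_enum L M I e' [] \<and>
        set bs \<subseteq> univ M \<and> set bs' \<subseteq> univ M \<and>
        tp_enum L M I e bs = tp_enum L M I e' bs' \<and>
        a \<in> cl M (e ` I \<union> set bs) \<longrightarrow>
        (\<exists>a'\<in>univ M. tp_enum L M I e (bs @ [a]) = tp_enum L M I e' (bs' @ [a'])))"

definition weakly_quasiminimal :: "('f, 'r) lang \<Rightarrow> ('f, 'r, 'u) pgstruct \<Rightarrow> bool" where
  "weakly_quasiminimal L M \<longleftrightarrow>
     is_structure L M \<and> pregeometry (univ M) (cl M) \<and> QM1 L M \<and> QM3 M \<and> QM4 L M \<and> QM5 L M"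

definition quasiminimal :: "('f, 'r) lang \<Rightarrow> ('f, 'r, 'u) pgstruct \<Rightarrow> bool" where
  "quasiminimal L M \<longleftrightarrow> weakly_quasiminimal L M \<and> QM2 M"

definition closed_embedding ::
  "('f, 'r) lang \<Rightarrow> ('f, 'r, 'u) pgstruct \<Rightarrow> ('f, 'r, 'u) pgstruct \<Rightarrow> ('u \<Rightarrow> 'u) \<Rightarrow> bool" where
  "closed_embedding L M N \<theta> \<longleftrightarrow>
     fo_embedding L M N \<theta> \<and> (\<forall>A. A \<subseteq> univ M \<longrightarrow> \<theta> ` cl M A = cl N (\<theta> ` A))"

definition closed_substructure ::
  "('f, 'r) lang \<Rightarrow> ('f, 'r, 'u) pgstruct \<Rightarrow> ('f, 'r, 'u) pgstruct \<Rightarrow> bool" where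
  "closed_substructure L N M \<longleftrightarrow> closed_in M (univ N) \<and> closed_embedding L N M id"

text \<open>As classes are closed under isomorphism, it suffices to consider chains whose closed
  embeddings are inclusions. The closure operator on the union is determined by those of the members
  of the chain, since pregeometries have finite character.\<close>

definition closed_chain :: "('f, 'r) lang \<Rightarrow> ('f, 'r, 'u) pgstruct set \<Rightarrow> bool" where
  "closed_chain L K \<longleftrightarrow>
     K \<noteq> {} \<and> (\<forall>N\<in>K. \<forall>N'\<in>K. closed_embedding L N N' id \<or> closed_embedding L N' N id)"

definition is_chain_union ::
  "('f, 'r) lang \<Rightarrow> ('f, 'r, 'u) pgstruct set \<Rightarrow> ('f, 'r, 'u) pgstruct \<Rightarrow> bool" where
  "is_chain_union L K M \<longleftrightarrow>
     univ M = (\<Union>N\<in>K. univ N) \<and> (\<forall>N\<in>K. closed_embedding L N M id) \<and>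
     pregeometry (univ M) (cl M)"

text \<open>The part of the quasiminimal class generated by \<open>M\<^sub>0\<close> that consists of the structures with
  universe contained in the type \<open>'u\<close>. Since \<open>'u\<close> is arbitrary, this is no restriction: a given
  member of the class, \<open>M\<^sub>0\<close> and the structures used in its generation can all be placed in one
  sufficiently large type.\<close>

inductive qm_class ::
  "('f, 'r) lang \<Rightarrow> ('f, 'r, 'u) pgstruct \<Rightarrow> ('f, 'r, 'u) pgstruct \<Rightarrow> bool"
  for L :: "('f, 'r) lang" and M0 :: "('f, 'r, 'u) pgstruct" where
  generator: "qm_class L M0 M0"
| isomorphic: "\<lbrakk>qm_class L M0 M; closed_embedding L M N \<theta>; fo_iso L M N \<theta>\<rbrakk> \<Longrightarrow> qm_class L M0 N"
| closed_sub: "\<lbrakk>qm_class L M0 M; closed_substructure L N M\<rbrakk> \<Longrightarrow> qm_class L M0 N"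
| chain_union: "\<lbrakk>\<forall>N\<in>K. qm_class L M0 N; closed_chain L K; is_chain_union L K M\<rbrakk>
    \<Longrightarrow> qm_class L M0 M"


section \<open>H-structures\<close>

text \<open>In the expansion by \<open>H\<close>, the new unary predicate is the symbol \<open>None\<close>.\<close>

definition lang_H :: "('f, 'r) lang \<Rightarrow> ('f, 'r option) lang" where
  "lang_H L = \<lparr>fsyms = fsyms L, rsyms = insert None (Some ` rsyms L),
               farity = farity L, rarity = case_option 1 (rarity L)\<rparr>"

definition expand_H ::
  "('f, 'r, 'u, 'z) fostruct_scheme \<Rightarrow> 'u set \<Rightarrow> ('f, 'r option, 'u) fostruct" where
  "expand_H M H = \<lparr>univ = univ M, fint = fint M,
                   rint = case_option (\<lambda>xs. hd xs \<in> H) (rint M)\<rparr>"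

definition dense_codense :: "('f, 'r, 'u) pgstruct \<Rightarrow> 'u set \<Rightarrow> bool" where
  "dense_codense M H \<longleftrightarrow>
     (\<forall>bs. set bs \<subseteq> univ M \<longrightarrow>
        (\<exists>a\<in>H. a \<notin> cl M (set bs)) \<and> (\<exists>a\<in>univ M. a \<notin> cl M (set bs \<union> H)))"

definition H_structure :: "('f, 'r, 'u) pgstruct \<Rightarrow> 'u set \<Rightarrow> bool" where
  "H_structure M H \<longleftrightarrow> H \<subseteq> univ M \<and> dense_codense M H \<and> cl_independent (cl M) H"

definition tp_H ::
  "('f, 'r) lang \<Rightarrow> ('f, 'r, 'u) pgstruct \<Rightarrow> 'u set \<Rightarrow> 'u list \<Rightarrow> 'u set
    \<Rightarrow> ('f, 'r option, nat + 'u) fm set" where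
  "tp_H L M H as B = inf_type_over (lang_H L) (expand_H M H) as B"

text \<open>Below, \<open>LEAST\<close> is with respect to inclusion. \<open>HB_closed\<close> is meant for \<open>B\<close> that are
  closed and \<open>H\<close>-independent, that is, \<open>dim (bs/B \<inter> H) = dim (bs/H)\<close> for all \<open>bs\<close> in \<open>B\<close>. For such
  \<open>B\<close> one has \<open>HB_set B \<subseteq> B\<close>, so that \<open>HB\<close> agrees with \<open>HB_closed\<close>, and \<open>cl (B \<union> HB_set B)\<close> is such
  a set for every \<open>B\<close>.\<close>

definition HB_closed ::
  "('f, 'r, 'u) pgstruct \<Rightarrow> 'u set \<Rightarrow> 'u list \<Rightarrow> 'u set \<Rightarrow> 'u set" where
  "HB_closed M H as B =
     (LEAST H0. finite H0 \<and> H0 \<subseteq> H \<and>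
        dim_over (cl M) (set as) (B \<union> H) =o dim_over (cl M) (set as) (B \<union> H0))"

definition HB_set :: "('f, 'r, 'u) pgstruct \<Rightarrow> 'u set \<Rightarrow> 'u set \<Rightarrow> 'u set" where
  "HB_set M H A =
     (LEAST H0. H0 \<subseteq> H \<and>
        (\<forall>as. set as \<subseteq> A \<longrightarrow> dim_over (cl M) (set as) H0 =o dim_over (cl M) (set as) H))"

definition HB :: "('f, 'r, 'u) pgstruct \<Rightarrow> 'u set \<Rightarrow> 'u list \<Rightarrow> 'u set \<Rightarrow> 'u set" where
  "HB M H as B = HB_closed M H as (cl M (B \<union> HB_set M H B))"

text \<open>\<open>indep_tuple M H as C B\<close> and \<open>indep M H A C B\<close>: independence from \<open>B\<close> over \<open>C\<close>.\<close>

definition indep_tuple ::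
  "('f, 'r, 'u) pgstruct \<Rightarrow> 'u set \<Rightarrow> 'u list \<Rightarrow> 'u set \<Rightarrow> 'u set \<Rightarrow> bool" where
  "indep_tuple M H as C B \<longleftrightarrow>
     cl_indep (cl M) as (C \<union> H) B \<and> HB M H as (cl M C) = HB M H as (cl M (C \<union> B))"

definition indep ::
  "('f, 'r, 'u) pgstruct \<Rightarrow> 'u set \<Rightarrow> 'u set \<Rightarrow> 'u set \<Rightarrow> 'u set \<Rightarrow> bool" where
  "indep M H A C B \<longleftrightarrow> (\<forall>as. set as \<subseteq> A \<longrightarrow> indep_tuple M H as C B)"

end

theory Submission
  imports Defs
begin

text \<open>
  All properties except extension belong to the theory of pregeometries. Write \<open>orth D X E\<close> for
  \<open>cl\<close>-independence of \<open>X\<close> from \<open>E\<close> over \<open>D\<close>. As \<open>H\<close> is independent, a basis of \<open>X\<close> over \<open>H\<close> together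
  with \<open>H\<close> is an independent set, and in it every element of \<open>X\<close> has a least support. Collecting the
  parts of these supports in \<open>H\<close> gives the least \<open>h \<subseteq> H\<close> with \<open>orth h X H\<close>; this is \<open>hbasis X\<close>, the
  \<open>H\<close>-basis of \<open>X\<close> (\<open>orth_hbasis_iff\<close>). Relative \<open>H\<close>-bases are differences: the \<open>H\<close>-basis of \<open>a\<close> over
  \<open>C\<close> is \<open>hbasis (C \<union> a) - hbasis C\<close> (\<open>HB_eq\<close>). If \<open>a\<close> and \<open>B\<close> are \<open>cl\<close>-independent over \<open>C \<union> H\<close>,
  then \<open>hbasis (C \<union> a \<union> B)\<close> is the union of \<open>hbasis (C \<union> a)\<close> and \<open>hbasis (C \<union> B)\<close> (\<open>hbasis_orth_Un\<close>),
  so that in this situation the equality of \<open>H\<close>-bases in the definition of independence says exactly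
  that \<open>hbasis (C \<union> a)\<close> and \<open>hbasis (C \<union> B)\<close> have no common element outside \<open>hbasis C\<close>. The
  description \<open>h_indep\<close> of independence obtained in this way (\<open>indep_iff_h_indep\<close>) is visibly
  symmetric and of finite character, and transitivity follows from the transitivity of \<open>orth\<close>
  and the formula for unions.
  
  For extension, let \<open>W\<close> consist of \<open>hbasis B\<close> and a basis of \<open>B\<close> over \<open>H\<close>. The tuple \<open>as\<close> lies in the
  closure of \<open>W \<union> S\<close>, where \<open>S\<close> is finite, independent over \<open>W\<close>, and consists of elements of \<open>H\<close> and of
  elements independent over \<open>B \<union> H\<close>. By the cardinality assumptions there is a copy \<open>S'\<close> of \<open>S\<close>
  that avoids \<open>hbasis C\<close> and whose part outside \<open>H\<close> is independent over \<open>C \<union> H\<close>. For countable \<open>E \<subseteq> W\<close>, the axioms QM4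
  and QM5 extend the map that fixes \<open>cl E\<close> and sends \<open>S\<close> to \<open>S'\<close> to an isomorphism between the closures
  of \<open>E \<union> S\<close> and \<open>E \<union> S'\<close>, and the image of \<open>as\<close> is a candidate for the required tuple. All
  candidates lie in one countable set. If each of them were refuted by some finite part of \<open>W\<close>, then
  the union of these parts would be countable, and the candidate that it yields would be a
  contradiction. So one candidate \<open>cs\<close> is compatible with all finite parts of \<open>W\<close>
  (\<open>h_indep_extension\<close>). Equality of types follows because the isomorphisms between closures of
  finite sets \<open>h \<union> b\<close>, with \<open>h \<subseteq> H\<close> and \<open>b\<close> independent over \<open>H\<close>, form a back-and-forth system by
  density and codensity, and hence preserve the infinitary formulas of the expanded language
  (\<open>h_iso_sat\<close>).
  
  It remains to verify the axioms for \<open>M\<close>, which is only known to be generated from \<open>M0\<close>. Axiom QM5 is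
  awkward for unions of chains, since a countable closed set of the union may lie in no member of the
  chain. Instead, one observes that all class constructions preserve the following property: the
  closure of every finite set embeds into \<open>M0\<close> as a closed set. As \<open>M0\<close> is
  infinite-dimensional, such embeddings can be extended one generator at a time, so that the closures
  of countable sets embed into \<open>M0\<close> as well, and the axioms can be pulled back along these embeddings
  (\<open>weak_qm_M\<close>).
\<close>

section \<open>Bases and independence in pregeometries\<close>

text \<open>
  A closure operator defined on all subsets of a type spares the side condition that sets lie in the
  universe.
\<close>

locale total_pregeometry =
  fixes K :: "'u set \<Rightarrow> 'u set"
  assumes pg: "pregeometry UNIV K"
begin

lemma K_ext: "A \<subseteq> K A"
  using pg by (simp add: pregeometry_def)

lemma K_mono: "A \<subseteq> B \<Longrightarrow> K A \<subseteq> K B"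
  using pg by (simp add: pregeometry_def)

lemma K_idem: "K (K A) = K A"
  using pg by (simp add: pregeometry_def)

lemma K_least: "A \<subseteq> K B \<Longrightarrow> K A \<subseteq> K B"
  using K_mono K_idem by blast

lemma K_finite: "x \<in> K A \<Longrightarrow> \<exists>F. finite F \<and> F \<subseteq> A \<and> x \<in> K F"
  using pg by (simp add: pregeometry_def)

lemma K_exchange: "x \<in> K (insert y A) \<Longrightarrow> x \<notin> K A \<Longrightarrow> y \<in> K (insert x A)"
  using pg unfolding pregeometry_def by blast

text \<open>
  Finite character for finite sets of elements, where the part \<open>B\<close> of the generators need not be
  made finite.
\<close>

lemma K_finite_set:
  assumes "finite X" "X \<subseteq> K (A \<union> B)"
  shows "\<exists>F. finite F \<and> F \<subseteq> A \<and> X \<subseteq> K (F \<union> B)"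
  using assms
proof (induction X)
  case empty
  then show ?case by auto
next
  case (insert x X)
  obtain F where F: "finite F" "F \<subseteq> A" "X \<subseteq> K (F \<union> B)" using insert by auto
  obtain G where G: "finite G" "G \<subseteq> A \<union> B" "x \<in> K G"
    using insert.prems K_finite[of x "A \<union> B"] by auto
  have "K G \<subseteq> K ((F \<union> (G \<inter> A)) \<union> B)" "K (F \<union> B) \<subseteq> K ((F \<union> (G \<inter> A)) \<union> B)"
    by (rule K_mono, use G in blast)+
  then show ?case using F G by (intro exI[of _ "F \<union> (G \<inter> A)"]) blast
qed

lemma K_Un_K: "K (K A \<union> B) = K (A \<union> B)"
proof
  have "K A \<subseteq> K (A \<union> B)" by (rule K_mono) blast
  then show "K (K A \<union> B) \<subseteq> K (A \<union> B)"
    by (intro K_least) (use K_ext[of "A \<union> B"] in blast)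
  show "K (A \<union> B) \<subseteq> K (K A \<union> B)" by (rule K_mono) (use K_ext[of A] in blast)
qed

definition indep_over :: "'u set \<Rightarrow> 'u set \<Rightarrow> bool" where
  "indep_over D S \<longleftrightarrow> cl_independent (localize K D) S"

lemma indep_over_iff: "indep_over D S \<longleftrightarrow> (\<forall>x\<in>S. x \<notin> K ((S - {x}) \<union> D))"
  by (simp add: indep_over_def cl_independent_def localize_def)

lemma indep_over_base:
  assumes "indep_over D S" "D' \<subseteq> K D"
  shows "indep_over D' S"
proof -
  have "K ((S - {x}) \<union> D') \<subseteq> K ((S - {x}) \<union> D)" for x
  proof (rule K_least)
    have "K D \<subseteq> K ((S - {x}) \<union> D)" by (rule K_mono) blast
    then show "(S - {x}) \<union> D' \<subseteq> K ((S - {x}) \<union> D)"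
      using K_ext[of "(S - {x}) \<union> D"] assms(2) by blast
  qed
  then show ?thesis using assms(1) unfolding indep_over_iff by blast
qed

lemma indep_over_mono_base: "indep_over D S \<Longrightarrow> D' \<subseteq> D \<Longrightarrow> indep_over D' S"
  using indep_over_base K_ext by blast

lemma indep_over_subset:
  assumes "indep_over D S" "S' \<subseteq> S"
  shows "indep_over D S'"
proof -
  have "K ((S' - {x}) \<union> D) \<subseteq> K ((S - {x}) \<union> D)" for x
    by (rule K_mono) (use assms(2) in blast)
  then show ?thesis using assms unfolding indep_over_iff by blast
qed

lemma indep_over_empty: "indep_over D {}"
  by (simp add: indep_over_iff)

lemma indep_over_finiteI:
  assumes "\<And>F. finite F \<Longrightarrow> F \<subseteq> S \<Longrightarrow> indep_over D F"
  shows "indep_over D S"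
  unfolding indep_over_iff
proof (intro ballI notI)
  fix x assume x: "x \<in> S" "x \<in> K ((S - {x}) \<union> D)"
  obtain F where F: "finite F" "F \<subseteq> S - {x}" "x \<in> K (F \<union> D)"
    using K_finite_set[of "{x}" "S - {x}" D] x by auto
  have "indep_over D (insert x F)" using assms F x by auto
  moreover have "insert x F - {x} = F" using F by auto
  ultimately show False using F unfolding indep_over_iff by (metis insertI1)
qed

text \<open>
  If some \<open>y \<in> S\<close> became dependent on adding \<open>x\<close>, then exchange would put \<open>x\<close> into the closure.
\<close>

lemma indep_over_insert:
  assumes "indep_over D S" "x \<notin> K (S \<union> D)"
  shows "indep_over D (insert x S)"
  unfolding indep_over_iff
proof (intro ballI notI)
  fix y assume y: "y \<in> insert x S" "y \<in> K ((insert x S - {y}) \<union> D)"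
  have xS: "x \<notin> S" using assms(2) K_ext by blast
  show False
  proof (cases "y = x")
    case True
    then show False using y xS assms(2) by simp
  next
    case False
    then have "y \<in> S" "(insert x S - {y}) \<union> D = insert x ((S - {y}) \<union> D)" using y by auto
    then have "x \<in> K (insert y ((S - {y}) \<union> D))"
      using K_exchange y assms(1) unfolding indep_over_iff by metis
    moreover have "insert y ((S - {y}) \<union> D) = S \<union> D" using \<open>y \<in> S\<close> by blast
    ultimately show False using assms(2) by simp
  qed
qed

text \<open>
  By finite character it suffices to add the elements of \<open>T\<close> one at a time.
\<close>

lemma indep_over_Un:
  assumes "indep_over D S" "indep_over (D \<union> S) T"
  shows "indep_over D (S \<union> T)"
proof -
  have fin: "indep_over D (S \<union> F)" if "finite F" "F \<subseteq> T" for F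
    using that
  proof (induction F)
    case empty
    then show ?case using assms by simp
  next
    case (insert t F)
    have "indep_over (D \<union> S) (insert t F)" using assms(2) insert.prems by (rule indep_over_subset)
    then have "t \<notin> K ((insert t F - {t}) \<union> (D \<union> S))" unfolding indep_over_iff by blast
    moreover have "(insert t F - {t}) \<union> (D \<union> S) = (S \<union> F) \<union> D" using insert by auto
    ultimately show ?case using insert indep_over_insert by auto
  qed
  show ?thesis
  proof (rule indep_over_finiteI)
    fix F assume "finite F" "F \<subseteq> S \<union> T"
    then show "indep_over D F"
      by (intro indep_over_subset[OF fin[of "F \<inter> T"]]) auto
  qed
qed

lemma indep_over_UnD:
  assumes "indep_over D (S \<union> T)" "S \<inter> T = {}"
  shows "indep_over (D \<union> S) T"
  unfolding indep_over_iff
proof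
  fix x assume "x \<in> T"
  then have "(T - {x}) \<union> (D \<union> S) = (S \<union> T - {x}) \<union> D" using assms by auto
  then show "x \<notin> K ((T - {x}) \<union> (D \<union> S))"
    using assms \<open>x \<in> T\<close> unfolding indep_over_iff by auto
qed

lemma indep_over_disjoint: "indep_over D S \<Longrightarrow> S \<inter> K D = {}"
  using K_mono[OF Un_upper2] unfolding indep_over_iff by blast

text \<open>
  Both conditions say that the disjoint union of \<open>S\<close> and \<open>T\<close> is independent over \<open>D\<close>. This is the
  symmetry on which that of \<open>orth\<close> rests.
\<close>

lemma indep_over_swap:
  assumes "indep_over D S" "indep_over (D \<union> S) T"
  shows "indep_over (D \<union> T) S"
proof -
  have "S \<inter> T = {}" using indep_over_disjoint[OF assms(2)] K_ext[of "D \<union> S"] by blast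
  then show ?thesis using indep_over_UnD[of D T S] indep_over_Un[OF assms] by (simp add: Un_commute Int_commute)
qed

definition basis_over :: "'u set \<Rightarrow> 'u set \<Rightarrow> 'u set \<Rightarrow> bool" where
  "basis_over D X T \<longleftrightarrow> T \<subseteq> X \<and> indep_over D T \<and> X \<subseteq> K (T \<union> D)"

lemma basis_over_extend:
  assumes "indep_over D S" "S \<subseteq> X"
  obtains T where "S \<subseteq> T" "basis_over D X T"
proof -
  let ?A = "{T. S \<subseteq> T \<and> T \<subseteq> X \<and> indep_over D T}"
  have "\<exists>T\<in>?A. \<forall>X\<in>?A. T \<subseteq> X \<longrightarrow> X = T"
  proof (rule subset_Zorn_nonempty)
    show "?A \<noteq> {}" using assms by auto
    fix C assume C: "C \<noteq> {}" "subset.chain ?A C"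
    have "indep_over D (\<Union>C)"
    proof (rule indep_over_finiteI)
      fix F assume "finite F" "F \<subseteq> \<Union>C"
      then obtain T where "T \<in> C" "F \<subseteq> T" using finite_subset_Union_chain C by metis
      moreover have "indep_over D T" using C \<open>T \<in> C\<close> unfolding subset.chain_def by blast
      ultimately show "indep_over D F" using indep_over_subset by simp
    qed
    moreover have "C \<subseteq> ?A" using C unfolding subset.chain_def by simp
    ultimately show "\<Union>C \<in> ?A" using C(1) by blast
  qed
  then obtain T where T: "S \<subseteq> T" "T \<subseteq> X" "indep_over D T"
    and max: "\<And>T'. T \<subseteq> T' \<Longrightarrow> T' \<subseteq> X \<Longrightarrow> indep_over D T' \<Longrightarrow> T' = T"
    by auto
  have "x \<in> K (T \<union> D)" if "x \<in> X" for x
  proof (rule ccontr)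
    assume n: "x \<notin> K (T \<union> D)"
    then have "insert x T = T" using T that by (intro max indep_over_insert) auto
    then show False using n K_ext[of "T \<union> D"] by blast
  qed
  then show thesis using that T unfolding basis_over_def by blast
qed

lemma basis_over_exists: obtains T where "basis_over D X T"
  using basis_over_extend[OF indep_over_empty, of X] by blast

text \<open>
  The exchange argument: an element \<open>x \<in> I\<close> outside the closure of the other generators can take the place
  of the generator \<open>y\<close>; localizing at \<open>x\<close> then reduces the claim to \<open>I - {x}\<close> and one generator less.
\<close>

lemma steinitz:
  assumes "finite J" "indep_over D I" "I \<subseteq> K (J \<union> D)"
  shows "finite I \<and> card I \<le> card J"
  using assms
proof (induction J arbitrary: D I)
  case empty
  then have "I = {}" using indep_over_disjoint[of D I] by auto
  then show ?case by simp
next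
  case (insert y J)
  show ?case
  proof (cases "I \<subseteq> K (J \<union> D)")
    case True
    then show ?thesis using insert by (metis card_insert_le le_trans)
  next
    case False
    then obtain x where x: "x \<in> I" "x \<notin> K (J \<union> D)" by blast
    have "x \<in> K (insert y (J \<union> D))" using x insert.prems by auto
    then have y: "y \<in> K (insert x (J \<union> D))" using K_exchange x by blast
    have 1: "indep_over (D \<union> {x}) (I - {x})"
      using indep_over_UnD[of D "{x}" "I - {x}"] insert.prems x by (simp add: insert_absorb)
    have "insert y J \<union> D \<subseteq> K (insert x (J \<union> D))"
      using y K_ext[of "insert x (J \<union> D)"] by blast
    then have "I \<subseteq> K (insert x (J \<union> D))" using insert.prems K_least by blast
    then have 2: "I - {x} \<subseteq> K (J \<union> (D \<union> {x}))" by auto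
    have "finite (I - {x}) \<and> card (I - {x}) \<le> card J" using insert.IH[OF 1 2] .
    then show ?thesis using x insert.hyps by (auto simp: card_Diff_singleton)
  qed
qed

lemma card_basis_over:
  assumes "finite X" "basis_over D X T" "basis_over D X T'"
  shows "card T = card T'"
proof -
  have "finite T" "finite T'" using assms finite_subset unfolding basis_over_def by blast+
  then show ?thesis using steinitz[of T' D T] steinitz[of T D T'] assms unfolding basis_over_def
    by (meson le_antisym subset_trans)
qed

text \<open>
  Independence of \<open>X\<close> from \<open>E\<close> over \<open>D\<close>. For finite \<open>X\<close> this says that \<open>X\<close> has the same dimension over
  \<open>D\<close> and over \<open>D \<union> E\<close>; the formulation by independent subsets also makes sense for infinite \<open>X\<close>.
\<close>

definition orth :: "'u set \<Rightarrow> 'u set \<Rightarrow> 'u set \<Rightarrow> bool" where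
  "orth D X E \<longleftrightarrow> (\<forall>S\<subseteq>X. indep_over D S \<longrightarrow> indep_over (D \<union> E) S)"

lemma orth_mono: "orth D X E \<Longrightarrow> X' \<subseteq> X \<Longrightarrow> E' \<subseteq> D \<union> E \<Longrightarrow> orth D X' E'"
  unfolding orth_def by (meson indep_over_mono_base le_sup_iff subset_trans sup_ge1)

text \<open>
  The set \<open>T\<close> is independent over \<open>D\<close> with any subset \<open>S\<close> of \<open>E\<close>. If \<open>S\<close> is itself independent over
  \<open>D\<close>, then \<open>S\<close> and \<open>T\<close> can be swapped, so \<open>S\<close> stays independent over \<open>D \<union> T\<close>, whose closure
  contains \<open>X\<close>.
\<close>

lemma orth_sym_spanned:
  assumes "indep_over (D \<union> E) T" "X \<subseteq> K (T \<union> D)"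
  shows "orth D E X"
  unfolding orth_def
proof (intro allI impI)
  fix S assume S: "S \<subseteq> E" "indep_over D S"
  have "indep_over (D \<union> S) T" using assms(1) S by (auto intro: indep_over_mono_base)
  then have "indep_over (D \<union> T) S" by (rule indep_over_swap[OF S(2)])
  moreover have "D \<union> X \<subseteq> K (D \<union> T)" using assms(2) K_ext[of "D \<union> T"] by (auto simp: Un_commute)
  ultimately show "indep_over (D \<union> X) S" by (rule indep_over_base)
qed

lemma orth_sym: assumes "orth D X E" shows "orth D E X"
proof -
  obtain T where "basis_over D X T" using basis_over_exists by blast
  then show ?thesis using assms orth_sym_spanned unfolding orth_def basis_over_def by blast
qed

lemma orth_spanned: "indep_over (D \<union> E) T \<Longrightarrow> X \<subseteq> K (T \<union> D) \<Longrightarrow> orth D X E"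
  using orth_sym_spanned orth_sym by blast

lemma orth_finiteI:
  assumes "\<And>F. finite F \<Longrightarrow> F \<subseteq> X \<Longrightarrow> orth D F E"
  shows "orth D X E"
  unfolding orth_def
proof (intro allI impI)
  fix S assume S: "S \<subseteq> X" "indep_over D S"
  show "indep_over (D \<union> E) S"
  proof (rule indep_over_finiteI)
    fix F assume "finite F" "F \<subseteq> S"
    then have "orth D F E" "indep_over D F"
      using assms[of F] S indep_over_subset[OF S(2)] by auto
    then show "indep_over (D \<union> E) F" unfolding orth_def by simp
  qed
qed

lemma orth_trans:
  assumes "D \<subseteq> D'" "D' \<subseteq> E"
  shows "orth D X E \<longleftrightarrow> orth D X D' \<and> orth D' X E"
proof
  assume o: "orth D X E"
  obtain T where T: "basis_over D X T" using basis_over_exists by blast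
  have "indep_over (D' \<union> E) T"
    using o T assms unfolding orth_def basis_over_def by (auto simp: Un_absorb1)
  moreover have "X \<subseteq> K (T \<union> D')"
    using T K_mono[of "T \<union> D" "T \<union> D'"] assms unfolding basis_over_def by blast
  ultimately have "orth D' X E" by (rule orth_spanned)
  moreover have "orth D X D'" using orth_mono[OF o, of X D'] assms by blast
  ultimately show "orth D X D' \<and> orth D' X E" by simp
next
  assume "orth D X D' \<and> orth D' X E"
  then show "orth D X E" using assms unfolding orth_def by (simp add: Un_absorb1 subset_trans)
qed

text \<open>
  A basis \<open>T\<close> of \<open>X\<close> over \<open>D \<union> H\<close> is independent over the smaller set \<open>D \<union> h\<close>. If it does not span \<open>X\<close>
  there, then adding an element outside the span gives a subset of \<open>X\<close> that is independent over \<open>D \<union> h\<close> but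
  not over \<open>D \<union> H\<close>.
\<close>

lemma orth_Un_iff_basis:
  assumes "basis_over (D \<union> H) X T" "h \<subseteq> H"
  shows "orth (D \<union> h) X H \<longleftrightarrow> X \<subseteq> K (T \<union> (D \<union> h))"
proof
  assume "X \<subseteq> K (T \<union> (D \<union> h))"
  moreover have "indep_over (D \<union> h \<union> H) T"
    using assms unfolding basis_over_def by (simp add: Un_assoc Un_absorb1)
  ultimately show "orth (D \<union> h) X H" using orth_spanned by blast
next
  assume o: "orth (D \<union> h) X H"
  show "X \<subseteq> K (T \<union> (D \<union> h))"
  proof (rule subsetI, rule ccontr)
    fix x assume x: "x \<in> X" "x \<notin> K (T \<union> (D \<union> h))"
    have "indep_over (D \<union> h) T"
      using assms unfolding basis_over_def by (auto intro: indep_over_mono_base)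
    then have "indep_over (D \<union> h) (insert x T)" using x indep_over_insert by blast
    then have "indep_over (D \<union> h \<union> H) (insert x T)"
      using o[unfolded orth_def, rule_format, of "insert x T"] x assms(1)
      unfolding basis_over_def by simp
    then have i: "indep_over (D \<union> H) (insert x T)" by (rule indep_over_mono_base) blast
    have "x \<notin> T" using x(2) K_ext[of "T \<union> (D \<union> h)"] by blast
    then have "x \<notin> K (T \<union> (D \<union> H))" using i unfolding indep_over_iff by (metis Diff_insert_absorb insertI1)
    then show False using x(1) assms(1) unfolding basis_over_def by blast
  qed
qed

end

section \<open>Supports in an independent set\<close>

locale pregeometry_with_independent_set = total_pregeometry K for K :: "'u set \<Rightarrow> 'u set" +
  fixes H :: "'u set"
  assumes indep_H: "indep_over {} H"
begin

text \<open>
  The elements of \<open>H\<close> that cannot be omitted. That these form the least \<open>h \<subseteq> H\<close> with \<open>orth h X H\<close> is shown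
  in \<open>orth_hbasis_iff\<close>; defining the set in this way avoids the choice of a basis of \<open>X\<close> over \<open>H\<close>.
\<close>

definition hbasis :: "'u set \<Rightarrow> 'u set" where
  "hbasis X = {y\<in>H. \<not> orth (H - {y}) X H}"

lemma hbasis_subset: "hbasis X \<subseteq> H" by (auto simp: hbasis_def)

lemma indep_Un_H: "indep_over H T \<Longrightarrow> indep_over {} (H \<union> T)"
  using indep_over_Un[of "{}" H T] indep_H by simp

text \<open>
  Let \<open>T\<close> be a basis of \<open>X\<close> over \<open>H\<close>. By \<open>orth_Un_iff_basis\<close> one has to find the least \<open>h \<subseteq> H\<close> such that
  \<open>T \<union> h\<close> spans \<open>X\<close>. For \<open>x \<in> X\<close> take a smallest \<open>F \<subseteq> H\<close> such that \<open>x\<close> is in the closure of \<open>F \<union> T\<close>. No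
  \<open>y \<in> F\<close> can be omitted even if the rest of \<open>H\<close> is allowed: by exchange \<open>y\<close> is in the closure of
  \<open>F - {y}\<close>, \<open>T\<close> and \<open>x\<close>, whereas \<open>H \<union> T\<close> is independent.
\<close>

lemma orth_hbasis_iff:
  assumes "h \<subseteq> H"
  shows "orth h X H \<longleftrightarrow> hbasis X \<subseteq> h"
proof -
  obtain T where T: "basis_over ({} \<union> H) X T" using basis_over_exists by blast
  have iff: "orth h X H \<longleftrightarrow> X \<subseteq> K (T \<union> h)" if "h \<subseteq> H" for h
    using orth_Un_iff_basis[OF T that] by simp
  have ind: "indep_over {} (H \<union> T)" using T indep_Un_H unfolding basis_over_def by simp
  have disj: "H \<inter> T = {}"
    using T indep_over_disjoint[of H T] K_ext[of H] unfolding basis_over_def by auto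
  have "x \<in> K (T \<union> hbasis X)" if "x \<in> X" for x
  proof -
    have "\<exists>F. finite F \<and> F \<subseteq> H \<and> x \<in> K (F \<union> T)"
      using K_finite_set[of "{x}" H T] T that unfolding basis_over_def by (auto simp: Un_commute)
    then obtain F where F: "finite F" "F \<subseteq> H" "x \<in> K (F \<union> T)"
      and min: "\<And>F'. finite F' \<Longrightarrow> F' \<subseteq> H \<Longrightarrow> x \<in> K (F' \<union> T) \<Longrightarrow> card F \<le> card F'"
      using ex_has_least_nat[of "\<lambda>F. finite F \<and> F \<subseteq> H \<and> x \<in> K (F \<union> T)" _ card] by metis
    have "F \<subseteq> hbasis X"
    proof
      fix y assume y: "y \<in> F"
      then have "x \<notin> K ((F - {y}) \<union> T)"
        using min[of "F - {y}"] F by (metis card_Diff1_less finite_Diff leD Diff_subset subset_trans)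
      moreover have "F \<union> T = insert y ((F - {y}) \<union> T)" using y by blast
      ultimately have "y \<in> K (insert x ((F - {y}) \<union> T))" using F K_exchange by metis
      moreover have "y \<notin> K ((H \<union> T) - {y})" using ind y F unfolding indep_over_iff by auto
      moreover have "insert x ((F - {y}) \<union> T) \<subseteq> K ((H \<union> T) - {y})" if "x \<in> K (T \<union> (H - {y}))"
      proof -
        have "T \<union> (H - {y}) = (H \<union> T) - {y}" using disj y F by blast
        moreover have "(F - {y}) \<union> T \<subseteq> (H \<union> T) - {y}" using disj y F by blast
        ultimately show ?thesis using that K_ext[of "(H \<union> T) - {y}"] by auto
      qed
      ultimately have "x \<notin> K (T \<union> (H - {y}))"
        using K_least[of "insert x ((F - {y}) \<union> T)" "(H \<union> T) - {y}"] by blast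
      then have "\<not> orth (H - {y}) X H" using iff[of "H - {y}"] \<open>x \<in> X\<close> by auto
      then show "y \<in> hbasis X" using y F unfolding hbasis_def by blast
    qed
    then show ?thesis using F K_mono[of "F \<union> T" "T \<union> hbasis X"] by blast
  qed
  then have span: "X \<subseteq> K (T \<union> hbasis X)" by blast
  show ?thesis
  proof
    assume "orth h X H"
    then have X: "X \<subseteq> K (T \<union> h)" using iff[OF assms] by simp
    show "hbasis X \<subseteq> h"
    proof
      fix y assume y: "y \<in> hbasis X"
      show "y \<in> h"
      proof (rule ccontr)
        assume "y \<notin> h"
        then have "K (T \<union> h) \<subseteq> K (T \<union> (H - {y}))" using assms by (intro K_mono) blast
        then have "orth (H - {y}) X H" using X iff[of "H - {y}"] by auto
        then show False using y unfolding hbasis_def by blast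
      qed
    qed
  next
    assume "hbasis X \<subseteq> h"
    then have "K (T \<union> hbasis X) \<subseteq> K (T \<union> h)" by (intro K_mono) blast
    then show "orth h X H" using span iff[OF assms] by simp
  qed
qed

lemma orth_hbasis: "orth (hbasis X) X H"
  using orth_hbasis_iff hbasis_subset by blast

lemma basis_span_iff:
  assumes "basis_over H X T" "h \<subseteq> H"
  shows "X \<subseteq> K (T \<union> h) \<longleftrightarrow> hbasis X \<subseteq> h"
  using orth_Un_iff_basis[of "{}" H X T h] orth_hbasis_iff assms by simp

text \<open>
  In contrast to \<open>basis_span_iff\<close>, the spanning set \<open>T\<close> is not required to lie in \<open>X\<close>. This gives all
  upper bounds for \<open>H\<close>-bases.
\<close>

lemma hbasis_spanned:
  assumes "h \<subseteq> H" "indep_over H T" "X \<subseteq> K (T \<union> h)"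
  shows "hbasis X \<subseteq> h"
  using orth_spanned[of h H T X] orth_hbasis_iff assms by (simp add: Un_absorb1)

lemma hbasis_mono: "X \<subseteq> Y \<Longrightarrow> hbasis X \<subseteq> hbasis Y"
  using orth_mono[OF orth_hbasis[of Y], of X H] orth_hbasis_iff[OF hbasis_subset] by blast

lemma hbasis_K: "hbasis (K X) = hbasis X"
proof
  obtain T where T: "basis_over H X T" using basis_over_exists by blast
  then have "X \<subseteq> K (T \<union> hbasis X)" using basis_span_iff[OF T hbasis_subset] by simp
  then show "hbasis (K X) \<subseteq> hbasis X"
    using hbasis_spanned[OF hbasis_subset, of T "K X" X] T K_least[of X "T \<union> hbasis X"] unfolding basis_over_def by simp
  show "hbasis X \<subseteq> hbasis (K X)" using hbasis_mono[OF K_ext] .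
qed

lemma hbasis_K_Un: "hbasis (K X \<union> Y) = hbasis (X \<union> Y)"
  using hbasis_K K_Un_K by metis

lemma hbasis_finite:
  assumes "y \<in> hbasis X"
  obtains F where "finite F" "F \<subseteq> X" "y \<in> hbasis F"
  using assms orth_finiteI[of X "H - {y}" H] unfolding hbasis_def by blast

lemma hbasis_finite_Un:
  assumes "y \<in> hbasis (C \<union> X)"
  obtains F where "finite F" "F \<subseteq> X" "y \<in> hbasis (C \<union> F)"
proof -
  obtain F where "finite F" "F \<subseteq> C \<union> X" "y \<in> hbasis F" using hbasis_finite[OF assms] .
  then show thesis using that[of "F \<inter> X"] hbasis_mono[of F "C \<union> (F \<inter> X)"] by blast
qed

lemma basis_Un:
  assumes "basis_over D X S" "basis_over (X \<union> D) Y T"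
  shows "basis_over D (X \<union> Y) (S \<union> T)"
proof -
  have 1: "indep_over (D \<union> S) T"
    using assms unfolding basis_over_def by (auto intro: indep_over_mono_base)
  have "K (S \<union> D) \<subseteq> K (S \<union> T \<union> D)" by (rule K_mono) blast
  then have X: "X \<subseteq> K (S \<union> T \<union> D)" using assms unfolding basis_over_def by blast
  have "K (T \<union> (X \<union> D)) \<subseteq> K (S \<union> T \<union> D)"
    by (rule K_least) (use X K_ext[of "S \<union> T \<union> D"] in blast)
  then show ?thesis using 1 X assms indep_over_Un[of D S T] unfolding basis_over_def by auto
qed

text \<open>
  Bases of \<open>C\<close>, of \<open>A\<close> and of \<open>B\<close> over \<open>H\<close> and over \<open>C \<union> H\<close>, respectively, form an independent set over
  \<open>H\<close>, because \<open>A\<close> and \<open>B\<close> are independent over \<open>C \<union> H\<close>. Together with the two \<open>H\<close>-bases on the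
  right-hand side it spans \<open>C \<union> A \<union> B\<close>.
\<close>

lemma hbasis_orth_Un:
  assumes "orth (C \<union> H) A B"
  shows "hbasis (C \<union> A \<union> B) = hbasis (C \<union> A) \<union> hbasis (C \<union> B)"
proof
  show "hbasis (C \<union> A) \<union> hbasis (C \<union> B) \<subseteq> hbasis (C \<union> A \<union> B)"
    using hbasis_mono[of "C \<union> A" "C \<union> A \<union> B"] hbasis_mono[of "C \<union> B" "C \<union> A \<union> B"] by blast
  obtain R where R: "basis_over H C R" using basis_over_exists by blast
  obtain S where S: "basis_over (C \<union> H) A S" using basis_over_exists by blast
  obtain T where T: "basis_over (C \<union> H) B T" using basis_over_exists by blast
  have "indep_over (C \<union> H \<union> B) S" using S assms unfolding basis_over_def orth_def by simp
  then have "indep_over (H \<union> (R \<union> T)) S"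
    using R T unfolding basis_over_def by (auto intro: indep_over_mono_base)
  then have ind: "indep_over H (R \<union> T \<union> S)"
    using basis_Un[OF R T] indep_over_Un[of H "R \<union> T" S] unfolding basis_over_def by simp
  let ?h = "hbasis (C \<union> A) \<union> hbasis (C \<union> B)"
  have "C \<union> A \<subseteq> K ((R \<union> S) \<union> hbasis (C \<union> A))" "C \<union> B \<subseteq> K ((R \<union> T) \<union> hbasis (C \<union> B))"
    using basis_span_iff[OF basis_Un[OF R S] hbasis_subset] basis_span_iff[OF basis_Un[OF R T] hbasis_subset]
    by simp_all
  moreover have "K ((R \<union> S) \<union> hbasis (C \<union> A)) \<subseteq> K ((R \<union> T \<union> S) \<union> ?h)"
    "K ((R \<union> T) \<union> hbasis (C \<union> B)) \<subseteq> K ((R \<union> T \<union> S) \<union> ?h)" by (rule K_mono, blast)+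
  ultimately have "C \<union> A \<union> B \<subseteq> K ((R \<union> T \<union> S) \<union> ?h)" by blast
  then show "hbasis (C \<union> A \<union> B) \<subseteq> ?h" using hbasis_spanned[of ?h, OF _ ind] hbasis_subset by simp
qed

lemma hbasis_Un_finite_set:
  assumes "finite Y"
  shows "finite (hbasis (X \<union> Y) - hbasis X)"
proof -
  obtain S where S: "basis_over H X S" using basis_over_exists by blast
  obtain T where T: "basis_over (X \<union> H) Y T" using basis_over_exists by blast
  have XY: "basis_over H (X \<union> Y) (S \<union> T)" using basis_Un[OF S T] .
  then obtain F where F: "finite F" "F \<subseteq> H" "Y \<subseteq> K (F \<union> (S \<union> T))"
    using K_finite_set[OF assms, of H "S \<union> T"] unfolding basis_over_def by (auto simp: Un_commute)
  have "X \<subseteq> K (S \<union> hbasis X)" using basis_span_iff[OF S hbasis_subset] by simp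
  moreover have "K (S \<union> hbasis X) \<subseteq> K ((S \<union> T) \<union> (hbasis X \<union> F))" "K (F \<union> (S \<union> T)) \<subseteq> K ((S \<union> T) \<union> (hbasis X \<union> F))"
    by (rule K_mono, blast)+
  ultimately have "X \<union> Y \<subseteq> K ((S \<union> T) \<union> (hbasis X \<union> F))" using F by blast
  then have "hbasis (X \<union> Y) \<subseteq> hbasis X \<union> F"
    using basis_span_iff[OF XY, of "hbasis X \<union> F"] hbasis_subset F by simp
  then show ?thesis using F by (meson Diff_subset_conv finite_subset)
qed

text \<open>
  Relative \<open>H\<close>-bases are differences. Over the closure of \<open>X \<union> hbasis X\<close>, a subset \<open>h\<close> of \<open>H\<close> and a basis \<open>T\<close> of \<open>Y\<close>
  over \<open>X \<union> H\<close> span \<open>Y\<close> if and only if \<open>hbasis X \<union> h\<close> and a basis of \<open>X \<union> Y\<close> over \<open>H\<close> span \<open>X \<union> Y\<close>.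
\<close>

lemma orth_over_hbasis_iff:
  assumes "h \<subseteq> H"
  shows "orth (K (X \<union> hbasis X) \<union> h) Y H \<longleftrightarrow> hbasis (X \<union> Y) - hbasis X \<subseteq> h"
proof -
  let ?D = "K (X \<union> hbasis X)"
  obtain S where S: "basis_over H X S" using basis_over_exists by blast
  obtain T where T: "basis_over (?D \<union> H) Y T" using basis_over_exists by blast
  have K: "K (?D \<union> Z) = K (X \<union> hbasis X \<union> Z)" for Z by (rule K_Un_K)
  have T': "basis_over (X \<union> H) Y T"
    unfolding basis_over_def
  proof (intro conjI)
    show "T \<subseteq> Y" using T unfolding basis_over_def by blast
    show "indep_over (X \<union> H) T"
      using T K_ext[of "X \<union> hbasis X"] unfolding basis_over_def by (auto intro: indep_over_mono_base)
    have "K (?D \<union> (H \<union> T)) \<subseteq> K (T \<union> (X \<union> H))"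
      unfolding K by (rule K_mono) (use hbasis_subset in blast)
    then show "Y \<subseteq> K (T \<union> (X \<union> H))"
      using T unfolding basis_over_def by (auto simp: ac_simps)
  qed
  have XY: "basis_over H (X \<union> Y) (S \<union> T)" using basis_Un[OF S T'] .
  have X: "X \<subseteq> K (S \<union> hbasis X)" using basis_span_iff[OF S hbasis_subset] by simp
  have "K (T \<union> (?D \<union> h)) = K (X \<union> (hbasis X \<union> h \<union> T))" using K[of "h \<union> T"] by (simp add: ac_simps)
  also have "\<dots> = K ((S \<union> T) \<union> (hbasis X \<union> h))"
  proof
    have "K (S \<union> hbasis X) \<subseteq> K ((S \<union> T) \<union> (hbasis X \<union> h))" by (rule K_mono) blast
    then show "K (X \<union> (hbasis X \<union> h \<union> T)) \<subseteq> K ((S \<union> T) \<union> (hbasis X \<union> h))"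
      by (intro K_least) (use X K_ext[of "(S \<union> T) \<union> (hbasis X \<union> h)"] in blast)
    show "K ((S \<union> T) \<union> (hbasis X \<union> h)) \<subseteq> K (X \<union> (hbasis X \<union> h \<union> T))"
      by (rule K_mono) (use S in \<open>auto simp: basis_over_def\<close>)
  qed
  finally have eq: "K (T \<union> (?D \<union> h)) = K ((S \<union> T) \<union> (hbasis X \<union> h))" .
  have "X \<subseteq> K ((S \<union> T) \<union> (hbasis X \<union> h))"
    using X K_mono[of "S \<union> hbasis X" "(S \<union> T) \<union> (hbasis X \<union> h)"] by blast
  then have "Y \<subseteq> K (T \<union> (?D \<union> h)) \<longleftrightarrow> X \<union> Y \<subseteq> K ((S \<union> T) \<union> (hbasis X \<union> h))"
    unfolding eq by blast
  also have "\<dots> \<longleftrightarrow> hbasis (X \<union> Y) \<subseteq> hbasis X \<union> h"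
    using basis_span_iff[OF XY, of "hbasis X \<union> h"] assms hbasis_subset by simp
  finally show ?thesis using orth_Un_iff_basis[OF T assms] by blast
qed

text \<open>
  Independence of \<open>A\<close> from \<open>B\<close> over \<open>C\<close> in \<open>H\<close>-structures; it agrees with the definition by \<open>H\<close>-bases
  of tuples by \<open>indep_iff_h_indep\<close>.
\<close>

definition h_indep :: "'u set \<Rightarrow> 'u set \<Rightarrow> 'u set \<Rightarrow> bool" where
  "h_indep A C B \<longleftrightarrow> orth (C \<union> H) A B \<and> hbasis (C \<union> A) \<inter> hbasis (C \<union> B) \<subseteq> hbasis C"

text \<open>
  By \<open>hbasis_orth_Un\<close> the set \<open>hbasis (C \<union> B \<union> A) - hbasis (C \<union> B)\<close> consists of the elements of
  \<open>hbasis (C \<union> A)\<close> outside \<open>hbasis (C \<union> B)\<close>.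
\<close>

lemma h_indep_iff_hbasis_diff:
  assumes "orth (C \<union> H) A B"
  shows "hbasis (C \<union> A) - hbasis C = hbasis (C \<union> B \<union> A) - hbasis (C \<union> B) \<longleftrightarrow> hbasis (C \<union> A) \<inter> hbasis (C \<union> B) \<subseteq> hbasis C"
  using hbasis_orth_Un[OF assms] hbasis_mono[of C "C \<union> B"] hbasis_mono[of C "C \<union> A"]
  by (auto simp: Un_ac)

lemma h_indep_mono: "h_indep A C B \<Longrightarrow> A' \<subseteq> A \<Longrightarrow> B' \<subseteq> C \<union> B \<Longrightarrow> h_indep A' C B'"
  unfolding h_indep_def
  using orth_mono[of "C \<union> H" A B A' B'] hbasis_mono[of "C \<union> A'" "C \<union> A"] hbasis_mono[of "C \<union> B'" "C \<union> B"] by blast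

lemma h_indep_sym: "h_indep A C B \<Longrightarrow> h_indep B C A"
  unfolding h_indep_def using orth_sym[of "C \<union> H" A B] by blast

lemma h_indep_trans:
  assumes "B \<subseteq> C" "C \<subseteq> D"
  shows "h_indep A B D \<longleftrightarrow> h_indep A B C \<and> h_indep A C D"
proof -
  have o: "orth (B \<union> H) A D \<longleftrightarrow> orth (B \<union> H) A C \<and> orth (C \<union> H) A D"
  proof -
    have "orth (B \<union> H) A E \<longleftrightarrow> orth (B \<union> H) A (E \<union> H)" "orth (C \<union> H) A E \<longleftrightarrow> orth (C \<union> H) A (E \<union> H)" for E
      by (auto intro: orth_mono)
    then show ?thesis using orth_trans[of "B \<union> H" "C \<union> H" "D \<union> H" A] assms by blast
  qed
  have eq: "B \<union> C = C" "B \<union> D = D" "C \<union> D = D" using assms by auto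
  have m: "hbasis B \<subseteq> hbasis C" "hbasis C \<subseteq> hbasis D" "hbasis (B \<union> A) \<subseteq> hbasis (C \<union> A)"
    using assms hbasis_mono by (meson Un_mono subset_refl)+
  have "hbasis (C \<union> A) = hbasis C \<union> hbasis (B \<union> A)" if "orth (B \<union> H) A C"
    using hbasis_orth_Un[OF that] eq by (metis Un_commute Un_left_commute Un_assoc)
  then show ?thesis unfolding h_indep_def o eq using m by blast
qed

lemma h_indep_finite_left:
  assumes "\<And>F. finite F \<Longrightarrow> F \<subseteq> A \<Longrightarrow> h_indep F C B"
  shows "h_indep A C B"
  unfolding h_indep_def
proof
  show "orth (C \<union> H) A B" using assms orth_finiteI[of A] unfolding h_indep_def by simp
  show "hbasis (C \<union> A) \<inter> hbasis (C \<union> B) \<subseteq> hbasis C"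
  proof
    fix y assume y: "y \<in> hbasis (C \<union> A) \<inter> hbasis (C \<union> B)"
    then obtain F where "finite F" "F \<subseteq> A" "y \<in> hbasis (C \<union> F)" using hbasis_finite_Un by blast
    then show "y \<in> hbasis C" using assms y unfolding h_indep_def by blast
  qed
qed

lemma h_indep_finite_right:
  assumes "\<And>F. finite F \<Longrightarrow> F \<subseteq> B \<Longrightarrow> h_indep A C F"
  shows "h_indep A C B"
  using h_indep_sym[OF h_indep_finite_left[of B C A]] assms h_indep_sym by blast

end

section \<open>Quantifier-free elementary maps\<close>

lemma finite_set2_trm: "finite (set2_trm t)"
  by (induction t) auto

lemma finite_fv_qf: "qf \<phi> \<Longrightarrow> finite (fv \<phi>)"
  by (induction \<phi>) (auto simp: finite_set2_trm)

lemma tval_cong: "(\<And>x. x \<in> set2_trm t \<Longrightarrow> v x = w x) \<Longrightarrow> tval M v t = tval M w t"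
proof (induction t)
  case (Fn f ts)
  then have "map (tval M v) ts = map (tval M w) ts" by (intro map_cong) auto
  then show ?case by (metis tval.simps(2))
qed simp

lemma sat_cong: "(\<And>x. x \<in> fv \<phi> \<Longrightarrow> v x = w x) \<Longrightarrow> sat M \<phi> v = sat M \<phi> w"
proof (induction \<phi> arbitrary: v w)
  case (Eq s t)
  then have "tval M v s = tval M w s" "tval M v t = tval M w t" by (auto intro: tval_cong)
  then show ?case by simp
next
  case (Rel R ts)
  have "map (tval M v) ts = map (tval M w) ts" using Rel by (intro map_cong tval_cong) auto
  then show ?case by (metis sat.simps(2))
next
  case (Neg \<phi>)
  have "sat M \<phi> v = sat M \<phi> w" by (rule Neg.IH) (simp add: Neg.prems)
  then show ?case by simp
next
  case (And \<phi> \<psi>)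
  have "sat M \<phi> v = sat M \<phi> w" by (rule And.IH(1)) (simp add: And.prems)
  moreover have "sat M \<psi> v = sat M \<psi> w" by (rule And.IH(2)) (simp add: And.prems)
  ultimately show ?case by simp
next
  case (CConj \<Phi>)
  have "sat M (\<Phi> n) v = sat M (\<Phi> n) w" for n
    by (rule CConj.IH) (use CConj.prems in \<open>auto simp only: fv.simps\<close>)
  then show ?case by simp
next
  case (Ex x \<phi>)
  have "sat M \<phi> (v(x := d)) = sat M \<phi> (w(x := d))" for d
    by (rule Ex.IH) (simp add: Ex.prems)
  then show ?case by simp
qed

lemma tval_map_trm: "tval M v (map_trm id g t) = tval M (v \<circ> g) t"
  by (induction t) (auto simp: comp_def intro: arg_cong[where f = "fint M _"])

lemma wf_map_trm: "wf_trm L (map_trm id g t) = wf_trm L t"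
  by (induction t) (auto simp: list_all_iff)

lemma sat_map_fm: "qf \<phi> \<Longrightarrow> sat M (map_fm id id g \<phi>) v = sat M \<phi> (v \<circ> g)"
  by (induction \<phi>) (auto simp: tval_map_trm comp_def)

lemma qf_map_fm: "qf (map_fm id id g \<phi>) = qf \<phi>"
  by (induction \<phi>) auto

lemma wf_map_fm: "wf_fm L (map_fm id id g \<phi>) = wf_fm L \<phi>"
  by (induction \<phi>) (auto simp: wf_map_trm wf_map_trm[unfolded id_def])

lemma fv_map_fm: "qf \<phi> \<Longrightarrow> fv (map_fm id id g \<phi>) = g ` fv \<phi>"
  by (induction \<phi>) (auto simp: trm.set_map image_Un)

text \<open>
  The map \<open>f\<close> preserves the quantifier-free types of tuples of \<open>A\<close>. The variables \<open>nat + nat\<close> are those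
  of \<open>tp_enum\<close>; by \<open>qf_elemD\<close> any other type of variables would do, as formulas have finitely many variables.
\<close>

definition qf_elem ::
  "('f, 'r) lang \<Rightarrow> ('f, 'r, 'u, 'y) fostruct_scheme \<Rightarrow> ('f, 'r, 'u, 'z) fostruct_scheme
    \<Rightarrow> 'u set \<Rightarrow> ('u \<Rightarrow> 'u) \<Rightarrow> bool" where
  "qf_elem L M N A f \<longleftrightarrow>
     (\<forall>(\<phi> :: ('f, 'r, nat + nat) fm) v. wf_fm L \<phi> \<and> qf \<phi> \<and> v ` fv \<phi> \<subseteq> A \<longrightarrow>
        sat M \<phi> v = sat N \<phi> (f \<circ> v))"

lemma qf_elemD:
  fixes \<phi> :: "('f, 'r, 'v) fm"
  assumes "qf_elem L M N A f" "wf_fm L \<phi>" "qf \<phi>" "v ` fv \<phi> \<subseteq> A"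
  shows "sat M \<phi> v = sat N \<phi> (f \<circ> v)"
proof -
  obtain g0 :: "'v \<Rightarrow> nat" where g0: "inj_on g0 (fv \<phi>)"
    using finite_imp_inj_to_nat_seg[OF finite_fv_qf[OF assms(3)]] by blast
  define g :: "'v \<Rightarrow> nat + nat" where "g = Inl \<circ> g0"
  have inj: "inj_on g (fv \<phi>)" using g0 by (auto simp: g_def inj_on_def)
  define w where "w = v \<circ> inv_into (fv \<phi>) g"
  have w: "(w \<circ> g) x = v x" if "x \<in> fv \<phi>" for x using that inj by (simp add: w_def)
  have "sat M \<phi> v = sat M (map_fm id id g \<phi>) w"
    unfolding sat_map_fm[OF assms(3)] by (rule sat_cong) (simp only: w)
  also have "\<dots> = sat N (map_fm id id g \<phi>) (f \<circ> w)"
  proof -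
    have "w ` fv (map_fm id id g \<phi>) = v ` fv \<phi>"
      using w assms(3) by (simp add: fv_map_fm image_comp)
    then show ?thesis
      using assms unfolding qf_elem_def by (metis qf_map_fm wf_map_fm)
  qed
  also have "\<dots> = sat N \<phi> (f \<circ> v)"
    unfolding sat_map_fm[OF assms(3)] by (rule sat_cong) (metis comp_apply w)
  finally show ?thesis .
qed

lemma qf_elem_subset: "qf_elem L M N A f \<Longrightarrow> B \<subseteq> A \<Longrightarrow> qf_elem L M N B f"
  unfolding qf_elem_def by (meson subset_trans)

lemma qf_elem_cong:
  fixes L :: "('f, 'r) lang"
  assumes "\<And>x. x \<in> A \<Longrightarrow> f x = g x"
  shows "qf_elem L M N A f = qf_elem L M N A g"
proof -
  have "sat N \<phi> (f \<circ> v) = sat N \<phi> (g \<circ> v)" if "v ` fv \<phi> \<subseteq> A" for \<phi> :: "('f, 'r, nat + nat) fm" and v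
    by (rule sat_cong) (use that assms in auto)
  then show ?thesis unfolding qf_elem_def by auto
qed

lemma qf_elem_id: "qf_elem L M M A id"
  by (simp add: qf_elem_def)

lemma qf_elem_comp:
  fixes L :: "('f, 'r) lang"
  assumes "qf_elem L M N A f" "qf_elem L N P (f ` A) g"
  shows "qf_elem L M P A (g \<circ> f)"
  unfolding qf_elem_def
proof (intro allI impI)
  fix \<phi> :: "('f, 'r, nat + nat) fm" and v
  assume \<phi>: "wf_fm L \<phi> \<and> qf \<phi> \<and> v ` fv \<phi> \<subseteq> A"
  then have "sat M \<phi> v = sat N \<phi> (f \<circ> v)" using assms(1) unfolding qf_elem_def by blast
  also have "\<dots> = sat P \<phi> (g \<circ> (f \<circ> v))"
    using assms(2) \<phi> unfolding qf_elem_def by (metis image_comp image_mono)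
  finally show "sat M \<phi> v = sat P \<phi> (g \<circ> f \<circ> v)" by (simp add: comp_assoc)
qed

lemma qf_elem_inj:
  fixes L :: "('f, 'r) lang"
  assumes "qf_elem L M N A f"
  shows "inj_on f A"
proof (rule inj_onI)
  fix x y assume xy: "x \<in> A" "y \<in> A" "f x = f y"
  let ?\<phi> = "Eq (Var True) (Var False) :: ('f, 'r, bool) fm"
  have "sat M ?\<phi> (\<lambda>b. if b then x else y) = sat N ?\<phi> (f \<circ> (\<lambda>b. if b then x else y))"
    by (rule qf_elemD[OF assms]) (use xy in auto)
  then show "x = y" using xy by simp
qed

lemma qf_elem_inverse:
  fixes L :: "('f, 'r) lang"
  assumes "qf_elem L M N A f" "\<And>x. x \<in> A \<Longrightarrow> g (f x) = x"
  shows "qf_elem L N M (f ` A) g"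
  unfolding qf_elem_def
proof (intro allI impI)
  fix \<phi> :: "('f, 'r, nat + nat) fm" and v
  assume \<phi>: "wf_fm L \<phi> \<and> qf \<phi> \<and> v ` fv \<phi> \<subseteq> f ` A"
  then have g: "g (v x) \<in> A" "f (g (v x)) = v x" if "x \<in> fv \<phi>" for x
    using assms(2) that by (auto simp: image_subset_iff)
  have "sat M \<phi> (g \<circ> v) = sat N \<phi> (f \<circ> (g \<circ> v))"
    using assms(1) \<phi> g(1) unfolding qf_elem_def by (metis comp_apply image_subsetI)
  also have "\<dots> = sat N \<phi> v" by (rule sat_cong) (use g in auto)
  finally show "sat N \<phi> v = sat M \<phi> (g \<circ> v)" by simp
qed

lemma qf_elem_finiteI:
  fixes L :: "('f, 'r) lang"
  assumes "\<And>F. finite F \<Longrightarrow> F \<subseteq> A \<Longrightarrow> qf_elem L M N F f"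
  shows "qf_elem L M N A f"
  unfolding qf_elem_def
proof (intro allI impI)
  fix \<phi> :: "('f, 'r, nat + nat) fm" and v
  assume \<phi>: "wf_fm L \<phi> \<and> qf \<phi> \<and> v ` fv \<phi> \<subseteq> A"
  then have "qf_elem L M N (v ` fv \<phi>) f" using assms by (simp add: finite_fv_qf)
  then show "sat M \<phi> v = sat N \<phi> (f \<circ> v)" using \<phi> unfolding qf_elem_def by blast
qed

text \<open>
  Conjugation of \<open>f\<close> by the quantifier-free embedding \<open>h\<close>.
\<close>

lemma qf_elem_conj:
  assumes "qf_elem L M N D h" "Y \<subseteq> D" "f ` Y \<subseteq> D" "\<And>y. y \<in> Y \<Longrightarrow> k (h y) = h (f y)"
  shows "qf_elem L N N (h ` Y) k \<longleftrightarrow> qf_elem L M M Y f"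
proof
  have hf: "qf_elem L M N (f ` Y) h" by (rule qf_elem_subset[OF assms(1,3)])
  have h: "qf_elem L M N Y h" by (rule qf_elem_subset[OF assms(1,2)])
  have inj: "inj_on h D" using assms(1) by (rule qf_elem_inj)
  {
    assume "qf_elem L N N (h ` Y) k"
    then have "qf_elem L M N Y (k \<circ> h)" using h qf_elem_comp by blast
    moreover have "qf_elem L N M (h ` D) (inv_into D h)"
      by (rule qf_elem_inverse[OF assms(1)]) (simp add: inj)
    moreover have "(k \<circ> h) ` Y \<subseteq> h ` D" using assms by auto
    ultimately have "qf_elem L N M ((k \<circ> h) ` Y) (inv_into D h)" "qf_elem L M N Y (k \<circ> h)"
      using qf_elem_subset by auto
    then have "qf_elem L M M Y (inv_into D h \<circ> (k \<circ> h))"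
      by (simp only: qf_elem_comp[of L M N Y "k \<circ> h" M "inv_into D h"])
    moreover have "(inv_into D h \<circ> (k \<circ> h)) y = f y" if "y \<in> Y" for y
      using that assms(3,4) inj by (simp add: image_subset_iff)
    ultimately show "qf_elem L M M Y f"
      using qf_elem_cong[of Y "inv_into D h \<circ> (k \<circ> h)" f] by metis
  next
    assume f: "qf_elem L M M Y f"
    have "qf_elem L M N Y (h \<circ> f)" using qf_elem_comp[OF f hf] .
    moreover have "qf_elem L N M (h ` Y) (inv_into D h)"
      by (rule qf_elem_inverse[OF h]) (use inj assms(2) in auto)
    moreover have "inv_into D h ` h ` Y = Y" using inj assms(2) by (simp add: inv_into_image_cancel)
    ultimately have "qf_elem L N N (h ` Y) (h \<circ> f \<circ> inv_into D h)"
      using qf_elem_comp[of L N M "h ` Y" "inv_into D h" N "h \<circ> f"] by simp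
    moreover have "(h \<circ> f \<circ> inv_into D h) y = k y" if "y \<in> h ` Y" for y
      using that assms(2,4) inj by auto
    ultimately show "qf_elem L N N (h ` Y) k"
      using qf_elem_cong[of "h ` Y" "h \<circ> f \<circ> inv_into D h" k] by metis
  }
qed

text \<open>
  The union of an increasing sequence of partial maps, given by total functions \<open>g n\<close> of which only the
  values on \<open>T n\<close> matter.
\<close>

lemma limit_map:
  fixes T :: "nat \<Rightarrow> 'a set" and g :: "nat \<Rightarrow> 'a \<Rightarrow> 'b"
  assumes "\<And>n. T n \<subseteq> T (Suc n)" "\<And>n x. x \<in> T n \<Longrightarrow> g (Suc n) x = g n x"
  obtains f where "\<And>n x. x \<in> T n \<Longrightarrow> f x = g n x"
proof
  have step: "x \<in> T (n + k) \<and> g (n + k) x = g n x" if "x \<in> T n" for x n k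
    using that assms by (induction k) auto
  show "g (LEAST m. x \<in> T m) x = g n x" if "x \<in> T n" for x n
    using step[of x "LEAST m. x \<in> T m" "n - (LEAST m. x \<in> T m)"] that Least_le[of "\<lambda>m. x \<in> T m" n]
      LeastI[of "\<lambda>m. x \<in> T m" n] by simp
qed

lemma finite_subset_increasing:
  fixes T :: "nat \<Rightarrow> 'a set"
  assumes "\<And>n. T n \<subseteq> T (Suc n)" "finite F" "F \<subseteq> (\<Union>n. T n)"
  obtains n where "F \<subseteq> T n"
proof -
  have mono: "T m \<subseteq> T n" if "m \<le> n" for m n using that assms(1) lift_Suc_mono_le by blast
  have "\<exists>n. F \<subseteq> T n" using assms(2,3)
  proof (induction F)
    case (insert x F)
    then obtain m n where "F \<subseteq> T m" "x \<in> T n" by auto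
    then have "insert x F \<subseteq> T (max m n)" using mono[of m "max m n"] mono[of n "max m n"] by auto
    then show ?case ..
  qed simp
  then show thesis using that by blast
qed

lemma qf_elem_limit:
  assumes "\<And>n. T n \<subseteq> T (Suc n)" "\<And>n. qf_elem L M N (T n) (g n)" "\<And>n x. x \<in> T n \<Longrightarrow> f x = g n x"
  shows "qf_elem L M N (\<Union>n. T n) f"
proof (rule qf_elem_finiteI)
  fix F assume "finite F" "F \<subseteq> (\<Union>n. T n)"
  then obtain n where n: "F \<subseteq> T n" using finite_subset_increasing assms(1) by metis
  have "qf_elem L M N (T n) f" using assms(2)[of n] assms(3)[of _ n] qf_elem_cong[of "T n" f "g n"] by blast
  then show "qf_elem L M N F f" using n qf_elem_subset by blast
qed

text \<open>
  A valuation in \<open>w ` J\<close> factors through \<open>w\<close>, so the formula can be renamed to one with variables in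
  \<open>J\<close>.
\<close>

lemma qf_elem_if_qf_type:
  fixes L :: "('f, 'r) lang"
  assumes "qf_type L M J w = qf_type L N J w'" "\<And>j. j \<in> J \<Longrightarrow> f (w j) = w' j"
  shows "qf_elem L M N (w ` J) f"
  unfolding qf_elem_def
proof (intro allI impI)
  fix \<phi> :: "('f, 'r, nat + nat) fm" and v
  assume \<phi>: "wf_fm L \<phi> \<and> qf \<phi> \<and> v ` fv \<phi> \<subseteq> w ` J"
  then have "\<forall>x\<in>fv \<phi>. \<exists>j\<in>J. w j = v x" by (metis imageE image_subset_iff)
  then obtain g where g: "\<And>x. x \<in> fv \<phi> \<Longrightarrow> g x \<in> J \<and> w (g x) = v x" by metis
  let ?\<psi> = "map_fm id id g \<phi>"
  have fv: "fv ?\<psi> \<subseteq> J" using g \<phi> by (auto simp: fv_map_fm)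
  have "sat M \<phi> v = sat M ?\<psi> w"
    using \<phi> g by (subst sat_map_fm) (auto intro!: sat_cong)
  also have "\<dots> \<longleftrightarrow> ?\<psi> \<in> qf_type L M J w"
    using \<phi> fv by (simp add: qf_type_def wf_map_fm qf_map_fm)
  also have "\<dots> \<longleftrightarrow> sat N ?\<psi> w'"
    unfolding assms(1) using \<phi> fv by (simp add: qf_type_def wf_map_fm qf_map_fm)
  also have "\<dots> = sat N \<phi> (f \<circ> v)"
    using \<phi> g assms(2) by (subst sat_map_fm) (auto intro!: sat_cong, metis)
  finally show "sat M \<phi> v = sat N \<phi> (f \<circ> v)" .
qed

lemma qf_type_if_qf_elem:
  assumes "qf_elem L M N A f" "w ` J \<subseteq> A" "\<And>j. j \<in> J \<Longrightarrow> w' j = f (w j)"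
  shows "qf_type L M J w = qf_type L N J w'"
proof -
  have "sat M \<phi> w = sat N \<phi> w'" if "wf_fm L \<phi>" "qf \<phi>" "fv \<phi> \<subseteq> J" for \<phi>
  proof -
    have "sat M \<phi> w = sat N \<phi> (f \<circ> w)"
      by (rule qf_elemD[OF assms(1) that(1,2)]) (use that(3) assms(2) in auto)
    also have "\<dots> = sat N \<phi> w'" by (rule sat_cong) (use that(3) assms(3) in auto)
    finally show ?thesis .
  qed
  then show ?thesis unfolding qf_type_def by blast
qed

lemma tval_fo_embedding:
  assumes "fo_embedding L M N \<theta>" "wf_trm L t" "v ` set2_trm t \<subseteq> univ M"
  shows "tval M v t \<in> univ M \<and> \<theta> (tval M v t) = tval N (\<theta> \<circ> v) t"
  using assms(2,3)
proof (induction t)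
  case (Fn f ts)
  have f: "f \<in> fsyms L" "length ts = farity L f" using Fn.prems by auto
  have ts: "tval M v t \<in> univ M \<and> \<theta> (tval M v t) = tval N (\<theta> \<circ> v) t" if "t \<in> set ts" for t
  proof (rule Fn.IH[OF that])
    show "wf_trm L t" using Fn.prems(1) that by (simp add: list_all_iff)
    show "v ` set2_trm t \<subseteq> univ M" using Fn.prems(2) that by auto
  qed
  have arg: "map (tval M v) ts \<in> argtuples M (farity L f)"
    using ts f by (auto simp: argtuples_def)
  moreover have "map \<theta> (map (tval M v) ts) = map (tval N (\<theta> \<circ> v)) ts" using ts by simp
  ultimately show ?case using assms(1) f unfolding fo_embedding_def is_structure_def by (metis tval.simps(2))
qed simp

lemma qf_elem_fo_embedding:
  fixes L :: "('f, 'r) lang"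
  assumes "fo_embedding L M N \<theta>"
  shows "qf_elem L M N (univ M) \<theta>"
proof -
  have "sat M \<phi> v = sat N \<phi> (\<theta> \<circ> v)" if "wf_fm L \<phi>" "qf \<phi>" "v ` fv \<phi> \<subseteq> univ M"
    for \<phi> :: "('f, 'r, nat + nat) fm" and v
    using that
  proof (induction \<phi>)
    case (Eq s t)
    then have "tval M v s \<in> univ M \<and> \<theta> (tval M v s) = tval N (\<theta> \<circ> v) s"
      "tval M v t \<in> univ M \<and> \<theta> (tval M v t) = tval N (\<theta> \<circ> v) t"
      using tval_fo_embedding[OF assms, of s v] tval_fo_embedding[OF assms, of t v]
      by (simp_all add: image_Un)
    then show ?case using assms unfolding fo_embedding_def inj_on_def by (metis sat.simps(1))
  next
    case (Rel R ts)
    have ts: "tval M v t \<in> univ M \<and> \<theta> (tval M v t) = tval N (\<theta> \<circ> v) t" if "t \<in> set ts" for t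
    proof (rule tval_fo_embedding[OF assms])
      show "wf_trm L t" using Rel.prems(1) that by simp
      show "v ` set2_trm t \<subseteq> univ M" using Rel.prems(3) that by auto
    qed
    then have "map (tval M v) ts \<in> argtuples M (rarity L R)"
      using Rel by (auto simp: argtuples_def)
    moreover have "map \<theta> (map (tval M v) ts) = map (tval N (\<theta> \<circ> v)) ts" using ts by simp
    ultimately show ?case using assms Rel unfolding fo_embedding_def by (metis sat.simps(2) wf_fm.simps(2))
  qed auto
  then show ?thesis unfolding qf_elem_def by blast
qed

section \<open>Dimension in structures with a pregeometry\<close>

text \<open>
  The closure operator of \<open>M\<close>, extended to a pregeometry on the whole type: elements outside the
  universe are independent of everything else.
\<close>

definition clo :: "('f, 'r, 'u) pgstruct \<Rightarrow> 'u set \<Rightarrow> 'u set" where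
  "clo M A = cl M (A \<inter> univ M) \<union> (A - univ M)"

lemma clo_eq: "A \<subseteq> univ M \<Longrightarrow> clo M A = cl M A"
  by (simp add: clo_def Int_absorb2) blast

lemma total_pregeometry_clo:
  assumes p: "pregeometry (univ M) (cl M)"
  shows "total_pregeometry (clo M)"
proof
  let ?U = "univ M"
  have ext: "A \<subseteq> cl M A" "cl M A \<subseteq> ?U" "cl M (cl M A) = cl M A" if "A \<subseteq> ?U" for A
    using p that unfolding pregeometry_def by auto
  have mono: "cl M A \<subseteq> cl M B" if "A \<subseteq> B" "B \<subseteq> ?U" for A B
    using p that unfolding pregeometry_def by auto
  show "pregeometry UNIV (clo M)"
    unfolding pregeometry_def
  proof (intro conjI allI impI)
    fix A :: "'a set"
    show "A \<subseteq> clo M A" using ext(1)[of "A \<inter> ?U"] unfolding clo_def by blast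
    have "clo M A \<inter> ?U = cl M (A \<inter> ?U)" "clo M A - ?U = A - ?U"
      using ext(2)[of "A \<inter> ?U"] unfolding clo_def by auto
    then show "clo M (clo M A) = clo M A" using ext(3)[of "A \<inter> ?U"] by (simp add: clo_def[of M "clo M A"]) (simp add: clo_def)
    show "clo M A \<subseteq> UNIV" by simp
  next
    fix A B :: "'a set" assume "A \<subseteq> B \<and> B \<subseteq> UNIV"
    then show "clo M A \<subseteq> clo M B" using mono[of "A \<inter> ?U" "B \<inter> ?U"] unfolding clo_def by blast
  next
    fix A :: "'a set" and x assume x: "A \<subseteq> UNIV \<and> x \<in> clo M A"
    show "\<exists>F. finite F \<and> F \<subseteq> A \<and> x \<in> clo M F"
    proof (cases "x \<in> ?U")
      case True
      then have "x \<in> cl M (A \<inter> ?U)" using x unfolding clo_def by blast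
      then obtain F where F: "finite F" "F \<subseteq> A \<inter> ?U" "x \<in> cl M F"
        using p unfolding pregeometry_def by (metis Int_lower2)
      then have "x \<in> clo M F" by (simp add: clo_eq)
      then show ?thesis using F by blast
    next
      case False
      then have "x \<in> A" using x ext(2)[of "A \<inter> ?U"] unfolding clo_def by blast
      then show ?thesis using False by (intro exI[of _ "{x}"]) (simp add: clo_def)
    qed
  next
    fix A :: "'a set" and x y
    assume *: "A \<subseteq> UNIV \<and> x \<in> UNIV \<and> y \<in> UNIV \<and> x \<in> clo M (insert y A) \<and> x \<notin> clo M A"
    show "y \<in> clo M (insert x A)"
    proof (cases "y \<in> ?U")
      case True
      then have "x \<in> cl M (insert y (A \<inter> ?U))" "x \<notin> cl M (A \<inter> ?U)" using * unfolding clo_def by auto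
      moreover from this have xU: "x \<in> ?U" using ext(2)[of "insert y (A \<inter> ?U)"] True by blast
      ultimately have "y \<in> cl M (insert x (A \<inter> ?U))" using p True unfolding pregeometry_def by (metis Int_lower2)
      then show ?thesis using xU by (simp add: clo_def)
    next
      case False
      then have "x = y" using * unfolding clo_def by auto
      then show ?thesis using False by (simp add: clo_def)
    qed
  qed
qed

locale pregeometry_structure =
  fixes M :: "('f, 'r, 'u) pgstruct"
  assumes pgM: "pregeometry (univ M) (cl M)"
begin

sublocale total_pregeometry "clo M"
  using total_pregeometry_clo pgM .

lemma clo_univ: "A \<subseteq> univ M \<Longrightarrow> clo M A \<subseteq> univ M"
  using pgM unfolding pregeometry_def by (simp add: clo_eq)

lemma pg_basis_iff:
  assumes "X \<subseteq> univ M" "D \<subseteq> univ M"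
  shows "pg_basis (localize (cl M) D) X I \<longleftrightarrow> basis_over D X I"
proof (cases "I \<subseteq> X")
  case True
  then have "cl M ((I - {x}) \<union> D) = clo M ((I - {x}) \<union> D)" "cl M (I \<union> D) = clo M (I \<union> D)" for x
    using assms by (intro clo_eq[symmetric], blast)+
  then show ?thesis
    by (simp add: pg_basis_def basis_over_def indep_over_iff cl_independent_def localize_def)
qed (simp add: pg_basis_def basis_over_def)

lemma dim_over_basis:
  assumes "X \<subseteq> univ M" "D \<subseteq> univ M"
  obtains I where "basis_over D X I" "dim_over (cl M) X D = |I|"
proof -
  obtain T where "basis_over D X T" using basis_over_exists by blast
  then have "basis_over D X (SOME I. pg_basis (localize (cl M) D) X I)"
    unfolding pg_basis_iff[OF assms] by (rule someI)
  then show thesis using that unfolding dim_over_def pgdim_def by blast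
qed

lemma pgdim_eq: "pgdim (cl M) X = dim_over (cl M) X {}"
  by (simp add: dim_over_def localize_def)

text \<open>
  A basis of \<open>X\<close> over \<open>D\<close> spans \<open>X\<close> over \<open>E\<close> and thus contains a basis of \<open>X\<close> over \<open>E\<close>. As \<open>X\<close> is finite, the
  dimensions agree if and only if no proper subset remains, that is, if bases over \<open>D\<close> stay
  independent over \<open>E\<close>.
\<close>

lemma dim_over_eq_iff_orth:
  assumes "finite X" "X \<subseteq> univ M" "D \<subseteq> E" "E \<subseteq> univ M"
  shows "dim_over (cl M) X E =o dim_over (cl M) X D \<longleftrightarrow> orth D X E"
proof -
  obtain I where I: "basis_over E X I" "dim_over (cl M) X E = |I|"
    using dim_over_basis assms(2,4) by blast
  obtain J where J: "basis_over D X J" "dim_over (cl M) X D = |J|"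
    using dim_over_basis[of X D] assms(2-4) by blast
  have fin: "finite I" "finite J" using I J assms(1) finite_subset unfolding basis_over_def by blast+
  have eq: "dim_over (cl M) X E =o dim_over (cl M) X D \<longleftrightarrow> card I = card J"
    unfolding I(2) J(2) card_of_ordIso[symmetric] using bij_betw_iff_card[OF fin] .
  have DE: "D \<union> E = E" using assms(3) by blast
  have spanE: "X \<subseteq> clo M (S \<union> E)" if "basis_over D X S" for S
    using that K_mono[of "S \<union> D" "S \<union> E"] assms(3) unfolding basis_over_def by blast
  show ?thesis unfolding eq
  proof
    assume c: "card I = card J"
    show "orth D X E" unfolding orth_def DE
    proof (intro allI impI)
      fix S assume S: "S \<subseteq> X" "indep_over D S"
      obtain T where T: "S \<subseteq> T" "basis_over D X T" using basis_over_extend[OF S(2,1)] .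
      obtain T' where T': "basis_over E T T'" using basis_over_exists by blast
      have finT: "finite T" using T(2) assms(1) finite_subset unfolding basis_over_def by blast
      have "T \<union> E \<subseteq> clo M (T' \<union> E)" using T' K_ext[of "T' \<union> E"] unfolding basis_over_def by blast
      then have "X \<subseteq> clo M (T' \<union> E)" using spanE[OF T(2)] K_least by blast
      then have "basis_over E X T'" using T' T(2) unfolding basis_over_def by blast
      then have "card T' = card T"
        using card_basis_over[OF assms(1)] I(1) J(1) T(2) c by metis
      then have "T' = T" using card_subset_eq[OF finT] T' unfolding basis_over_def by blast
      then show "indep_over E S" using T' T(1) indep_over_subset unfolding basis_over_def by blast
    qed
  next
    assume "orth D X E"
    then have "basis_over E X J" using J(1) spanE unfolding orth_def DE basis_over_def by blast
    then show "card I = card J" using card_basis_over[OF assms(1) I(1)] by blast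
  qed
qed

end

section \<open>Extending partial isomorphisms\<close>

text \<open>
  The axioms of weakly quasiminimal pregeometry structures in terms of partial maps instead of types of
  enumerations.
\<close>

locale weak_qm = pregeometry_structure M
  for L :: "('f, 'r) lang" and M :: "('f, 'r, 'u) pgstruct" +
  assumes struct: "is_structure L M"
    and qm1_finite: "\<lbrakk>qf_elem L M M A f; A \<subseteq> univ M; f ` A \<subseteq> univ M; finite X; X \<subseteq> A; x \<in> A\<rbrakk>
      \<Longrightarrow> x \<in> clo M X \<longleftrightarrow> f x \<in> clo M (f ` X)"
    and qm3: "\<lbrakk>finite A; A \<subseteq> univ M\<rbrakk> \<Longrightarrow> countable (clo M A)"
    and qm4: "\<lbrakk>countable A; A \<subseteq> univ M; f ` A \<subseteq> univ M; clo M A = A; clo M (f ` A) = f ` A;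
        qf_elem L M M A f; a \<in> univ M - A; a' \<in> univ M - f ` A\<rbrakk>
      \<Longrightarrow> qf_elem L M M (insert a A) (f(a := a'))"
    and qm5: "\<lbrakk>countable A; A \<subseteq> univ M; f ` A \<subseteq> univ M; clo M A = A \<and> clo M (f ` A) = f ` A \<or> A = {};
        finite B; B \<subseteq> univ M; f ` B \<subseteq> univ M; qf_elem L M M (A \<union> B) f; a \<in> clo M (A \<union> B) - (A \<union> B)\<rbrakk>
      \<Longrightarrow> \<exists>a'\<in>univ M. qf_elem L M M (insert a (A \<union> B)) (f(a := a'))"
begin

lemma qm1:
  assumes "qf_elem L M M A f" "A \<subseteq> univ M" "f ` A \<subseteq> univ M" "X \<subseteq> A" "x \<in> A"
  shows "x \<in> clo M X \<longleftrightarrow> f x \<in> clo M (f ` X)"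
proof
  assume "x \<in> clo M X"
  then obtain F where F: "finite F" "F \<subseteq> X" "x \<in> clo M F" using K_finite by blast
  then have "f x \<in> clo M (f ` F)" using qm1_finite[OF assms(1-3), of F x] assms(4,5) by auto
  then show "f x \<in> clo M (f ` X)" using K_mono[of "f ` F" "f ` X"] F by blast
next
  assume "f x \<in> clo M (f ` X)"
  then obtain G where G: "finite G" "G \<subseteq> f ` X" "f x \<in> clo M G" using K_finite by blast
  then obtain F where F: "finite F" "F \<subseteq> X" "G = f ` F" using finite_subset_image by metis
  then have "x \<in> clo M F" using qm1_finite[OF assms(1-3), of F x] assms(4,5) G by auto
  then show "x \<in> clo M X" using K_mono[of F X] F by blast
qed

lemma countable_clo:
  assumes "countable A" "A \<subseteq> univ M"
  shows "countable (clo M A)"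
proof -
  have "clo M A \<subseteq> (\<Union>F\<in>{F. finite F \<and> F \<subseteq> A}. clo M F)" using K_finite by blast
  moreover have "countable (\<Union>F\<in>{F. finite F \<and> F \<subseteq> A}. clo M F)"
    using assms qm3 by (intro countable_UN countable_Collect_finite_subset) auto
  ultimately show ?thesis using countable_subset by blast
qed

text \<open>
  Closedness of \<open>f ` D\<close> is needed for surjectivity: otherwise an element of the closure of \<open>f ` X\<close> might
  lie outside the range of \<open>f\<close>.
\<close>

lemma image_clo:
  assumes "qf_elem L M M D f" "D \<subseteq> univ M" "f ` D \<subseteq> univ M" "clo M D = D" "clo M (f ` D) = f ` D" "X \<subseteq> D"
  shows "f ` clo M X = clo M (f ` X)"
proof
  have X: "clo M X \<subseteq> D" using K_mono[OF assms(6)] assms(4) by simp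
  show "f ` clo M X \<subseteq> clo M (f ` X)"
  proof
    fix y assume "y \<in> f ` clo M X"
    then obtain x where x: "x \<in> clo M X" "y = f x" by blast
    then show "y \<in> clo M (f ` X)" using qm1[OF assms(1-3,6), of x] X by blast
  qed
  show "clo M (f ` X) \<subseteq> f ` clo M X"
  proof
    fix y assume y: "y \<in> clo M (f ` X)"
    have "clo M (f ` X) \<subseteq> f ` D" using K_mono[OF image_mono[OF assms(6), of f]] assms(5) by simp
    then obtain x where x: "x \<in> D" "y = f x" using y by blast
    then show "y \<in> f ` clo M X" using qm1[OF assms(1-3,6), of x] y by blast
  qed
qed

text \<open>
  The point provided by QM5 lies in the closure of the image by QM1.
\<close>

lemma extend_by_point:
  assumes A: "countable A" "A \<subseteq> univ M" "f ` A \<subseteq> univ M"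
      "clo M A = A \<and> clo M (f ` A) = f ` A \<or> A = {}"
    and S: "finite S" "S \<subseteq> univ M" "f ` S \<subseteq> univ M"
    and f: "qf_elem L M M (A \<union> S) f" and d: "d \<in> clo M (A \<union> S)" "d \<notin> A \<union> S"
  obtains d' where "d' \<in> clo M (f ` (A \<union> S))" "qf_elem L M M (insert d (A \<union> S)) (f(d := d'))"
proof -
  obtain d' where d': "d' \<in> univ M" "qf_elem L M M (insert d (A \<union> S)) (f(d := d'))"
    using qm5[OF A S f, of d] d by blast
  let ?f = "f(d := d')"
  have im: "?f ` (A \<union> S) = f ` (A \<union> S)" by (intro image_cong refl) (use d(2) in auto)
  have "?f ` insert d (A \<union> S) = insert d' (f ` A \<union> f ` S)"
    using im by (simp only: image_insert fun_upd_same image_Un)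
  then have U: "?f ` insert d (A \<union> S) \<subseteq> univ M" using d'(1) A(3) S(3) by simp
  have "clo M (A \<union> S) \<subseteq> univ M" using A(2) S(2) by (intro clo_univ) simp
  then have "insert d (A \<union> S) \<subseteq> univ M" using d(1) A(2) S(2) by auto
  then have "?f d \<in> clo M (?f ` (A \<union> S))" using qm1[OF d'(2) _ U, of "A \<union> S" d] d(1) by blast
  then show thesis using that[OF _ d'(2)] unfolding im by simp
qed

text \<open>
  Both closures are countable, so the one-point extensions \<open>extend_by_point\<close> of the map and of its
  inverse can be alternated along enumerations of the two closures. In each stage the map is given on
  the possibly infinite set \<open>A\<close> and on a finite set \<open>S\<close>, as QM5 requires.
\<close>

lemma extend_to_closure:
  assumes A: "countable A" "A \<subseteq> univ M" "f ` A \<subseteq> univ M"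
      "clo M A = A \<and> clo M (f ` A) = f ` A \<or> A = {}"
    and B: "finite B" "B \<subseteq> univ M" "f ` B \<subseteq> univ M"
    and f: "qf_elem L M M (A \<union> B) f"
  obtains g where "qf_elem L M M (clo M (A \<union> B)) g" "\<And>x. x \<in> A \<union> B \<Longrightarrow> g x = f x"
    "g ` clo M (A \<union> B) = clo M (f ` (A \<union> B))"
proof -
  let ?D = "clo M (A \<union> B)" and ?D' = "clo M (f ` (A \<union> B))"
  have AB: "A \<union> B \<subseteq> ?D" by (rule K_ext)
  have DU: "?D \<subseteq> univ M" using A B by (intro clo_univ) auto
  have DU': "?D' \<subseteq> univ M" using A B by (intro clo_univ) auto
  have fAB: "f ` (A \<union> B) \<subseteq> ?D'" by (rule K_ext)
  define good where "good = (\<lambda>(S, g). finite S \<and> B \<subseteq> S \<and> S \<subseteq> ?D \<and> g ` S \<subseteq> ?D' \<and>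
    qf_elem L M M (A \<union> S) g \<and> (\<forall>x\<in>A \<union> B. g x = f x))"
  define ext where "ext = (\<lambda>(S, g) (S', g'). S \<subseteq> S' \<and> (\<forall>x\<in>A \<union> S. g' x = (g x :: 'u)))"
  have goodD: "finite S" "S \<subseteq> univ M" "g ` S \<subseteq> univ M" "qf_elem L M M (A \<union> S) g" "g ` A = f ` A"
    "clo M (A \<union> S) = ?D" "clo M (g ` (A \<union> S)) = ?D'" if "good (S, g)" for S g
  proof -
    have S: "B \<subseteq> S" "S \<subseteq> ?D" "g ` S \<subseteq> ?D'" and gf: "\<And>x. x \<in> A \<union> B \<Longrightarrow> g x = f x"
      using that unfolding good_def by auto
    show "finite S" "qf_elem L M M (A \<union> S) g" using that unfolding good_def by auto
    show "S \<subseteq> univ M" "g ` S \<subseteq> univ M" using S(2,3) DU DU' by auto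
    show gA: "g ` A = f ` A" using gf by (intro image_cong) auto
    have "A \<union> S \<subseteq> ?D" using AB S(2) by blast
    then show "clo M (A \<union> S) = ?D" using K_least[of "A \<union> S"] K_mono[of "A \<union> B" "A \<union> S"] S(1) by blast
    have "f ` (A \<union> B) = g ` (A \<union> B)" using gf by (intro image_cong) auto
    then have "f ` (A \<union> B) \<subseteq> g ` (A \<union> S)" using S(1) by auto
    moreover have "g ` (A \<union> S) \<subseteq> ?D'" using gA fAB S(3) by (auto simp: image_Un)
    ultimately show "clo M (g ` (A \<union> S)) = ?D'" using K_least K_mono by (meson subset_antisym)
  qed
  have add: "\<exists>q. good q \<and> ext (S, g) q \<and> d \<in> A \<union> fst q \<and> d' \<in> snd q ` (A \<union> fst q)"
    if "good (S, g)" "d \<notin> A \<union> S" "d \<in> ?D" "d' \<in> ?D'" "qf_elem L M M (insert d (A \<union> S)) (g(d := d'))"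
    for S g d d'
  proof (intro exI conjI)
    show "good (insert d S, g(d := d'))" using that unfolding good_def by auto
    show "ext (S, g) (insert d S, g(d := d'))" using that(2) unfolding ext_def by auto
    show "d' \<in> snd (insert d S, g(d := d')) ` (A \<union> fst (insert d S, g(d := d')))"
      by (intro image_eqI[of _ _ d]) auto
  qed simp
  have forward: "\<exists>q. good q \<and> ext p q \<and> d \<in> A \<union> fst q" if p: "good p" and d: "d \<in> ?D" for p d
  proof (cases "d \<in> A \<union> fst p")
    case True
    then show ?thesis using p by (intro exI[of _ p]) (auto simp: ext_def)
  next
    case False
    obtain S g where Sg: "p = (S, g)" by (cases p)
    note S = goodD[OF p[unfolded Sg]]
    obtain d' where "d' \<in> ?D'" "qf_elem L M M (insert d (A \<union> S)) (g(d := d'))"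
      using extend_by_point[of A g S d] A S d False Sg by auto
    then show ?thesis using add[of S g d d'] p d False Sg by auto
  qed
  have backward: "\<exists>q. good q \<and> ext p q \<and> d' \<in> snd q ` (A \<union> fst q)" if p: "good p" and d': "d' \<in> ?D'" for p d'
  proof (cases "d' \<in> snd p ` (A \<union> fst p)")
    case True
    then show ?thesis using p by (intro exI[of _ p]) (auto simp: ext_def)
  next
    case False
    obtain S g where Sg: "p = (S, g)" by (cases p)
    note S = goodD[OF p[unfolded Sg]]
    have d'n: "d' \<notin> g ` A \<union> g ` S" using False Sg by auto
    define k where "k = inv_into (A \<union> S) g"
    have k: "k (g x) = x" if "x \<in> A \<union> S" for x
      using qf_elem_inj[OF S(4)] that unfolding k_def by (rule inv_into_f_f)
    have kA: "k ` g ` A = A" "k ` g ` S = S"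
      using k by (auto simp: image_comp intro!: image_eqI)
    have "qf_elem L M M (g ` A \<union> g ` S) k"
      using qf_elem_inverse[OF S(4) k] by (simp add: image_Un)
    then obtain d where d: "d \<in> ?D" "qf_elem L M M (insert d' (g ` A \<union> g ` S)) (k(d' := d))"
      using extend_by_point[of "g ` A" k "g ` S" d'] A S kA d' d'n by (auto simp: image_Un)
    let ?k = "k(d' := d)" and ?g = "g(d := d')"
    have kim: "?k ` (g ` A \<union> g ` S) = A \<union> S"
    proof -
      have "?k ` (g ` A \<union> g ` S) = k ` (g ` A \<union> g ` S)" by (intro image_cong refl) (use d'n in auto)
      then show ?thesis using kA by (simp add: image_Un)
    qed
    have dn: "d \<notin> A \<union> S"
    proof
      assume "d \<in> A \<union> S"
      then have "?k d' \<in> ?k ` (g ` A \<union> g ` S)" using kim by simp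
      then show False
        using qf_elem_inj[OF d(2)] d'n by (metis inj_on_image_mem_iff insertI1 subset_insertI)
    qed
    have "?g (?k y) = y" if "y \<in> insert d' (g ` A \<union> g ` S)" for y
      using that d'n dn k by auto
    then have "qf_elem L M M (?k ` insert d' (g ` A \<union> g ` S)) ?g"
      using qf_elem_inverse[OF d(2)] by blast
    then have "qf_elem L M M (insert d (A \<union> S)) ?g" using kim by (simp only: image_insert fun_upd_same)
    then show ?thesis using add[of S g d d'] p d(1) d' dn Sg by auto
  qed
  show thesis
  proof (cases "?D = {}")
    case True
    then show thesis using that[of f] AB f by auto
  next
    case False
    then have ne: "?D' \<noteq> {}" using fAB by auto
    have cnt: "countable ?D" "countable ?D'" using A B by (auto intro!: countable_clo simp: countable_finite)
    let ?d = "from_nat_into ?D" and ?d' = "from_nat_into ?D'"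
    have "good (B, f)" using AB fAB B(1) f unfolding good_def by auto
    have "\<exists>q. good q \<and> ext p q \<and> ?d n \<in> A \<union> fst q \<and> ?d' n \<in> snd q ` (A \<union> fst q)" if p: "good p" for p n
    proof -
      obtain q where q: "good q" "ext p q" "?d n \<in> A \<union> fst q"
        using forward[OF p, of "?d n"] from_nat_into[OF False] by blast
      obtain r where r: "good r" "ext q r" "?d' n \<in> snd r ` (A \<union> fst r)"
        using backward[OF q(1), of "?d' n"] from_nat_into[OF ne] by blast
      have "ext p r" "fst q \<subseteq> fst r" using q(2) r(2) unfolding ext_def by (auto split: prod.splits)
      then show ?thesis using r q(3) by blast
    qed
    then have "\<exists>P. \<forall>n. good (P n) \<and> ext (P n) (P (Suc n)) \<and> ?d n \<in> A \<union> fst (P (Suc n)) \<and>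
        ?d' n \<in> snd (P (Suc n)) ` (A \<union> fst (P (Suc n)))"
      using \<open>good (B, f)\<close> by (intro dependent_nat_choice[of "\<lambda>_. good" "\<lambda>n p q. ext p q \<and> ?d n \<in> A \<union> fst q \<and>
        ?d' n \<in> snd q ` (A \<union> fst q)"]) blast+
    then obtain P where P: "\<And>n. good (P n)" "\<And>n. ext (P n) (P (Suc n))" "\<And>n. ?d n \<in> A \<union> fst (P (Suc n))"
      "\<And>n. ?d' n \<in> snd (P (Suc n)) ` (A \<union> fst (P (Suc n)))" by blast
    let ?T = "\<lambda>n. A \<union> fst (P n)"
    have inc: "?T n \<subseteq> ?T (Suc n)" for n using P(2)[of n] unfolding ext_def by (auto split: prod.splits)
    have eq: "snd (P (Suc n)) x = snd (P n) x" if "x \<in> ?T n" for n x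
      using P(2)[of n] that unfolding ext_def by (auto split: prod.splits)
    obtain g where g: "\<And>n x. x \<in> ?T n \<Longrightarrow> g x = snd (P n) x"
      using limit_map[of ?T "\<lambda>n. snd (P n)"] inc eq by metis
    have G: "fst (P n) \<subseteq> ?D" "snd (P n) ` fst (P n) \<subseteq> ?D'" "B \<subseteq> fst (P n)"
      "qf_elem L M M (?T n) (snd (P n))" "\<forall>x\<in>A \<union> B. snd (P n) x = f x" for n
      using P(1)[of n] unfolding good_def by (simp_all add: case_prod_beta)
    have "qf_elem L M M (\<Union>n. ?T n) g" using inc G(4) g by (rule qf_elem_limit)
    moreover have UT: "(\<Union>n. ?T n) = ?D"
    proof
      show "(\<Union>n. ?T n) \<subseteq> ?D" using G(1) AB by blast
      show "?D \<subseteq> (\<Union>n. ?T n)"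
      proof
        fix x assume "x \<in> ?D"
        then obtain n where "x = ?d n" using from_nat_into_surj[OF cnt(1)] by metis
        then show "x \<in> (\<Union>n. ?T n)" using P(3)[of n] by blast
      qed
    qed
    moreover have "g x = f x" if "x \<in> A \<union> B" for x
    proof -
      have "x \<in> ?T 0" "snd (P 0) x = f x" using G(3,5)[of 0] that by auto
      then show ?thesis using g by metis
    qed
    moreover have "g ` ?D = ?D'"
    proof
      show "?D' \<subseteq> g ` ?D"
      proof
        fix y assume "y \<in> ?D'"
        then obtain n where "y = ?d' n" using from_nat_into_surj[OF cnt(2)] by metis
        then have "y \<in> snd (P (Suc n)) ` ?T (Suc n)" using P(4) by blast
        then obtain x where x: "x \<in> ?T (Suc n)" "y = snd (P (Suc n)) x" by blast
        then have "y = g x" using g[OF x(1)] by simp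
        then show "y \<in> g ` ?D" using x(1) UT by blast
      qed
      show "g ` ?D \<subseteq> ?D'"
      proof
        fix y assume "y \<in> g ` ?D"
        then obtain n x where x: "x \<in> ?T n" "y = g x" using UT by blast
        show "y \<in> ?D'" using x g[OF x(1)] fAB G(2,5)[of n] by auto
      qed
    qed
    ultimately show thesis using that[of g] by simp
  qed
qed

text \<open>
  QM4 followed by \<open>extend_to_closure\<close>.
\<close>

lemma extend_by_generic:
  assumes A: "countable A" "A \<subseteq> univ M" "f ` A \<subseteq> univ M" "clo M A = A" "clo M (f ` A) = f ` A"
    and f: "qf_elem L M M A f" and a: "a \<in> univ M - A" "a' \<in> univ M - f ` A"
  obtains g where "qf_elem L M M (clo M (insert a A)) g" "\<And>x. x \<in> A \<Longrightarrow> g x = f x" "g a = a'"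
    "g ` clo M (insert a A) = clo M (insert a' (f ` A))"
proof -
  let ?f = "f(a := a')"
  have im: "?f ` A = f ` A" by (intro image_cong refl) (use a in auto)
  have q: "qf_elem L M M (A \<union> {a}) ?f" using qm4[of A f a a'] assms by simp
  obtain g where g: "qf_elem L M M (clo M (A \<union> {a})) g" "\<And>x. x \<in> A \<union> {a} \<Longrightarrow> g x = ?f x"
    "g ` clo M (A \<union> {a}) = clo M (?f ` (A \<union> {a}))"
  proof (rule extend_to_closure[of A ?f "{a}"])
    show "?f ` A \<subseteq> univ M" "clo M A = A \<and> clo M (?f ` A) = ?f ` A \<or> A = {}"
      unfolding im using A by auto
    show "qf_elem L M M (A \<union> {a}) ?f" by (rule q)
  qed (use A a in auto)
  show thesis
  proof
    show "qf_elem L M M (clo M (insert a A)) g" using g(1) by simp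
    show "g x = f x" if "x \<in> A" for x using g(2)[of x] that a by auto
    show "g a = a'" using g(2)[of a] by simp
    show "g ` clo M (insert a A) = clo M (insert a' (f ` A))"
      using g(3) im by (simp only: image_Un) simp
  qed
qed

end

lemma tp_map:
  assumes "qf_elem L M M A f" "set as \<subseteq> A"
  shows "tp L M as = tp L M (map f as)"
  unfolding tp_def length_map
  by (rule qf_type_if_qf_elem[OF assms(1)]) (use assms(2) in auto)

lemma tp_enum_map:
  assumes "qf_elem L M M A f" "e ` I \<union> set bs \<subseteq> A"
  shows "tp_enum L M I e bs = tp_enum L M I (f \<circ> e) (map f bs)"
  unfolding tp_enum_def length_map
  by (rule qf_type_if_qf_elem[OF assms(1)]) (use assms(2) in \<open>auto simp: Plus_def\<close>)

lemma qf_elem_if_tp_enum: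
  assumes "tp_enum L M I e bs = tp_enum L M I e' bs'" "\<And>i. i \<in> I \<Longrightarrow> g (e i) = e' i" "map g bs = bs'"
  shows "qf_elem L M M (e ` I \<union> set bs) g"
proof -
  have "length bs' = length bs" using assms(3) by auto
  then have "qf_elem L M M (case_sum e (nth bs) ` (I <+> {..<length bs})) g"
    using assms by (intro qf_elem_if_qf_type[of L M _ _ M "case_sum e' (nth bs')"])
      (auto simp: tp_enum_def Plus_def)
  moreover have "case_sum e (nth bs) ` (I <+> {..<length bs}) = e ` I \<union> set bs"
    by (auto simp: Plus_def image_Un image_image set_conv_nth)
  ultimately show ?thesis by simp
qed

lemma countable_enum:
  assumes "countable A"
  obtains I :: "nat set" and e where "e ` I = A"
proof
  show "from_nat_into A ` (to_nat_on A ` A) = A"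
    using assms by (force simp: image_image)
qed

text \<open>
  In the axioms the enumeration \<open>e'\<close> is instantiated with \<open>f \<circ> e\<close>. In QM5 the new point may be assumed
  to differ from the old ones, since the image of an old point is already known.
\<close>

lemma weak_qm_if_weakly_quasiminimal:
  fixes L :: "('f, 'r) lang" and M :: "('f, 'r, 'u) pgstruct"
  assumes "weakly_quasiminimal L M"
  shows "weak_qm L M"
proof -
  have pg: "pregeometry (univ M) (cl M)" and st: "is_structure L M" and Q1: "QM1 L M"
    and Q3: "QM3 M" and Q4: "QM4 L M" and Q5: "QM5 L M"
    using assms unfolding weakly_quasiminimal_def by auto
  interpret pregeometry_structure M using pg by unfold_locales
  have closed: "closed_in M A" if "A \<subseteq> univ M" "clo M A = A" for A
    using that unfolding closed_in_def by (simp add: clo_eq)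
  show ?thesis
  proof
    show "is_structure L M" by (rule st)
  next
    fix A f X x
    assume q: "qf_elem L M M A f" and A: "A \<subseteq> univ M" "f ` A \<subseteq> univ M" "finite X" "X \<subseteq> A" "x \<in> A"
    obtain xs where xs: "set xs = X" using A(3) finite_list by blast
    have "tp L M (x # xs) = tp L M (f x # map f xs)" using tp_map[OF q, of "x # xs"] A xs by auto
    moreover have "set xs \<subseteq> univ M" "set (map f xs) \<subseteq> univ M" "x \<in> univ M" "f x \<in> univ M"
      using A xs by auto
    ultimately have "x \<in> cl M (set xs) \<longleftrightarrow> f x \<in> cl M (set (map f xs))"
      using Q1[unfolded QM1_def, rule_format, of x "f x" xs "map f xs"] by blast
    moreover have "X \<subseteq> univ M" "f ` X \<subseteq> univ M" using A by auto
    ultimately show "x \<in> clo M X \<longleftrightarrow> f x \<in> clo M (f ` X)" using xs by (simp add: clo_eq)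
  next
    fix A :: "'u set" assume "finite A" "A \<subseteq> univ M"
    then show "countable (clo M A)" using Q3 unfolding QM3_def by (simp add: clo_eq)
  next
    fix A f a a'
    assume A: "countable A" "A \<subseteq> univ M" "f ` A \<subseteq> univ M" "clo M A = A" "clo M (f ` A) = f ` A"
      and q: "qf_elem L M M A f" and a: "a \<in> univ M - A" "a' \<in> univ M - f ` A"
    obtain I :: "nat set" and e where e: "e ` I = A" by (rule countable_enum[OF A(1)])
    have fe: "(f \<circ> e) ` I = f ` A" using e by auto
    have "tp_enum L M I e [] = tp_enum L M I (f \<circ> e) []" using tp_enum_map[OF q, of e I "[]"] e by simp
    then have "tp_enum L M I e [a] = tp_enum L M I (f \<circ> e) [a']"
      using Q4[unfolded QM4_def, rule_format, of e I "f \<circ> e" a a'] closed A a e fe by simp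
    then have "qf_elem L M M (e ` I \<union> set [a]) (f(a := a'))"
      by (rule qf_elem_if_tp_enum) (use a e in auto)
    then show "qf_elem L M M (insert a A) (f(a := a'))" using e by simp
  next
    fix A f B a
    assume A: "countable A" "A \<subseteq> univ M" "f ` A \<subseteq> univ M"
        "clo M A = A \<and> clo M (f ` A) = f ` A \<or> A = {}"
      and B: "finite B" "B \<subseteq> univ M" "f ` B \<subseteq> univ M"
      and q: "qf_elem L M M (A \<union> B) f" and a: "a \<in> clo M (A \<union> B) - (A \<union> B)"
    obtain I :: "nat set" and e where e: "e ` I = A" by (rule countable_enum[OF A(1)])
    obtain bs where bs: "set bs = B" using B(1) finite_list by blast
    have fe: "(f \<circ> e) ` I = f ` A" using e by auto
    have t0: "tp_enum L M I e [] = tp_enum L M I (f \<circ> e) []"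
      using tp_enum_map[OF q, of e I "[]"] e by simp
    have t1: "tp_enum L M I e bs = tp_enum L M I (f \<circ> e) (map f bs)"
      using tp_enum_map[OF q, of e I bs] e bs by simp
    have "a \<in> cl M (e ` I \<union> set bs)" using a A(2) B(2) e bs clo_eq[of "A \<union> B" M] by simp
    moreover have "(closed_in M (e ` I) \<or> e ` I = {}) \<and> (closed_in M ((f \<circ> e) ` I) \<or> (f \<circ> e) ` I = {})"
      unfolding e fe using closed A by auto
    moreover have "set bs \<subseteq> univ M" "set (map f bs) \<subseteq> univ M" using bs B by auto
    ultimately obtain a' where a': "a' \<in> univ M"
        "tp_enum L M I e (bs @ [a]) = tp_enum L M I (f \<circ> e) (map f bs @ [a'])"
      using Q5[unfolded QM5_def, rule_format, of e I "f \<circ> e" bs "map f bs" a] t0 t1 by blast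
    have "qf_elem L M M (e ` I \<union> set (bs @ [a])) (f(a := a'))"
      using a'(2) by (rule qf_elem_if_tp_enum) (use a e bs in auto)
    then show "\<exists>a'\<in>univ M. qf_elem L M M (insert a (A \<union> B)) (f(a := a'))" using a'(1) e bs by auto
  qed
qed

section \<open>Closed embeddings into an infinite-dimensional structure\<close>

text \<open>
  Closed embeddings defined on a closed subset \<open>A\<close> of \<open>M\<close> only; \<open>A\<close> is not turned into a structure
  of its own.
\<close>

definition closed_emb ::
  "('f, 'r) lang \<Rightarrow> ('f, 'r, 'u) pgstruct \<Rightarrow> ('f, 'r, 'u) pgstruct \<Rightarrow> 'u set \<Rightarrow> ('u \<Rightarrow> 'u) \<Rightarrow> bool" where
  "closed_emb L M N A h \<longleftrightarrow> qf_elem L M N A h \<and> A \<subseteq> univ M \<and> h ` A \<subseteq> univ N \<and> clo M A = A \<and>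
     (\<forall>X\<subseteq>A. h ` clo M X = clo N (h ` X))"

lemma closed_embD:
  assumes "closed_emb L M N A h"
  shows "qf_elem L M N A h" "A \<subseteq> univ M" "h ` A \<subseteq> univ N" "clo M A = A"
    "\<And>X. X \<subseteq> A \<Longrightarrow> h ` clo M X = clo N (h ` X)" "inj_on h A"
  using assms qf_elem_inj[of L M N A h] unfolding closed_emb_def by simp_all

lemma closed_emb_comp:
  assumes "closed_emb L M N A h" "closed_emb L N P (h ` A) k"
  shows "closed_emb L M P A (k \<circ> h)"
proof -
  have "(k \<circ> h) ` clo M X = clo P ((k \<circ> h) ` X)" if "X \<subseteq> A" for X
    using assms that unfolding closed_emb_def by (metis image_comp image_mono)
  then show ?thesis
    using assms qf_elem_comp[of L M N A h P k] unfolding closed_emb_def by (auto simp: image_comp)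
qed

context pregeometry_structure
begin

lemma closed_emb_inverse:
  assumes "closed_emb L M N A h" "\<And>x. x \<in> A \<Longrightarrow> g (h x) = x"
  shows "closed_emb L N M (h ` A) g"
  unfolding closed_emb_def
proof (intro conjI allI impI)
  note h = closed_embD[OF assms(1)]
  have gh: "g ` h ` X = X" if "X \<subseteq> A" for X using assms(2) that by (force simp: image_image)
  show "qf_elem L N M (h ` A) g" using h(1) assms(2) by (rule qf_elem_inverse)
  show "h ` A \<subseteq> univ N" "g ` h ` A \<subseteq> univ M" using h gh by auto
  show "clo N (h ` A) = h ` A" using h(5)[of A] h(4) by simp
  fix Y assume "Y \<subseteq> h ` A"
  then obtain X where X: "X \<subseteq> A" "Y = h ` X" by (meson subset_imageE)
  have "clo M X \<subseteq> A" using K_mono[OF X(1)] h(4) by simp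
  then show "g ` clo N Y = clo M (g ` Y)" using X h(5) gh by metis
qed

lemma closed_emb_subset:
  assumes "closed_emb L M N A h" "X \<subseteq> A"
  shows "closed_emb L M N (clo M X) h"
proof -
  note h = closed_embD[OF assms(1)]
  have X: "clo M X \<subseteq> A" using K_mono[OF assms(2)] h(4) by simp
  then have "Y \<subseteq> clo M X \<Longrightarrow> h ` clo M Y = clo N (h ` Y)" for Y using h(5)[of Y] by blast
  moreover have "h ` clo M X \<subseteq> univ N" "clo M X \<subseteq> univ M" using X h(2,3) by blast+
  ultimately show ?thesis
    using qf_elem_subset[OF h(1) X] unfolding closed_emb_def by (simp add: K_idem)
qed

lemma closed_emb_if_closed_embedding:
  assumes "closed_embedding L M N \<theta>"
  shows "closed_emb L M N (univ M) \<theta>"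
proof -
  have \<theta>: "fo_embedding L M N \<theta>" "\<And>A. A \<subseteq> univ M \<Longrightarrow> \<theta> ` cl M A = cl N (\<theta> ` A)"
    using assms unfolding closed_embedding_def by auto
  have "\<theta> ` univ M \<subseteq> univ N" using \<theta>(1) unfolding fo_embedding_def by blast
  moreover have "clo M (univ M) = univ M" using clo_univ K_ext[of "univ M"] by blast
  moreover have "\<theta> ` clo M X = clo N (\<theta> ` X)" if "X \<subseteq> univ M" for X
  proof -
    have "\<theta> ` X \<subseteq> univ N" using that calculation(1) by blast
    then show ?thesis using \<theta>(2)[OF that] that by (simp add: clo_eq)
  qed
  ultimately show ?thesis using qf_elem_fo_embedding[OF \<theta>(1)] unfolding closed_emb_def by simp
qed

end

lemma (in weak_qm) closed_embI:
  assumes "qf_elem L M M D f" "D \<subseteq> univ M" "f ` D \<subseteq> univ M" "clo M D = D" "clo M (f ` D) = f ` D"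
  shows "closed_emb L M M D f"
  using assms image_clo[OF assms] unfolding closed_emb_def by simp

text \<open>
  The situation of a member \<open>M\<close> of the class generated by \<open>N\<close>. The assumption \<open>local_emb\<close> says nothing about the
  compatibility of the embeddings for different finite sets, which is supplied by the homogeneity of \<open>N\<close>.
\<close>

locale local_embeddings = M: pregeometry_structure M + N: weak_qm L N
  for L :: "('f, 'r) lang" and M N :: "('f, 'r, 'u) pgstruct" +
  assumes infinite_dim: "\<lbrakk>finite F; F \<subseteq> univ N\<rbrakk> \<Longrightarrow> clo N F \<noteq> univ N"
    and local_emb: "\<lbrakk>finite F; F \<subseteq> univ M\<rbrakk> \<Longrightarrow> \<exists>k. closed_emb L M N (clo M F) k"
    and structM: "is_structure L M"
begin

text \<open>
  Let \<open>k\<close> be any closed embedding of the closure of \<open>insert a F\<close>. The partial map \<open>h \<circ> inv k\<close> of \<open>N\<close> is an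
  isomorphism between closed sets, and as \<open>N\<close> is infinite-dimensional there is a point \<open>m\<close> outside its range.
  Extending it by \<open>k a \<mapsto> m\<close> and composing with \<open>k\<close> corrects \<open>k\<close> to an extension of \<open>h\<close>.
\<close>

lemma extend_closed_emb:
  assumes F: "finite F" "F \<subseteq> univ M" and h: "closed_emb L M N (clo M F) h" and a: "a \<in> univ M"
  shows "\<exists>h'. closed_emb L M N (clo M (insert a F)) h' \<and> (\<forall>x\<in>clo M F. h' x = h x)"
proof (cases "a \<in> clo M F")
  case True
  then have "insert a F \<subseteq> clo M F" using M.K_ext[of F] by blast
  then have "clo M (insert a F) = clo M F" using M.K_least M.K_mono[of F "insert a F"] by blast
  then show ?thesis using h by auto
next
  case False
  let ?E = "clo M F" and ?D = "clo M (insert a F)"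
  obtain k where k: "closed_emb L M N ?D k" using local_emb[of "insert a F"] F a by auto
  have ED: "?E \<subseteq> ?D" by (rule M.K_mono) blast
  have kE: "closed_emb L M N ?E k" using M.closed_emb_subset[OF k, of F] M.K_ext[of "insert a F"] by blast
  have injk: "inj_on k ?D" by (rule closed_embD(6)[OF k])
  let ?i = "inv_into ?D k"
  have i: "?i (k x) = x" if "x \<in> ?D" for x using injk that by simp
  let ?A = "k ` ?E" and ?g = "h \<circ> ?i"
  have gA: "?g ` ?A = h ` ?E" using i ED by (force simp: image_image)
  have "closed_emb L N M ?A ?i" by (rule M.closed_emb_inverse[OF kE]) (use i ED in blast)
  moreover have iA: "?i ` ?A = ?E" using i ED by (force simp: image_image)
  ultimately have g: "closed_emb L N N ?A ?g" using closed_emb_comp[of L N M ?A ?i N h] h by simp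
  have A_eq: "?A = clo N (k ` F)" using closed_embD(5)[OF k, of F] M.K_ext[of "insert a F"] by simp
  have hE_eq: "h ` ?E = clo N (h ` F)" using closed_embD(5)[OF h M.K_ext] .
  have hF: "h ` F \<subseteq> univ N" using closed_embD(3)[OF h] M.K_ext[of F] by blast
  have kF: "k ` F \<subseteq> univ N" using closed_embD(3)[OF k] M.K_ext[of "insert a F"] by blast
  obtain m where m: "m \<in> univ N - h ` ?E"
    using infinite_dim[of "h ` F"] F(1) hF hE_eq N.clo_univ[OF hF] by auto
  have aD: "a \<in> ?D" using M.K_ext[of "insert a F"] by blast
  have ka: "k a \<in> univ N - ?A"
    using closed_embD(3)[OF k] aD inj_on_image_mem_iff[OF injk aD ED] False by blast
  have kD: "k ` ?D = clo N (insert (k a) ?A)"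
  proof -
    have "?D = clo M (insert a ?E)" using M.K_Un_K[of F "{a}"] by simp
    moreover have "insert a ?E \<subseteq> ?D" using aD ED by blast
    ultimately show ?thesis using closed_embD(5)[OF k, of "insert a ?E"] by simp
  qed
  have "countable ?A" unfolding A_eq using F(1) kF by (intro N.qm3) auto
  then obtain g' where g': "qf_elem L N N (clo N (insert (k a) ?A)) g'" "\<And>x. x \<in> ?A \<Longrightarrow> g' x = ?g x"
    "g' (k a) = m" "g' ` clo N (insert (k a) ?A) = clo N (insert m (?g ` ?A))"
  proof (rule N.extend_by_generic[of ?A ?g "k a" m])
    show "?A \<subseteq> univ N" "?g ` ?A \<subseteq> univ N" "clo N ?A = ?A" "qf_elem L N N ?A ?g" "clo N (?g ` ?A) = ?g ` ?A"
      using closed_embD[OF g] closed_embD(4)[OF g] closed_embD(5)[OF g, of ?A] by auto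
    show "k a \<in> univ N - ?A" by (rule ka)
    show "m \<in> univ N - ?g ` ?A" unfolding gA by (rule m)
  qed blast
  have "closed_emb L N N (k ` ?D) g'"
    unfolding kD
  proof (rule N.closed_embI[OF g'(1)])
    show "clo N (insert (k a) ?A) \<subseteq> univ N" using kD closed_embD(3)[OF k] by blast
    show "clo N (clo N (insert (k a) ?A)) = clo N (insert (k a) ?A)" by (rule N.K_idem)
    show "g' ` clo N (insert (k a) ?A) \<subseteq> univ N"
      unfolding g'(4) gA using m closed_embD(3)[OF h] by (intro N.clo_univ) auto
    show "clo N (g' ` clo N (insert (k a) ?A)) = g' ` clo N (insert (k a) ?A)"
      unfolding g'(4) by (rule N.K_idem)
  qed
  then have "closed_emb L M N ?D (g' \<circ> k)" using closed_emb_comp[OF k] by blast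
  moreover have "(g' \<circ> k) x = h x" if "x \<in> ?E" for x
    using g'(2)[of "k x"] i[of x] that ED by auto
  ultimately show ?thesis by blast
qed

lemma countable_closed_emb:
  assumes "countable A" "A \<subseteq> univ M"
  obtains h where "closed_emb L M N (clo M A) h"
proof (cases "A = {}")
  case True
  then show thesis using that local_emb[of "{}"] by auto
next
  case False
  define T where "T n = clo M (from_nat_into A ` {..<n})" for n
  have aA: "from_nat_into A n \<in> A" for n using False by (rule from_nat_into)
  have sub: "from_nat_into A ` {..<n} \<subseteq> univ M" for n using aA assms(2) by blast
  have T_Suc: "T (Suc n) = clo M (insert (from_nat_into A n) (from_nat_into A ` {..<n}))" for n
    unfolding T_def by (simp add: lessThan_Suc)
  have inc: "T n \<subseteq> T (Suc n)" for n unfolding T_Suc unfolding T_def by (rule M.K_mono) blast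
  have "\<exists>h. \<forall>n. closed_emb L M N (T n) (h n) \<and> (\<forall>x\<in>T n. h (Suc n) x = h n x)"
  proof (rule dependent_nat_choice)
    show "\<exists>h. closed_emb L M N (T 0) h" unfolding T_def using local_emb[of "{}"] by simp
    show "\<exists>h'. closed_emb L M N (T (Suc n)) h' \<and> (\<forall>x\<in>T n. h' x = h x)"
      if "closed_emb L M N (T n) h" for h n
      using extend_closed_emb[of "from_nat_into A ` {..<n}" h "from_nat_into A n"] that sub aA assms(2)
      unfolding T_Suc unfolding T_def by blast
  qed
  then obtain hn where hn: "\<And>n. closed_emb L M N (T n) (hn n)" "\<And>n x. x \<in> T n \<Longrightarrow> hn (Suc n) x = hn n x"
    by blast
  obtain h where h: "\<And>n x. x \<in> T n \<Longrightarrow> h x = hn n x"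
    using limit_map[of T hn] inc hn(2) by metis
  have him: "h ` X = hn n ` X" if "X \<subseteq> T n" for X n using h that by (intro image_cong) auto
  have UT: "(\<Union>n. T n) = clo M A"
  proof
    show "(\<Union>n. T n) \<subseteq> clo M A" 
    proof
      fix x assume "x \<in> (\<Union>n. T n)"
      then obtain n where "x \<in> clo M (from_nat_into A ` {..<n})" unfolding T_def by blast
      moreover have "from_nat_into A ` {..<n} \<subseteq> A" using aA by blast
      ultimately show "x \<in> clo M A" using M.K_mono by blast
    qed
    show "clo M A \<subseteq> (\<Union>n. T n)"
    proof
      fix x assume "x \<in> clo M A"
      then obtain F where F: "finite F" "F \<subseteq> A" "x \<in> clo M F" using M.K_finite by blast
      have "F \<subseteq> (\<Union>n. from_nat_into A ` {..<n})"
      proof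
        fix y assume "y \<in> F"
        then obtain n where "y = from_nat_into A n" using F(2) from_nat_into_surj[OF assms(1)] by blast
        then show "y \<in> (\<Union>n. from_nat_into A ` {..<n})" by (intro UN_I[of "Suc n"]) auto
      qed
      then obtain n where n: "F \<subseteq> from_nat_into A ` {..<n}"
        by (rule finite_subset_increasing[rotated 2, of F "\<lambda>n. from_nat_into A ` {..<n}"])
          (use F(1) in \<open>auto simp: lessThan_Suc\<close>)
      then show "x \<in> (\<Union>n. T n)" using F(3) M.K_mono[OF n] unfolding T_def by blast
    qed
  qed
  have "qf_elem L M N (\<Union>n. T n) h"
    by (rule qf_elem_limit[of T L M N hn h]) (use inc hn(1) h in \<open>auto simp: closed_emb_def\<close>)
  moreover have "clo M A \<subseteq> univ M" using M.clo_univ assms(2) .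
  moreover have "h ` (\<Union>n. T n) \<subseteq> univ N" using closed_embD(3)[OF hn(1)] him by blast
  moreover have "h ` clo M X = clo N (h ` X)" if X: "X \<subseteq> (\<Union>n. T n)" for X
  proof -
    have fin: "h ` clo M F = clo N (h ` F) \<and> clo M F \<subseteq> clo M X" if F: "finite F" "F \<subseteq> X" for F
    proof -
      have "F \<subseteq> (\<Union>n. T n)" using F(2) X by blast
      then obtain n where n: "F \<subseteq> T n" using finite_subset_increasing[of T F, OF inc F(1)] by blast
      have "clo M F \<subseteq> T n" using M.K_mono[OF n] closed_embD(4)[OF hn(1)] by simp
      then show ?thesis using him n closed_embD(5)[OF hn(1) n] M.K_mono[OF F(2)] by metis
    qed
    show ?thesis
    proof
      show "h ` clo M X \<subseteq> clo N (h ` X)"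
      proof
        fix y assume "y \<in> h ` clo M X"
        then obtain x where x: "x \<in> clo M X" "y = h x" by blast
        then obtain F where F: "finite F" "F \<subseteq> X" "x \<in> clo M F" using M.K_finite by blast
        then have "y \<in> clo N (h ` F)" using fin x by blast
        then show "y \<in> clo N (h ` X)" using N.K_mono[of "h ` F" "h ` X"] F(2) by blast
      qed
      show "clo N (h ` X) \<subseteq> h ` clo M X"
      proof
        fix y assume "y \<in> clo N (h ` X)"
        then obtain G where G: "finite G" "G \<subseteq> h ` X" "y \<in> clo N G" using N.K_finite by blast
        then obtain F where F: "finite F" "F \<subseteq> X" "G = h ` F" using finite_subset_image by metis
        then show "y \<in> h ` clo M X" using G(3) fin by blast
      qed
    qed
  qed
  ultimately have "closed_emb L M N (clo M A) h" unfolding closed_emb_def UT by (simp add: M.K_idem)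
  then show thesis by (rule that)
qed

text \<open>
  The tool for pulling back axioms from \<open>N\<close>: the map \<open>f\<close> of \<open>M\<close> becomes a map \<open>k\<close> of \<open>N\<close> after embedding
  the closure of everything involved.
\<close>

lemma conjugate_into_N:
  assumes "countable Z" "Z \<subseteq> univ M" "X \<subseteq> Z" "f ` X \<subseteq> Z"
  obtains h k where "closed_emb L M N (clo M Z) h" "\<forall>y\<in>X. k (h y) = h (f y)"
    "\<forall>W\<subseteq>X. k ` h ` W = h ` f ` W"
    "\<forall>x\<in>clo M Z. \<forall>W\<subseteq>clo M Z. h x \<in> clo N (h ` W) \<longleftrightarrow> x \<in> clo M W"
    "qf_elem L M M X f \<longrightarrow> qf_elem L N N (h ` X) k"
    "\<forall>a\<in>clo M Z - X. \<forall>a'\<in>clo M Z. qf_elem L N N (insert (h a) (h ` X)) (k(h a := h a')) \<longrightarrow>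
      qf_elem L M M (insert a X) (f(a := a'))"
proof -
  obtain h where h: "closed_emb L M N (clo M Z) h" using countable_closed_emb assms(1,2) .
  note inj = closed_embD(6)[OF h]
  have Z: "Z \<subseteq> clo M Z" by (rule M.K_ext)
  define k where "k = h \<circ> f \<circ> inv_into (clo M Z) h"
  have k: "k (h y) = h (f y)" if "y \<in> X" for y
  proof -
    have "inv_into (clo M Z) h (h y) = y" using inj that assms(3) Z by (intro inv_into_f_f) auto
    then show ?thesis by (simp add: k_def)
  qed
  have im: "k ` h ` W = h ` f ` W" if "W \<subseteq> X" for W
    unfolding image_image using k that by (intro image_cong) auto
  have mem: "h x \<in> clo N (h ` W) \<longleftrightarrow> x \<in> clo M W" if "x \<in> clo M Z" "W \<subseteq> clo M Z" for x W
    using inj_on_image_mem_iff[OF inj that(1), of "clo M W"] M.K_mono[OF that(2)] M.K_idem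
      closed_embD(5)[OF h that(2)] by simp
  have q: "qf_elem L N N (h ` X) k" if "qf_elem L M M X f"
    using qf_elem_conj[OF closed_embD(1)[OF h], of X f k] k that assms(3,4) Z by auto
  have pull: "qf_elem L M M (insert a X) (f(a := a'))"
    if a: "a \<in> clo M Z - X" "a' \<in> clo M Z" and q: "qf_elem L N N (insert (h a) (h ` X)) (k(h a := h a'))"
    for a a'
  proof -
    have "(k(h a := h a')) (h y) = h ((f(a := a')) y)" if "y \<in> insert a X" for y
    proof (cases "y = a")
      case False
      then have "h y \<noteq> h a" using inj_onD[OF inj, of y a] that a(1) assms(3) Z by blast
      then show ?thesis using False that k by simp
    qed simp
    moreover have "insert a X \<subseteq> clo M Z" "f(a := a') ` insert a X \<subseteq> clo M Z"
      using a assms(3,4) Z by auto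
    ultimately show ?thesis
      using qf_elem_conj[OF closed_embD(1)[OF h], of "insert a X" "f(a := a')" "k(h a := h a')"] q by simp
  qed
  show thesis
    by (rule that[OF h, of k]; intro ballI allI impI) (simp_all add: k im mem q pull)
qed

text \<open>
  Each axiom concerns countably many elements of \<open>M\<close>, to which \<open>conjugate_into_N\<close> is applied. In QM5 the
  point found in \<open>N\<close> belongs to the range of the embedding because it lies in the closure of the image.
\<close>

theorem weak_qm_M: "weak_qm L M"
proof
  show "is_structure L M" by (rule structM)
next
  fix A f X x
  assume q: "qf_elem L M M A f" and A: "A \<subseteq> univ M" "f ` A \<subseteq> univ M" "finite X" "X \<subseteq> A" "x \<in> A"
  let ?Y = "insert x X"
  have Z: "countable (?Y \<union> f ` ?Y)" "?Y \<union> f ` ?Y \<subseteq> univ M"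
    using A by (auto intro!: countable_finite)
  obtain h k where h: "closed_emb L M N (clo M (?Y \<union> f ` ?Y)) h"
    and k: "\<forall>y\<in>?Y. k (h y) = h (f y)" and kh: "\<forall>W\<subseteq>?Y. k ` h ` W = h ` f ` W"
    and mem: "\<forall>x\<in>clo M (?Y \<union> f ` ?Y). \<forall>W\<subseteq>clo M (?Y \<union> f ` ?Y).
      h x \<in> clo N (h ` W) \<longleftrightarrow> x \<in> clo M W"
    and qk: "qf_elem L M M ?Y f \<longrightarrow> qf_elem L N N (h ` ?Y) k"
    and pull: "\<forall>a\<in>clo M (?Y \<union> f ` ?Y) - ?Y. \<forall>a'\<in>clo M (?Y \<union> f ` ?Y). qf_elem L N N (insert (h a) (h ` ?Y)) (k(h a := h a')) \<longrightarrow>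
      qf_elem L M M (insert a ?Y) (f(a := a'))"
    by (rule conjugate_into_N[OF Z Un_upper1 Un_upper2])
  note k = k[rule_format] and kh = kh[rule_format] and mem = mem[rule_format] and qk = qk[rule_format]
  let ?D = "clo M (?Y \<union> f ` ?Y)"
  have D: "?Y \<subseteq> ?D" "f ` ?Y \<subseteq> ?D" using M.K_ext[of "?Y \<union> f ` ?Y"] by blast+
  have "qf_elem L M M ?Y f" using A by (intro qf_elem_subset[OF q]) auto
  then have qk: "qf_elem L N N (h ` ?Y) k" by (rule qk)
  have "h ` ?Y \<subseteq> univ N" using closed_embD(3)[OF h] D by blast
  moreover have "k ` h ` ?Y \<subseteq> univ N" using closed_embD(3)[OF h] D kh[of ?Y] by blast
  ultimately have "h x \<in> clo N (h ` X) \<longleftrightarrow> k (h x) \<in> clo N (k ` h ` X)"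
    using N.qm1[OF qk, of "h ` X" "h x"] by blast
  moreover have "h x \<in> clo N (h ` X) \<longleftrightarrow> x \<in> clo M X" using mem[of x X] D by blast
  moreover have "h (f x) \<in> clo N (h ` f ` X) \<longleftrightarrow> f x \<in> clo M (f ` X)" using mem[of "f x" "f ` X"] D by blast
  moreover have "k (h x) = h (f x)" "k ` h ` X = h ` f ` X" using k[of x] kh[of X] by auto
  ultimately show "x \<in> clo M X \<longleftrightarrow> f x \<in> clo M (f ` X)" by simp
next
  fix A :: "'u set" assume A: "finite A" "A \<subseteq> univ M"
  obtain h where h: "closed_emb L M N (clo M A) h" using local_emb[OF A] by blast
  have "h ` clo M A = clo N (h ` A)" "h ` A \<subseteq> univ N" "inj_on h (clo M A)"
    using closed_embD(5)[OF h M.K_ext] closed_embD(3)[OF h] M.K_ext[of A] closed_embD(6)[OF h] by blast+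
  then show "countable (clo M A)" using N.qm3[of "h ` A"] A(1) countable_image_inj_on[of h "clo M A"] by simp
next
  fix A f a a'
  assume A: "countable A" "A \<subseteq> univ M" "f ` A \<subseteq> univ M" "clo M A = A" "clo M (f ` A) = f ` A"
    and q: "qf_elem L M M A f" and a: "a \<in> univ M - A" "a' \<in> univ M - f ` A"
  let ?Y = "A \<union> f ` A \<union> {a, a'}"
  have Z: "countable ?Y" "?Y \<subseteq> univ M" "A \<subseteq> ?Y" "f ` A \<subseteq> ?Y" using A a by auto
  obtain h k where h: "closed_emb L M N (clo M ?Y) h"
    and k: "\<forall>y\<in>A. k (h y) = h (f y)" and kh: "\<forall>W\<subseteq>A. k ` h ` W = h ` f ` W"
    and mem: "\<forall>x\<in>clo M ?Y. \<forall>W\<subseteq>clo M ?Y. h x \<in> clo N (h ` W) \<longleftrightarrow> x \<in> clo M W"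
    and qk: "qf_elem L M M A f \<longrightarrow> qf_elem L N N (h ` A) k"
    and pull: "\<forall>a\<in>clo M ?Y - A. \<forall>a'\<in>clo M ?Y. qf_elem L N N (insert (h a) (h ` A)) (k(h a := h a')) \<longrightarrow>
      qf_elem L M M (insert a A) (f(a := a'))"
    by (rule conjugate_into_N[OF Z])
  note k = k[rule_format] and kh = kh[rule_format] and qk = qk[rule_format]
  let ?D = "clo M ?Y"
  have D: "?Y \<subseteq> ?D" by (rule M.K_ext)
  have hq: "qf_elem L M N ?D h" "h ` ?D \<subseteq> univ N" "\<And>Z. Z \<subseteq> ?D \<Longrightarrow> h ` clo M Z = clo N (h ` Z)"
    using closed_embD[OF h] by blast+
  have inj: "inj_on h ?D" using hq(1) by (rule qf_elem_inj)
  have kA: "k ` h ` A = h ` f ` A" using kh by blast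
  have "qf_elem L N N (h ` A) k" using qk q by blast
  moreover have "clo N (h ` A) = h ` A" "clo N (h ` f ` A) = h ` f ` A"
    using hq(3)[of A] hq(3)[of "f ` A"] D A by auto
  moreover have "h a \<in> univ N - h ` A"
    using hq(2) D inj a inj_on_image_mem_iff[OF inj, of a A] by auto
  moreover have "h a' \<in> univ N - h ` f ` A"
    using hq(2) D inj a inj_on_image_mem_iff[OF inj, of a' "f ` A"] by auto
  moreover have "h ` A \<subseteq> univ N" "h ` f ` A \<subseteq> univ N"
    using hq(2) D image_mono[of A ?D h] image_mono[of "f ` A" ?D h] by blast+
  ultimately have "qf_elem L N N (insert (h a) (h ` A)) (k(h a := h a'))"
    using A(1) kA by (intro N.qm4) auto
  then show "qf_elem L M M (insert a A) (f(a := a'))" using pull D a by auto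
next
  fix A f B a
  assume A: "countable A" "A \<subseteq> univ M" "f ` A \<subseteq> univ M"
      "clo M A = A \<and> clo M (f ` A) = f ` A \<or> A = {}"
    and B: "finite B" "B \<subseteq> univ M" "f ` B \<subseteq> univ M"
    and q: "qf_elem L M M (A \<union> B) f" and a: "a \<in> clo M (A \<union> B) - (A \<union> B)"
  let ?X = "A \<union> B" let ?Y = "?X \<union> f ` ?X"
  have Z: "countable ?Y" "?Y \<subseteq> univ M" "?X \<subseteq> ?Y" "f ` ?X \<subseteq> ?Y"
    using A B by (auto intro: countable_finite)
  obtain h k where h: "closed_emb L M N (clo M ?Y) h"
    and k: "\<forall>y\<in>?X. k (h y) = h (f y)" and kim: "\<forall>W\<subseteq>?X. k ` h ` W = h ` f ` W"
    and mem: "\<forall>x\<in>clo M ?Y. \<forall>W\<subseteq>clo M ?Y. h x \<in> clo N (h ` W) \<longleftrightarrow> x \<in> clo M W"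
    and qk: "qf_elem L M M ?X f \<longrightarrow> qf_elem L N N (h ` ?X) k"
    and pull: "\<forall>a\<in>clo M ?Y - ?X. \<forall>a'\<in>clo M ?Y. qf_elem L N N (insert (h a) (h ` ?X)) (k(h a := h a')) \<longrightarrow>
      qf_elem L M M (insert a ?X) (f(a := a'))"
    by (rule conjugate_into_N[OF Z])
  note k = k[rule_format] and kim = kim[rule_format] and qk = qk[rule_format]
  let ?D = "clo M ?Y"
  have D: "?Y \<subseteq> ?D" by (rule M.K_ext)
  have hq: "qf_elem L M N ?D h" "h ` ?D \<subseteq> univ N" "\<And>Z. Z \<subseteq> ?D \<Longrightarrow> h ` clo M Z = clo N (h ` Z)"
    using closed_embD[OF h] by blast+
  have inj: "inj_on h ?D" using hq(1) by (rule qf_elem_inj)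
  have XD: "?X \<subseteq> ?D" "f ` ?X \<subseteq> ?D" using D by auto
  have AD: "A \<subseteq> ?D" "f ` A \<subseteq> ?D" using D by blast+
  have aD: "a \<in> ?D" using a M.K_mono[of ?X ?Y] by blast
  have qk: "qf_elem L N N (h ` A \<union> h ` B) k"
    using qk q by (simp add: image_Un)
  have ha: "h a \<in> clo N (h ` A \<union> h ` B)" using hq(3)[OF XD(1)] a by (auto simp: image_Un)
  have cl: "clo N (h ` A) = h ` A \<and> clo N (k ` h ` A) = k ` h ` A \<or> h ` A = {}"
    using A(4) hq(3)[OF AD(1)] hq(3)[OF AD(2)] kim[of A] by auto
  have hX: "h ` ?X \<subseteq> univ N" "h ` f ` ?X \<subseteq> univ N"
    using hq(2) image_mono[OF XD(1), of h] image_mono[OF XD(2), of h] by blast+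
  have U: "h ` A \<subseteq> univ N" "h ` B \<subseteq> univ N" "k ` h ` A \<subseteq> univ N" "k ` h ` B \<subseteq> univ N"
    using hX kim[of A] kim[of B] by (simp_all add: image_Un)
  have "h a \<notin> h ` A \<union> h ` B"
    using a inj_on_image_mem_iff[OF inj aD XD(1)] by (simp add: image_Un)
  then obtain b where b: "b \<in> clo N (k ` (h ` A \<union> h ` B))"
    "qf_elem L N N (insert (h a) (h ` A \<union> h ` B)) (k(h a := b))"
    using N.extend_by_point[of "h ` A" k "h ` B" "h a"] A(1) B(1) U cl qk ha by auto
  have "b \<in> clo N (h ` f ` ?X)" using b(1) kim[of ?X] by (simp add: image_Un)
  then have "b \<in> h ` clo M (f ` ?X)" using hq(3)[OF XD(2)] by simp
  then obtain a' where a': "a' \<in> clo M (f ` ?X)" "b = h a'" by blast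
  have a'D: "a' \<in> ?D" using a'(1) M.K_mono[of "f ` ?X" ?Y] by blast
  have "f ` ?X \<subseteq> univ M" using A(3) B(3) by auto
  then have "a' \<in> univ M" using M.clo_univ a'(1) by blast
  moreover have "qf_elem L M M (insert a ?X) (f(a := a'))"
    using pull[rule_format, of a a'] aD a a'D a'(2) b(2) by (simp add: image_Un)
  ultimately show "\<exists>a'\<in>univ M. qf_elem L M M (insert a (A \<union> B)) (f(a := a'))" by blast
qed

end

section \<open>Members of a quasiminimal class\<close>

text \<open>
  Covers both isomorphic copies (with the inverse of the isomorphism as \<open>\<theta>\<close>) and closed substructures.
\<close>

lemma pregeometry_pullback:
  assumes p: "pregeometry S c" and \<theta>: "\<theta> ` S' \<subseteq> S"
    and sub: "\<And>A. A \<subseteq> S' \<Longrightarrow> c' A \<subseteq> S'"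
    and mem: "\<And>A x. A \<subseteq> S' \<Longrightarrow> x \<in> S' \<Longrightarrow> x \<in> c' A \<longleftrightarrow> \<theta> x \<in> c (\<theta> ` A)"
  shows "pregeometry S' c'"
proof -
  have c: "A \<subseteq> S \<Longrightarrow> A \<subseteq> c A" "A \<subseteq> S \<Longrightarrow> c (c A) = c A" "A \<subseteq> S \<Longrightarrow> c A \<subseteq> S"
    "A \<subseteq> B \<Longrightarrow> B \<subseteq> S \<Longrightarrow> c A \<subseteq> c B" "A \<subseteq> S \<Longrightarrow> x \<in> c A \<Longrightarrow> \<exists>F. finite F \<and> F \<subseteq> A \<and> x \<in> c F"
    "A \<subseteq> S \<Longrightarrow> x \<in> S \<Longrightarrow> y \<in> S \<Longrightarrow> x \<in> c (insert y A) \<Longrightarrow> x \<notin> c A \<Longrightarrow> y \<in> c (insert x A)"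
    for A B x y using p unfolding pregeometry_def by simp_all
  have im: "\<theta> ` A \<subseteq> S" if "A \<subseteq> S'" for A using \<theta> that by blast
  have ext: "A \<subseteq> c' A" if "A \<subseteq> S'" for A
  proof
    fix x assume x: "x \<in> A"
    then have "\<theta> x \<in> c (\<theta> ` A)" using c(1)[OF im[OF that]] by blast
    then show "x \<in> c' A" using mem[OF that, of x] x that by blast
  qed
  have mono: "c' A \<subseteq> c' B" if AB: "A \<subseteq> B" "B \<subseteq> S'" for A B
  proof
    fix x assume x: "x \<in> c' A"
    have A: "A \<subseteq> S'" using AB by (rule subset_trans)
    have xS: "x \<in> S'" using x sub[OF A] by blast
    show "x \<in> c' B"
      using x mem[OF A xS] mem[OF AB(2) xS] c(4)[OF image_mono[OF AB(1)] im[OF AB(2)]] by blast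
  qed
  show ?thesis
    unfolding pregeometry_def
  proof (intro conjI allI impI)
    fix A assume A: "A \<subseteq> S'"
    show "A \<subseteq> c' A" "c' A \<subseteq> S'" using ext[OF A] sub[OF A] .
    show "c' (c' A) = c' A"
    proof
      have "\<theta> ` c' A \<subseteq> c (\<theta> ` A)" using mem[OF A] sub[OF A] by blast
      then have "c (\<theta> ` c' A) \<subseteq> c (\<theta> ` A)" using c(2,3)[OF im[OF A]] c(4) by metis
      then show "c' (c' A) \<subseteq> c' A" using mem[OF A] mem[OF sub[OF A]] sub[OF sub[OF A]] by blast
    qed (rule ext[OF sub[OF A]])
  next
    fix A B assume "A \<subseteq> B \<and> B \<subseteq> S'"
    then show "c' A \<subseteq> c' B" using mono[of A B] by simp
  next
    fix A x assume A: "A \<subseteq> S' \<and> x \<in> c' A"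
    then have x: "x \<in> S'" "\<theta> x \<in> c (\<theta> ` A)" using sub[of A] mem[of A x] by blast+
    obtain F where F: "finite F" "F \<subseteq> A" "\<theta> x \<in> c (\<theta> ` F)"
      using c(5)[OF im x(2)] A finite_subset_image by metis
    then show "\<exists>F. finite F \<and> F \<subseteq> A \<and> x \<in> c' F" using mem[of F x] x(1) A by (intro exI[of _ F]) auto
  next
    fix A x y assume A: "A \<subseteq> S' \<and> x \<in> S' \<and> y \<in> S' \<and> x \<in> c' (insert y A) \<and> x \<notin> c' A"
    then have "\<theta> x \<in> S" "\<theta> y \<in> S" using \<theta> by auto
    then show "y \<in> c' (insert x A)"
      using A c(6)[OF im[of A], of "\<theta> x" "\<theta> y"] mem[of A x] mem[of "insert y A" x] mem[of "insert x A" y] by simp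
  qed
qed

lemma local_emb_transfer:
  assumes M: "pregeometry_structure M" and N: "pregeometry_structure N" and e: "closed_embedding L M N \<theta>"
    and F: "F \<subseteq> univ M"
  shows "(\<exists>h. closed_emb L M P (clo M F) h) \<longleftrightarrow> (\<exists>h. closed_emb L N P (clo N (\<theta> ` F)) h)"
proof -
  interpret M: pregeometry_structure M by (rule M)
  have \<theta>: "closed_emb L M N (clo M F) \<theta>"
    using M.closed_emb_subset[OF M.closed_emb_if_closed_embedding[OF e] F] .
  have im: "\<theta> ` clo M F = clo N (\<theta> ` F)" using closed_embD(5)[OF \<theta> M.K_ext] .
  have inj: "inj_on \<theta> (clo M F)" by (rule closed_embD(6)[OF \<theta>])
  let ?i = "inv_into (clo M F) \<theta>"
  have i: "closed_emb L N M (\<theta> ` clo M F) ?i" by (rule M.closed_emb_inverse[OF \<theta>]) (simp add: inj)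
  have ii: "?i ` \<theta> ` clo M F = clo M F" using inj by (simp add: inv_into_image_cancel)
  show ?thesis
    using closed_emb_comp[OF \<theta>, of P] closed_emb_comp[OF i, of P] unfolding im[symmetric] ii by blast
qed

text \<open>
  The property passes to unions of chains because a finite subset of the union lies in a member of
  the chain, which is closed in the union.
\<close>

lemma qm_class_local_emb:
  assumes M0: "weak_qm L M0" and M: "qm_class L M0 M"
  shows "is_structure L M \<and> pregeometry_structure M \<and>
    (\<forall>F. finite F \<and> F \<subseteq> univ M \<longrightarrow> (\<exists>h. closed_emb L M M0 (clo M F) h))"
  using M
proof induction
  case generator
  interpret weak_qm L M0 by (rule M0)
  have "closed_emb L M0 M0 (clo M0 F) id" if "F \<subseteq> univ M0" for F
    using clo_univ[OF that] K_idem qf_elem_id by (intro closed_embI) auto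
  then show ?case using struct pregeometry_structure_axioms by blast
next
  case (isomorphic M N \<theta>)
  have im: "\<theta> ` univ M = univ N" and fe: "fo_embedding L M N \<theta>" using isomorphic unfolding fo_iso_def by auto
  have ce: "\<And>A. A \<subseteq> univ M \<Longrightarrow> \<theta> ` cl M A = cl N (\<theta> ` A)" using isomorphic unfolding closed_embedding_def by blast
  have p: "pregeometry (univ M) (cl M)" using isomorphic.IH unfolding pregeometry_structure_def by simp
  have clM: "cl M A \<subseteq> univ M" if "A \<subseteq> univ M" for A using p that unfolding pregeometry_def by simp
  have inj: "inj_on \<theta> (univ M)" using fe unfolding fo_embedding_def by simp
  let ?i = "inv_into (univ M) \<theta>"
  have "pregeometry (univ N) (cl N)"
  proof (rule pregeometry_pullback[OF p, of ?i])
    show "?i ` univ N \<subseteq> univ M" unfolding im[symmetric] by (intro image_subsetI inv_into_into)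
    fix A assume "A \<subseteq> univ N"
    then have "A \<subseteq> \<theta> ` univ M" using im by simp
    then obtain A0 where A0: "A0 \<subseteq> univ M" "A = \<theta> ` A0" by (rule subset_imageE)
    have A: "cl N A = \<theta> ` cl M A0" "?i ` A = A0" using ce[OF A0(1)] A0 inj by (simp_all add: inv_into_image_cancel)
    show "cl N A \<subseteq> univ N" unfolding A(1) im[symmetric] by (rule image_mono[OF clM[OF A0(1)]])
    fix x assume "x \<in> univ N"
    then obtain x0 where "x0 \<in> univ M" "x = \<theta> x0" using im by blast
    then show "x \<in> cl N A \<longleftrightarrow> ?i x \<in> cl M (?i ` A)"
      unfolding A using inj_on_image_mem_iff[OF inj _ clM[OF A0(1)]] inj by simp
  qed
  then have N: "pregeometry_structure N" by unfold_locales
  moreover have "\<exists>h. closed_emb L N M0 (clo N F) h" if F: "finite F" "F \<subseteq> univ N" for F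
  proof -
    obtain F0 where F0: "F0 \<subseteq> univ M" "finite F0" "F = \<theta> ` F0" using F im finite_subset_image by metis
    then show ?thesis using local_emb_transfer[of M N L \<theta> F0 M0] isomorphic N by auto
  qed
  moreover have "is_structure L N" using fe unfolding fo_embedding_def by simp
  ultimately show ?case by simp
next
  case (closed_sub M N)
  have c: "closed_in M (univ N)" and e: "closed_embedding L N M id" using closed_sub unfolding closed_substructure_def by auto
  have p: "pregeometry (univ M) (cl M)" using closed_sub.IH unfolding pregeometry_structure_def by simp
  have eq: "cl N A = cl M A" if "A \<subseteq> univ N" for A using e that unfolding closed_embedding_def by auto
  have U: "univ N \<subseteq> univ M" "cl M (univ N) = univ N" using c unfolding closed_in_def by auto
  have "pregeometry (univ N) (cl N)"
  proof (rule pregeometry_pullback[OF p, of id])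
    fix A assume A: "A \<subseteq> univ N"
    have "cl M A \<subseteq> cl M (univ N)" using p A U(1) unfolding pregeometry_def by simp
    then show "cl N A \<subseteq> univ N" using eq[OF A] U(2) by simp
  qed (use eq U in simp_all)
  then have N: "pregeometry_structure N" by unfold_locales
  moreover have "\<exists>h. closed_emb L N M0 (clo N F) h" if F: "finite F" "F \<subseteq> univ N" for F
    using local_emb_transfer[of N M L id F M0] F closed_sub.IH N e c unfolding closed_in_def by auto
  moreover have "is_structure L N" using e unfolding closed_embedding_def fo_embedding_def by simp
  ultimately show ?case by simp
next
  case (chain_union K M)
  have u: "univ M = (\<Union>N\<in>K. univ N)" and e: "\<And>N. N \<in> K \<Longrightarrow> closed_embedding L N M id"
    and p: "pregeometry (univ M) (cl M)" using chain_union.hyps unfolding is_chain_union_def by auto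
  have ne: "K \<noteq> {}" and ch: "\<And>N N'. N \<in> K \<Longrightarrow> N' \<in> K \<Longrightarrow> univ N \<subseteq> univ N' \<or> univ N' \<subseteq> univ N"
  proof -
    show "K \<noteq> {}" using chain_union.hyps unfolding closed_chain_def by simp
    fix N N' assume "N \<in> K" "N' \<in> K"
    then have "closed_embedding L N N' id \<or> closed_embedding L N' N id"
      using chain_union.hyps unfolding closed_chain_def by blast
    then show "univ N \<subseteq> univ N' \<or> univ N' \<subseteq> univ N"
      unfolding closed_embedding_def fo_embedding_def by auto
  qed
  have M: "pregeometry_structure M" using p by unfold_locales
  moreover have "\<exists>h. closed_emb L M M0 (clo M F) h" if F: "finite F" "F \<subseteq> univ M" for F
  proof -
    have "\<exists>S\<in>univ ` K. F \<subseteq> S"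
    proof -
      have "subset.chain UNIV (univ ` K)" using ch unfolding subset.chain_def by auto
      moreover have "F \<subseteq> \<Union> (univ ` K)" "univ ` K \<noteq> {}" using F(2) u ne by auto
      ultimately obtain S where "S \<in> univ ` K" "F \<subseteq> S" using finite_subset_Union_chain[OF F(1)] by metis
      then show ?thesis by blast
    qed
    then obtain N where N: "N \<in> K" "F \<subseteq> univ N" by blast
    then show ?thesis using local_emb_transfer[of N M L id F M0] F chain_union.IH M e by auto
  qed
  moreover have "is_structure L M"
  proof -
    obtain N where "N \<in> K" using ne by blast
    then show ?thesis using e[of N] unfolding closed_embedding_def fo_embedding_def by simp
  qed
  ultimately show ?case by simp
qed

text \<open>
  A finite set with closure \<open>univ M0\<close> would bound the dimension of \<open>M0\<close> by \<open>steinitz\<close>, contrary to QM2.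
\<close>

theorem weak_qm_if_qm_class:
  assumes "quasiminimal L M0" "qm_class L M0 M"
  shows "weak_qm L M"
proof -
  have M0: "weak_qm L M0" using assms weak_qm_if_weakly_quasiminimal unfolding quasiminimal_def by blast
  interpret M0: weak_qm L M0 by (rule M0)
  interpret M: pregeometry_structure M using qm_class_local_emb[OF M0 assms(2)] by blast
  interpret local_embeddings L M M0
  proof
    fix F :: "'c set" assume F: "finite F" "F \<subseteq> univ M0"
    show "clo M0 F \<noteq> univ M0"
    proof
      assume eq: "clo M0 F = univ M0"
      obtain I where I: "M0.basis_over {} (univ M0) I" "dim_over (cl M0) (univ M0) {} = |I|"
        using M0.dim_over_basis[of "univ M0" "{}"] by auto
      have "finite I"
        using M0.steinitz[OF F(1), of "{}" I] I(1) eq unfolding M0.basis_over_def by auto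
      moreover have "cinfinite |I|"
        using assms(1) I(2) unfolding quasiminimal_def QM2_def M0.pgdim_eq by simp
      ultimately show False by (simp add: cinfinite_def Field_card_of)
    qed
  qed (use qm_class_local_emb[OF M0 assms(2)] in blast)+
  show ?thesis by (rule weak_qm_M)
qed

section \<open>Back and forth in H-structures\<close>

lemma tval_univ: "is_structure L M \<Longrightarrow> wf_trm L t \<Longrightarrow> v ` set2_trm t \<subseteq> univ M \<Longrightarrow> tval M v t \<in> univ M"
  using tval_fo_embedding[of L M M id t v] by (simp add: fo_embedding_def)

lemma wf_trm_lang_H: "wf_trm (lang_H L) t = wf_trm L t"
  by (induction t) (auto simp: lang_H_def list_all_iff)

lemma tval_expand_H: "tval (expand_H M H) v t = tval M v t"
proof (induction t)
  case (Fn f ts)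
  then have "map (tval (expand_H M H) v) ts = map (tval M v) ts" by simp
  then show ?case by (metis fostruct.select_convs(2) expand_H_def tval.simps(2))
qed simp

lemma rint_expand_H:
  "rint (expand_H M H) None xs \<longleftrightarrow> hd xs \<in> H" "rint (expand_H M H) (Some R) xs \<longleftrightarrow> rint M R xs"
  by (simp_all add: expand_H_def)

locale h_structure = weak_qm L M for L :: "('f, 'r) lang" and M :: "('f, 'r, 'u) pgstruct" +
  fixes H :: "'u set"
  assumes h_structure: "H_structure M H"
begin

lemma H_univ: "H \<subseteq> univ M"
  using h_structure unfolding H_structure_def by simp

sublocale pregeometry_with_independent_set "clo M" H
proof
  have "cl M (H - {x}) = clo M (H - {x})" for x
    using H_univ by (intro clo_eq[symmetric]) auto
  then show "indep_over {} H"
    using h_structure unfolding H_structure_def indep_over_iff cl_independent_def by simp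
qed

lemma density:
  assumes "finite F" "F \<subseteq> univ M"
  obtains a where "a \<in> H" "a \<notin> clo M F"
proof -
  obtain bs where "set bs = F" using finite_list[OF assms(1)] by blast
  then show thesis
    using h_structure assms(2) that unfolding H_structure_def dense_codense_def clo_eq[OF assms(2)] by blast
qed

lemma codensity:
  assumes "finite F" "F \<subseteq> univ M"
  obtains a where "a \<in> univ M" "a \<notin> clo M (F \<union> H)"
proof -
  obtain bs where bs: "set bs = F" using finite_list[OF assms(1)] by blast
  have "F \<union> H \<subseteq> univ M" using assms(2) H_univ by simp
  then show thesis
    using h_structure assms(2) that bs unfolding H_structure_def dense_codense_def by (metis clo_eq)
qed

text \<open>
  Isomorphisms between closures of \<open>h \<union> b\<close> and \<open>f ` (h \<union> b)\<close>, where \<open>h\<close> is a finite subset of \<open>H\<close> and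
  \<open>b\<close> is finite and independent over \<open>H\<close>, and likewise for the images. Preservation of \<open>H\<close> on the whole
  closure is a consequence (\<open>h_iso_H\<close>).
\<close>

definition h_iso :: "('u \<Rightarrow> 'u) \<Rightarrow> 'u set \<Rightarrow> 'u set \<Rightarrow> bool" where
  "h_iso f h b \<longleftrightarrow> finite h \<and> h \<subseteq> H \<and> finite b \<and> b \<subseteq> univ M \<and> indep_over H b \<and>
     qf_elem L M M (clo M (h \<union> b)) f \<and> f ` h \<subseteq> H \<and> f ` b \<subseteq> univ M \<and> indep_over H (f ` b) \<and>
     f ` clo M (h \<union> b) = clo M (f ` (h \<union> b))"

lemma h_isoD:
  assumes "h_iso f h b"
  shows "finite h" "h \<subseteq> H" "finite b" "b \<subseteq> univ M" "indep_over H b" "qf_elem L M M (clo M (h \<union> b)) f"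
    "f ` h \<subseteq> H" "f ` b \<subseteq> univ M" "indep_over H (f ` b)" "f ` clo M (h \<union> b) = clo M (f ` (h \<union> b))"
    "h \<union> b \<subseteq> univ M" "f ` (h \<union> b) \<subseteq> univ M" "clo M (h \<union> b) \<subseteq> univ M" "f ` clo M (h \<union> b) \<subseteq> univ M"
    "inj_on f (clo M (h \<union> b))"
proof -
  have "h \<union> b \<subseteq> univ M" "f ` (h \<union> b) \<subseteq> univ M" using assms H_univ unfolding h_iso_def by auto
  then show "h \<union> b \<subseteq> univ M" "f ` (h \<union> b) \<subseteq> univ M" "clo M (h \<union> b) \<subseteq> univ M"
    "f ` clo M (h \<union> b) \<subseteq> univ M"
    using assms clo_univ[of "h \<union> b"] clo_univ[of "f ` (h \<union> b)"] unfolding h_iso_def by simp_all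
qed (use assms qf_elem_inj in \<open>auto simp: h_iso_def\<close>)

lemma clo_Int_H:
  assumes "h \<subseteq> H" "indep_over H b"
  shows "clo M (h \<union> b) \<inter> H = h"
proof
  have disj: "H \<inter> b = {}" using indep_over_disjoint[OF assms(2)] K_ext[of H] by blast
  show "clo M (h \<union> b) \<inter> H \<subseteq> h"
  proof (rule subsetI, rule ccontr)
    fix y assume y: "y \<in> clo M (h \<union> b) \<inter> H" "y \<notin> h"
    then have "h \<union> b \<subseteq> (H \<union> b) - {y}" using assms(1) disj by blast
    then have "y \<in> clo M ((H \<union> b) - {y})" using y K_mono by blast
    then show False using indep_Un_H[OF assms(2)] y unfolding indep_over_iff by auto
  qed
  show "h \<subseteq> clo M (h \<union> b) \<inter> H" using assms(1) K_ext[of "h \<union> b"] by blast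
qed

lemma h_iso_H:
  assumes p: "h_iso f h b" and x: "x \<in> clo M (h \<union> b)"
  shows "f x \<in> H \<longleftrightarrow> x \<in> H"
proof -
  note p' = h_isoD[OF p]
  have hbasis: "h \<subseteq> clo M (h \<union> b)" using K_ext[of "h \<union> b"] by blast
  have "clo M (f ` h \<union> f ` b) \<inter> H = f ` h" using clo_Int_H[OF p'(7,9)] .
  moreover have "f x \<in> clo M (f ` h \<union> f ` b)" using p'(10) x by (metis imageI image_Un)
  ultimately have "f x \<in> H \<longleftrightarrow> f x \<in> f ` h" by blast
  also have "\<dots> \<longleftrightarrow> x \<in> h" using inj_on_image_mem_iff[OF p'(15) x hbasis] .
  also have "\<dots> \<longleftrightarrow> x \<in> H" using clo_Int_H[OF p'(2,5)] x by blast
  finally show ?thesis .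
qed

lemma h_iso_inverse:
  assumes p: "h_iso f h b" and g: "\<And>x. x \<in> clo M (h \<union> b) \<Longrightarrow> g (f x) = x"
  shows "h_iso g (f ` h) (f ` b)"
proof -
  note p' = h_isoD[OF p]
  have sub: "h \<subseteq> clo M (h \<union> b)" "b \<subseteq> clo M (h \<union> b)" using K_ext[of "h \<union> b"] by blast+
  have gf: "g ` f ` X = X" if "X \<subseteq> clo M (h \<union> b)" for X
    unfolding image_image using g that by (auto simp: subset_iff image_iff)
  have hbasis: "g ` f ` h = h" "g ` f ` b = b" using gf sub by simp_all
  have "qf_elem L M M (f ` clo M (h \<union> b)) g" using p'(6) g by (rule qf_elem_inverse)
  then have "qf_elem L M M (clo M (f ` h \<union> f ` b)) g" using p'(10) by (simp add: image_Un)
  moreover have "g ` clo M (f ` h \<union> f ` b) = clo M (g ` (f ` h \<union> f ` b))"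
    using p'(10) gf[of "clo M (h \<union> b)"] hbasis by (simp add: image_Un)
  ultimately show ?thesis using p' unfolding h_iso_def hbasis by simp
qed

lemma h_iso_extend:
  assumes p: "h_iso f h b" and a: "a \<in> univ M" "a \<notin> clo M (h \<union> b)"
    and a': "a' \<in> univ M" "a' \<notin> clo M (f ` (h \<union> b))"
  obtains g where "qf_elem L M M (clo M (insert a (h \<union> b))) g" "\<forall>x\<in>clo M (h \<union> b). g x = f x" "g a = a'"
    "g ` clo M (insert a (h \<union> b)) = clo M (insert a' (f ` (h \<union> b)))"
proof -
  note p' = h_isoD[OF p]
  have cnt: "countable (clo M (h \<union> b))" using p'(1,3,11) by (intro qm3) auto
  have closed: "clo M (f ` clo M (h \<union> b)) = f ` clo M (h \<union> b)" unfolding p'(10) by (rule K_idem)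
  obtain g where g: "qf_elem L M M (clo M (insert a (clo M (h \<union> b)))) g"
    "\<And>x. x \<in> clo M (h \<union> b) \<Longrightarrow> g x = f x" "g a = a'"
    "g ` clo M (insert a (clo M (h \<union> b))) = clo M (insert a' (f ` clo M (h \<union> b)))"
  proof (rule extend_by_generic[of "clo M (h \<union> b)" f a a'])
    show "clo M (clo M (h \<union> b)) = clo M (h \<union> b)" by (rule K_idem)
  qed (use a a' p' cnt closed in \<open>simp_all del: image_Un\<close>)
  have "clo M (insert a (clo M (h \<union> b))) = clo M (insert a (h \<union> b))"
    "clo M (insert a' (f ` clo M (h \<union> b))) = clo M (insert a' (f ` (h \<union> b)))"
    using K_Un_K[of "h \<union> b" "{a}"] K_Un_K[of "f ` (h \<union> b)" "{a'}"] p'(10) by simp_all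
  then show thesis using that[of g] g by simp
qed

text \<open>
  Density provides the image of \<open>y\<close>.
\<close>

lemma h_iso_add_H:
  assumes p: "h_iso f h b" and y: "y \<in> H"
  shows "\<exists>g. h_iso g (insert y h) b \<and> (\<forall>x\<in>clo M (h \<union> b). g x = f x)"
proof (cases "y \<in> h")
  case True
  then show ?thesis using p by (auto simp: insert_absorb)
next
  case False
  note p' = h_isoD[OF p]
  have yn: "y \<notin> clo M (h \<union> b)" using clo_Int_H[OF p'(2,5)] y False by blast
  obtain y' where y': "y' \<in> H" "y' \<notin> clo M (f ` (h \<union> b))"
    using density[of "f ` (h \<union> b)"] p'(1,3,12) by auto
  obtain g where g: "qf_elem L M M (clo M (insert y (h \<union> b))) g" "\<forall>x\<in>clo M (h \<union> b). g x = f x" "g y = y'"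
    "g ` clo M (insert y (h \<union> b)) = clo M (insert y' (f ` (h \<union> b)))"
    using h_iso_extend[OF p _ yn _ y'(2)] y y'(1) H_univ by blast
  have im: "g ` h = f ` h" "g ` b = f ` b"
    using g(2) K_ext[of "h \<union> b"] by (auto intro!: image_cong)
  have "g ` clo M (insert y h \<union> b) = clo M (g ` (insert y h \<union> b))"
    using g(3,4) im by (simp add: image_Un)
  then have "h_iso g (insert y h) b" using p' y y'(1) g(1,3) im unfolding h_iso_def by simp
  then show ?thesis using g(2) by blast
qed

text \<open>
  Codensity provides the image of \<open>x\<close>.
\<close>

lemma h_iso_add_generic:
  assumes p: "h_iso f h b" and x: "x \<in> univ M" "x \<notin> clo M (b \<union> H)"
  shows "\<exists>g. h_iso g h (insert x b) \<and> (\<forall>x\<in>clo M (h \<union> b). g x = f x)"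
proof -
  note p' = h_isoD[OF p]
  have "clo M (h \<union> b) \<subseteq> clo M (b \<union> H)" using p'(2) by (intro K_mono) blast
  then have xn: "x \<notin> clo M (h \<union> b)" using x(2) by blast
  obtain x' where x': "x' \<in> univ M" "x' \<notin> clo M (f ` b \<union> H)"
    using codensity[of "f ` b"] p'(3,8) by auto
  have "clo M (f ` (h \<union> b)) \<subseteq> clo M (f ` b \<union> H)" using p'(7) by (intro K_mono) auto
  then have x'n: "x' \<notin> clo M (f ` (h \<union> b))" using x'(2) by blast
  obtain g where g: "qf_elem L M M (clo M (insert x (h \<union> b))) g" "\<forall>x\<in>clo M (h \<union> b). g x = f x" "g x = x'"
    "g ` clo M (insert x (h \<union> b)) = clo M (insert x' (f ` (h \<union> b)))"
    using h_iso_extend[OF p x(1) xn x'(1) x'n] by blast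
  have im: "g ` h = f ` h" "g ` b = f ` b"
    using g(2) K_ext[of "h \<union> b"] by (auto intro!: image_cong)
  have "g ` clo M (h \<union> insert x b) = clo M (g ` (h \<union> insert x b))"
    using g(3,4) im by (simp add: image_Un)
  moreover have "indep_over H (insert x b)" using p'(5) x(2) by (rule indep_over_insert)
  moreover have "indep_over H (insert x' (f ` b))" using p'(9) x'(2) by (rule indep_over_insert)
  ultimately have "h_iso g h (insert x b)" using p' x x' g(1,3) im unfolding h_iso_def by simp
  then show ?thesis using g(2) by blast
qed

lemma h_iso_add_H_set:
  assumes "finite F" "F \<subseteq> H" "h_iso f h b"
  shows "\<exists>g. h_iso g (F \<union> h) b \<and> (\<forall>x\<in>clo M (h \<union> b). g x = f x)"
  using assms(1,2)
proof (induction F)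
  case empty
  then show ?case using assms(3) by auto
next
  case (insert y F)
  then obtain g where g: "h_iso g (F \<union> h) b" "\<forall>x\<in>clo M (h \<union> b). g x = f x" by auto
  obtain g' where g': "h_iso g' (insert y (F \<union> h)) b" "\<forall>x\<in>clo M (F \<union> h \<union> b). g' x = g x"
    using h_iso_add_H[OF g(1), of y] insert.prems by auto
  have "clo M (h \<union> b) \<subseteq> clo M (F \<union> h \<union> b)" by (rule K_mono) blast
  then show ?case using g g' by (intro exI[of _ g']) auto
qed

text \<open>
  An element in the closure of \<open>b \<union> H\<close> is reached by adding finitely many elements of \<open>H\<close> to \<open>h\<close>; any other
  element is independent over \<open>b \<union> H\<close> and can be added to \<open>b\<close>.
\<close>

lemma h_iso_forth:
  assumes p: "h_iso f h b" and x: "x \<in> univ M"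
  obtains g h' b' where "h_iso g h' b'" "clo M (h \<union> b) \<subseteq> clo M (h' \<union> b')" "x \<in> clo M (h' \<union> b')"
    "\<forall>z\<in>clo M (h \<union> b). g z = f z"
proof (cases "x \<in> clo M (b \<union> H)")
  case True
  then obtain F where F: "finite F" "F \<subseteq> H" "x \<in> clo M (F \<union> b)"
    using K_finite_set[of "{x}" H b] by (auto simp: Un_commute)
  obtain g where g: "h_iso g (F \<union> h) b" "\<forall>z\<in>clo M (h \<union> b). g z = f z"
    using h_iso_add_H_set[OF F(1,2) p] by blast
  have "clo M (h \<union> b) \<subseteq> clo M (F \<union> h \<union> b)" "clo M (F \<union> b) \<subseteq> clo M (F \<union> h \<union> b)"
    by (rule K_mono, blast)+
  then show thesis using that[of g "F \<union> h" b] g F(3) by blast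
next
  case False
  obtain g where g: "h_iso g h (insert x b)" "\<forall>z\<in>clo M (h \<union> b). g z = f z"
    using h_iso_add_generic[OF p x False] by blast
  have "clo M (h \<union> b) \<subseteq> clo M (h \<union> insert x b)" by (rule K_mono) blast
  then show thesis using that[of g h "insert x b"] g K_ext[of "h \<union> insert x b"] by blast
qed

text \<open>
  The value of a term is not known to lie in the domain of \<open>f\<close>, so \<open>f\<close> is first extended to it. The variable
  \<open>None\<close> of the auxiliary formula stands for this value.
\<close>

lemma h_iso_tval_H:
  assumes p: "h_iso f h b" and t: "wf_trm L t" and v: "v ` set2_trm t \<subseteq> clo M (h \<union> b)"
  shows "tval M (f \<circ> v) t \<in> H \<longleftrightarrow> tval M v t \<in> H"
proof -
  let ?y = "tval M v t"
  have "?y \<in> univ M" using struct t v h_isoD(13)[OF p] by (intro tval_univ) auto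
  then obtain g h' b' where g: "h_iso g h' b'" "clo M (h \<union> b) \<subseteq> clo M (h' \<union> b')" "?y \<in> clo M (h' \<union> b')"
    "\<forall>z\<in>clo M (h \<union> b). g z = f z" using h_iso_forth[OF p] by blast
  have v': "v x \<in> clo M (h' \<union> b')" if "x \<in> set2_trm t" for x using v g(2) that by blast
  let ?\<phi> = "Eq (map_trm id Some t) (Var None)" and ?w = "case_option ?y v"
  have "sat M ?\<phi> ?w \<longleftrightarrow> sat M ?\<phi> (g \<circ> ?w)"
    by (rule qf_elemD[OF h_isoD(6)[OF g(1)]]) (use t v' g(3) in \<open>auto simp: wf_map_trm trm.set_map\<close>)
  moreover have "?w \<circ> Some = v" by auto
  then have "sat M ?\<phi> ?w" by (simp add: tval_map_trm)
  ultimately have "tval M (g \<circ> ?w \<circ> Some) t = g ?y" by (simp add: tval_map_trm)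
  moreover have "tval M (g \<circ> ?w \<circ> Some) t = tval M (f \<circ> v) t"
    by (rule tval_cong) (use v g(4) in auto)
  ultimately show ?thesis using h_iso_H[OF g(1,3)] by simp
qed

text \<open>
  The usual induction on formulas for a back-and-forth system; the inverse of an \<open>h_iso\<close> is again
  one, so the forth property suffices for the quantifier.
\<close>

lemma h_iso_sat:
  assumes "h_iso f h b" "wf_fm (lang_H L) \<phi>" "v ` fv \<phi> \<subseteq> clo M (h \<union> b)"
  shows "sat (expand_H M H) \<phi> v \<longleftrightarrow> sat (expand_H M H) \<phi> (f \<circ> v)"
  using assms
proof (induction \<phi> arbitrary: f h b v)
  case (Eq s t)
  have "sat M (Eq s t :: ('f, 'r, _) fm) v \<longleftrightarrow> sat M (Eq s t :: ('f, 'r, _) fm) (f \<circ> v)"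
    by (rule qf_elemD[OF h_isoD(6)[OF Eq.prems(1)]]) (use Eq.prems in \<open>auto simp: wf_trm_lang_H\<close>)
  then show ?case by (simp only: sat.simps tval_expand_H)
next
  case (Rel R ts)
  have ts: "\<forall>t\<in>set ts. wf_trm L t" using Rel.prems(2) by (simp add: wf_trm_lang_H)
  show ?case
  proof (cases R)
    case None
    then have "length ts = 1" using Rel.prems(2) by (simp add: lang_H_def)
    then obtain t where t: "ts = [t]" by (auto simp: length_Suc_conv)
    have "tval M (f \<circ> v) t \<in> H \<longleftrightarrow> tval M v t \<in> H"
      by (rule h_iso_tval_H[OF Rel.prems(1)]) (use ts Rel.prems(3) t in auto)
    then show ?thesis unfolding None t by (simp only: sat.simps rint_expand_H list.map list.sel tval_expand_H)
  next
    case (Some R')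
    have "sat M (Rel R' ts) v \<longleftrightarrow> sat M (Rel R' ts) (f \<circ> v)"
      by (rule qf_elemD[OF h_isoD(6)[OF Rel.prems(1)]])
        (use Rel.prems ts Some in \<open>auto simp: lang_H_def\<close>)
    moreover have "map (tval (expand_H M H) w) ts = map (tval M w) ts" for w
      by (simp add: tval_expand_H)
    ultimately show ?thesis unfolding Some by (simp only: sat.simps rint_expand_H)
  qed
next
  case (Neg \<phi>)
  have "sat (expand_H M H) \<phi> v \<longleftrightarrow> sat (expand_H M H) \<phi> (f \<circ> v)"
    by (rule Neg.IH[OF Neg.prems(1)]) (use Neg.prems in auto)
  then show ?case by (simp only: sat.simps)
next
  case (And \<phi> \<psi>)
  have "sat (expand_H M H) \<phi> v \<longleftrightarrow> sat (expand_H M H) \<phi> (f \<circ> v)"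
    by (rule And.IH(1)[OF And.prems(1)]) (use And.prems in auto)
  moreover have "sat (expand_H M H) \<psi> v \<longleftrightarrow> sat (expand_H M H) \<psi> (f \<circ> v)"
    by (rule And.IH(2)[OF And.prems(1)]) (use And.prems in auto)
  ultimately show ?case by (simp only: sat.simps)
next
  case (CConj \<Phi>)
  have "sat (expand_H M H) (\<Phi> n) v \<longleftrightarrow> sat (expand_H M H) (\<Phi> n) (f \<circ> v)" for n
  proof (rule CConj.IH[OF _ CConj.prems(1)])
    show "v ` fv (\<Phi> n) \<subseteq> clo M (h \<union> b)" using CConj.prems(3) by (simp add: image_UN) blast
  qed (use CConj.prems(2) in auto)
  then show ?case by (simp only: sat.simps)
next
  case (Ex x \<phi>)
  note p = h_isoD[OF Ex.prems(1)]
  have univ: "univ (expand_H M H) = univ M" by (simp add: expand_H_def)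
  have wf: "wf_fm (lang_H L) \<phi>" using Ex.prems(2) by simp
  have vb: "\<forall>z\<in>fv \<phi> - {x}. v z \<in> clo M (h \<union> b)" using Ex.prems(3) by auto
  have step: "sat (expand_H M H) \<phi> (w(x := d)) \<Longrightarrow> \<exists>d'\<in>univ M. sat (expand_H M H) \<phi> ((g \<circ> w)(x := d'))"
    if g: "h_iso g k c" "\<forall>z\<in>fv \<phi> - {x}. w z \<in> clo M (k \<union> c)" and d: "d \<in> univ M" for g k c w d
  proof -
    assume s: "sat (expand_H M H) \<phi> (w(x := d))"
    obtain g' k' c' where g': "h_iso g' k' c'" "clo M (k \<union> c) \<subseteq> clo M (k' \<union> c')" "d \<in> clo M (k' \<union> c')"
      "\<forall>z\<in>clo M (k \<union> c). g' z = g z" using h_iso_forth[OF g(1) d] by blast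
    have "w(x := d) ` fv \<phi> \<subseteq> clo M (k' \<union> c')"
    proof (rule image_subsetI)
      fix z assume "z \<in> fv \<phi>"
      then show "(w(x := d)) z \<in> clo M (k' \<union> c')" using g(2) g'(2,3) by (cases "z = x") auto
    qed
    then have "sat (expand_H M H) \<phi> (g' \<circ> w(x := d))"
      using Ex.IH[OF g'(1) wf, of "w(x := d)"] s by blast
    also have "sat (expand_H M H) \<phi> (g' \<circ> w(x := d)) = sat (expand_H M H) \<phi> ((g \<circ> w)(x := g' d))"
      by (rule sat_cong) (use g(2) g'(4) in auto)
    finally show "\<exists>d'\<in>univ M. sat (expand_H M H) \<phi> ((g \<circ> w)(x := d'))"
      using g'(3) h_isoD(14)[OF g'(1)] by blast
  qed
  show ?case
  proof
    assume "sat (expand_H M H) (Ex x \<phi>) v"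
    then obtain d where d: "d \<in> univ M" "sat (expand_H M H) \<phi> (v(x := d))"
      by (auto simp only: sat.simps univ)
    show "sat (expand_H M H) (Ex x \<phi>) (f \<circ> v)"
      using step[OF Ex.prems(1) vb d] by (simp only: sat.simps univ)
  next
    assume "sat (expand_H M H) (Ex x \<phi>) (f \<circ> v)"
    then obtain d where d: "d \<in> univ M" "sat (expand_H M H) \<phi> ((f \<circ> v)(x := d))"
      by (auto simp only: sat.simps univ)
    let ?g = "inv_into (clo M (h \<union> b)) f"
    have gf: "?g (f z) = z" if "z \<in> clo M (h \<union> b)" for z using p(15) that by simp
    have g: "h_iso ?g (f ` h) (f ` b)" using h_iso_inverse[OF Ex.prems(1) gf] .
    have "\<forall>z\<in>fv \<phi> - {x}. (f \<circ> v) z \<in> clo M (f ` h \<union> f ` b)"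
      using vb p(10) by (simp only: image_Un[symmetric] comp_apply) blast
    then obtain d' where d': "d' \<in> univ M" "sat (expand_H M H) \<phi> ((?g \<circ> (f \<circ> v))(x := d'))"
      using step[OF g _ d] by blast
    have "sat (expand_H M H) \<phi> ((?g \<circ> (f \<circ> v))(x := d')) = sat (expand_H M H) \<phi> (v(x := d'))"
      by (rule sat_cong) (use vb gf in auto)
    then show "sat (expand_H M H) (Ex x \<phi>) v" using d' by (auto simp only: sat.simps univ)
  qed
qed

end

section \<open>Extension\<close>

text \<open>
  The elements of \<open>S\<close> are added one at a time; by independence each of them is generic over the closure
  reached so far, and so is its image.
\<close>

lemma (in weak_qm) extend_by_generic_set:
  assumes A: "countable A" "A \<subseteq> univ M" "f ` A \<subseteq> univ M" "clo M A = A" "clo M (f ` A) = f ` A"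
    "qf_elem L M M A f"
    and S: "finite S" "S \<subseteq> univ M" "indep_over A S"
    and p: "inj_on p S" "p ` S \<subseteq> univ M" "indep_over (f ` A) (p ` S)"
  shows "\<exists>g. qf_elem L M M (clo M (A \<union> S)) g \<and> (\<forall>x\<in>A. g x = f x) \<and> (\<forall>x\<in>S. g x = p x) \<and>
    g ` clo M (A \<union> S) = clo M (f ` A \<union> p ` S)"
  using S p
proof (induction S)
  case empty
  then show ?case using A by (intro exI[of _ f]) simp
next
  case (insert s S)
  have "indep_over A S" using insert.prems(2) by (rule indep_over_subset) blast
  moreover have "indep_over (f ` A) (p ` S)" using insert.prems(5) by (rule indep_over_subset) blast
  ultimately obtain g where g: "qf_elem L M M (clo M (A \<union> S)) g" "\<forall>x\<in>A. g x = f x" "\<forall>x\<in>S. g x = p x"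
    "g ` clo M (A \<union> S) = clo M (f ` A \<union> p ` S)" using insert by auto
  let ?D = "clo M (A \<union> S)"
  have ps: "p s \<notin> p ` S" using insert.prems(3) insert.hyps(2) by auto
  have s: "s \<notin> ?D"
    using insert.prems(2) insert.hyps(2) unfolding indep_over_iff by (auto simp: Un_commute)
  have p's: "p s \<notin> clo M (f ` A \<union> p ` S)"
  proof -
    have "p ` insert s S - {p s} = p ` S" using ps by auto
    moreover have "p s \<notin> clo M ((p ` insert s S - {p s}) \<union> f ` A)"
      using insert.prems(5) unfolding indep_over_iff by blast
    ultimately show ?thesis by (metis Un_commute)
  qed
  have AS: "A \<union> S \<subseteq> univ M" "f ` A \<union> p ` S \<subseteq> univ M" using A(2,3) insert.prems(1,4) by auto
  have cnt: "countable ?D" using A(1) insert.hyps(1) AS(1) by (intro countable_clo) (auto intro: countable_finite)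
  obtain g' where g': "qf_elem L M M (clo M (insert s ?D)) g'" "\<And>x. x \<in> ?D \<Longrightarrow> g' x = g x" "g' s = p s"
    "g' ` clo M (insert s ?D) = clo M (insert (p s) (g ` ?D))"
  proof (rule extend_by_generic[of ?D g s "p s"])
    show "countable ?D" by (rule cnt)
    show "?D \<subseteq> univ M" "g ` ?D \<subseteq> univ M" unfolding g(4) using clo_univ AS by auto
    show "clo M ?D = ?D" "clo M (g ` ?D) = g ` ?D" unfolding g(4) by (rule K_idem)+
    show "qf_elem L M M ?D g" by (rule g(1))
    show "s \<in> univ M - ?D" "p s \<in> univ M - g ` ?D" unfolding g(4) using s p's insert.prems(1,4) by auto
  qed blast
  have eq: "clo M (insert s ?D) = clo M (A \<union> insert s S)"
    "clo M (insert (p s) (g ` ?D)) = clo M (f ` A \<union> p ` insert s S)"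
    unfolding g(4) using K_Un_K[of "A \<union> S" "{s}"] K_Un_K[of "f ` A \<union> p ` S" "{p s}"] by simp_all
  have "g' x = g x" if "x \<in> A \<union> S" for x using g'(2)[of x] K_ext[of "A \<union> S"] that by blast
  then show ?case using g g' unfolding eq by (intro exI[of _ g']) simp
qed

context h_structure
begin

text \<open>
  A formula mentions only a finite set \<open>P\<close> of parameters, so the map may depend on \<open>P\<close>.
\<close>

lemma same_type_if_h_isos:
  assumes len: "length cs = length as"
    and p: "\<And>P. finite P \<Longrightarrow> P \<subseteq> B \<Longrightarrow> \<exists>f h b. h_iso f h b \<and> set as \<union> P \<subseteq> clo M (h \<union> b) \<and>
      map f as = cs \<and> (\<forall>x\<in>P. f x = x)"
  shows "tp_H L M H cs B = tp_H L M H as B"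
proof -
  have "sat (expand_H M H) \<phi> (case_sum (nth as) id) \<longleftrightarrow> sat (expand_H M H) \<phi> (case_sum (nth cs) id)"
    if \<phi>: "wf_fm (lang_H L) \<phi>" "finite (fv \<phi>)" "fv \<phi> \<subseteq> {..<length as} <+> B" for \<phi>
  proof -
    let ?P = "{x \<in> B. Inr x \<in> fv \<phi>}"
    have "finite ?P"
      by (rule finite_subset[OF _ finite_vimageI[OF \<phi>(2), of Inr]]) auto
    then obtain f h b where f: "h_iso f h b" "set as \<union> ?P \<subseteq> clo M (h \<union> b)" "map f as = cs" "\<forall>x\<in>?P. f x = x"
      using p[of ?P] by blast
    have "case_sum (nth as) id ` fv \<phi> \<subseteq> clo M (h \<union> b)"
      using \<phi>(3) f(2) by (auto simp: subset_iff Plus_def)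
    then have "sat (expand_H M H) \<phi> (case_sum (nth as) id) \<longleftrightarrow>
        sat (expand_H M H) \<phi> (f \<circ> case_sum (nth as) id)"
      using h_iso_sat[OF f(1) \<phi>(1)] by blast
    also have "\<dots> \<longleftrightarrow> sat (expand_H M H) \<phi> (case_sum (nth cs) id)"
      by (rule sat_cong) (use \<phi>(3) f(3,4) in \<open>auto simp: Plus_def\<close>)
    finally show ?thesis .
  qed
  then show ?thesis unfolding tp_H_def inf_type_over_def len by blast
qed

text \<open>
  The last two assumptions say that there is room for a copy \<open>S'\<close> of \<open>S\<close> that is independent from \<open>C\<close>. The
  tuple \<open>cs\<close> lies in the closure of \<open>W \<union> S'\<close>, which yields independence directly: \<open>G'\<close> is
  independent over \<open>C \<union> H\<close>, and \<open>hbasis (B \<union> set cs)\<close> is contained in \<open>hbasis B \<union> F0'\<close>, where \<open>F0'\<close>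
  avoids \<open>hbasis C\<close>. The difficulty is to find one tuple \<open>cs\<close> for all parameters in the possibly uncountable set
  \<open>B\<close>. It is resolved by the fact that candidates range over the countable set \<open>T\<close>.
\<close>

lemma h_indep_extension:
  assumes as: "set as \<subseteq> univ M" and B: "B \<subseteq> C" "C \<subseteq> univ M"
    and room_H: "infinite (H - hbasis C)"
    and room: "\<And>n. \<exists>T\<subseteq>univ M. finite T \<and> card T = n \<and> indep_over (C \<union> H) T"
  shows "\<exists>cs. set cs \<subseteq> univ M \<and> tp_H L M H cs B = tp_H L M H as B \<and> h_indep (set cs) B C"
proof -
  obtain R where R: "basis_over H B R" using basis_over_exists by blast
  obtain G where G: "basis_over (B \<union> H) (set as) G" using basis_over_exists by blast
  note RG = basis_Un[OF R G]
  define W where "W = hbasis B \<union> R"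
  have BW: "B \<subseteq> clo M W" using basis_span_iff[OF R hbasis_subset] unfolding W_def by (simp add: Un_commute)
  have Gfin: "finite G" "G \<subseteq> univ M" using G as finite_subset unfolding basis_over_def by auto
  have R': "R \<subseteq> B" "indep_over H R" using R unfolding basis_over_def by auto
  have WU: "W \<subseteq> univ M" using R' B hbasis_subset[of B] H_univ unfolding W_def by blast
  obtain F1 where F1: "finite F1" "F1 \<subseteq> H" "set as \<subseteq> clo M (F1 \<union> (R \<union> G))"
    using K_finite_set[of "set as" H "R \<union> G"] RG unfolding basis_over_def by (auto simp: Un_commute)
  define F0 where "F0 = F1 - hbasis B"
  have F0: "finite F0" "F0 \<subseteq> H" "F0 \<inter> hbasis B = {}" using F1 unfolding F0_def by auto
  define S where "S = F0 \<union> G"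
  have "clo M (F1 \<union> (R \<union> G)) \<subseteq> clo M (W \<union> S)"
    by (rule K_mono) (use F1 in \<open>auto simp: W_def S_def F0_def\<close>)
  then obtain E0 where E0: "finite E0" "E0 \<subseteq> W" "set as \<subseteq> clo M (E0 \<union> S)"
    using K_finite_set[of "set as" W S] F1(3) by auto
  obtain F0' where F0': "F0' \<subseteq> H - hbasis C" "finite F0'" "card F0' = card F0"
    using infinite_arbitrarily_large[OF room_H, of "card F0"] by blast
  obtain G' where G': "G' \<subseteq> univ M" "finite G'" "card G' = card G" "indep_over (C \<union> H) G'"
    using room by blast
  define S' where "S' = F0' \<union> G'"
  have dis: "H \<inter> R = {}" "(B \<union> H) \<inter> G = {}" "(C \<union> H) \<inter> G' = {}"
    using indep_over_disjoint[OF R'(2)] indep_over_disjoint[of "B \<union> H" G] indep_over_disjoint[OF G'(4)]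
      G K_ext[of H] K_ext[of "B \<union> H"] K_ext[of "C \<union> H"] unfolding basis_over_def by blast+
  have hbBC: "hbasis B \<subseteq> hbasis C" using hbasis_mono[OF B(1)] .
  have RG': "indep_over H (R \<union> G')"
  proof (rule indep_over_Un[OF R'(2)])
    show "indep_over (H \<union> R) G'"
      using G'(4) by (rule indep_over_mono_base) (use R'(1) B(1) in blast)
  qed
  have indep: "indep_over W S" "indep_over W S'"
  proof -
    have "W \<union> S \<subseteq> H \<union> (R \<union> G)" "W \<union> S' \<subseteq> H \<union> (R \<union> G')"
      using F0 F0' hbasis_subset[of B] unfolding W_def S_def S'_def by auto
    then have "indep_over {} (W \<union> S)" "indep_over {} (W \<union> S')"
      using indep_over_subset[OF indep_Un_H] RG RG' unfolding basis_over_def by blast+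
    moreover have "W \<inter> S = {}"
    proof -
      have "hbasis B \<inter> G = {}" "R \<inter> F0 = {}" "R \<inter> G = {}"
        using hbasis_subset[of B] dis(1,2) F0(2) R'(1) by auto
      then show ?thesis using F0(3) unfolding W_def S_def by auto
    qed
    moreover have "W \<inter> S' = {}"
    proof -
      have "hbasis B \<inter> G' = {}" "R \<inter> F0' = {}" "R \<inter> G' = {}" "hbasis B \<inter> F0' = {}"
        using hbasis_subset[of B] dis(1,3) F0'(1) R'(1) B(1) hbBC by auto
      then show ?thesis unfolding W_def S'_def by auto
    qed
    ultimately show "indep_over W S" "indep_over W S'"
      using indep_over_UnD[of "{}" W S] indep_over_UnD[of "{}" W S'] by auto
  qed
  obtain p1 where p1: "bij_betw p1 F0 F0'"
    using finite_same_card_bij[OF F0(1) F0'(2)] F0'(3) by auto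
  obtain p2 where p2: "bij_betw p2 G G'"
    using finite_same_card_bij[OF Gfin(1) G'(2)] G'(3) by auto
  define p where "p x = (if x \<in> H then p1 x else p2 x)" for x
  have pF: "p x = p1 x" if "x \<in> F0" for x using that F0(2) by (auto simp: p_def)
  have pG: "p x = p2 x" if "x \<in> G" for x using that dis(2) by (auto simp: p_def)
  have pim: "p ` F0 = F0'" "p ` G = G'"
    using p1 p2 pF pG by (simp_all add: bij_betw_def cong: image_cong_simp)
  have pinj: "inj_on p S"
    unfolding S_def
  proof (rule inj_on_Un[THEN iffD2], intro conjI)
    show "inj_on p F0" using p1 pF inj_on_cong[of F0 p p1] by (simp add: bij_betw_def)
    show "inj_on p G" using p2 pG inj_on_cong[of G p p2] by (simp add: bij_betw_def)
    have "p ` (F0 - G) \<inter> p ` (G - F0) \<subseteq> F0' \<inter> G'" using pim by blast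
    then show "p ` (F0 - G) \<inter> p ` (G - F0) = {}" using dis(3) F0'(1) by blast
  qed
  have pS: "p ` S = S'" unfolding S_def S'_def image_Un pim ..
  have SU: "finite S" "S \<subseteq> univ M" "S' \<subseteq> univ M"
    using F0 F0' Gfin G' H_univ unfolding S_def S'_def by auto
  \<comment> \<open>For countable parts of \<open>W\<close> the required isomorphism exists.\<close>
  have ext: "\<exists>g. qf_elem L M M (clo M (E \<union> S)) g \<and> (\<forall>x\<in>clo M E. g x = x) \<and> (\<forall>x\<in>S. g x = p x) \<and>
      g ` clo M (E \<union> S) = clo M (E \<union> S')" if E: "countable E" "E \<subseteq> W" for E
  proof -
    have EU: "E \<subseteq> univ M" using E(2) WU by blast
    have "clo M E \<subseteq> clo M W" by (rule K_mono[OF E(2)])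
    then have i: "indep_over (clo M E) S" "indep_over (clo M E) S'"
      using indep indep_over_base by blast+
    have "\<exists>g. qf_elem L M M (clo M (clo M E \<union> S)) g \<and> (\<forall>x\<in>clo M E. g x = id x) \<and> (\<forall>x\<in>S. g x = p x) \<and>
      g ` clo M (clo M E \<union> S) = clo M (id ` clo M E \<union> p ` S)"
      using countable_clo[OF E(1) EU] clo_univ[OF EU] SU pinj i K_idem qf_elem_id[unfolded id_def]
      by (intro extend_by_generic_set) (simp_all add: pS)
    then show ?thesis by (simp add: pS K_Un_K)
  qed
  have ES: "((E \<inter> H) \<union> F0) \<union> ((E - H) \<union> G) = E \<union> S" for E unfolding S_def by auto
  \<comment> \<open>Its restriction to the closure of a finite part belongs to the back-and-forth system.\<close>
  have restrict: "h_iso g ((E \<inter> H) \<union> F0) ((E - H) \<union> G)"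
    if E: "finite E" "E \<subseteq> W" "E \<subseteq> E'" "E' \<subseteq> W"
      and g: "qf_elem L M M (clo M (E' \<union> S)) g" "\<forall>x\<in>clo M E'. g x = x" "\<forall>x\<in>S. g x = p x"
      "g ` clo M (E' \<union> S) = clo M (E' \<union> S')" for g E E'
  proof -
    have gE: "g ` X = X" if "X \<subseteq> E" for X
    proof -
      have "g x = x" if "x \<in> X" for x using g(2) that \<open>X \<subseteq> E\<close> E(3) K_ext[of E'] by blast
      then show ?thesis by simp
    qed
    have gS: "g ` F0 = F0'" "g ` G = G'"
      using g(3) pim unfolding S_def by (auto simp: image_iff)
    have ER: "E - H \<subseteq> R" using E(2) hbasis_subset[of B] unfolding W_def by blast
    have EU: "E' \<union> S \<subseteq> univ M" "E' \<union> S' \<subseteq> univ M" using E(4) WU SU by auto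
    have gU: "g ` clo M (E' \<union> S) \<subseteq> univ M" unfolding g(4) by (rule clo_univ[OF EU(2)])
    have ES': "E \<union> S \<subseteq> clo M (E' \<union> S)" using E(3) K_ext[of "E' \<union> S"] by blast
    have im: "g ` clo M (E \<union> S) = clo M (g ` (E \<union> S))"
      by (rule image_clo[OF g(1) clo_univ[OF EU(1)] gU K_idem _ ES']) (simp only: g(4) K_idem)
    have "clo M (E \<union> S) \<subseteq> clo M (E' \<union> S)" using K_mono[of "E \<union> S" "E' \<union> S"] E(3) by blast
    then have q: "qf_elem L M M (clo M (E \<union> S)) g" using g(1) qf_elem_subset by blast
    have ind: "indep_over H ((E - H) \<union> G)" "indep_over H ((E - H) \<union> G')"
      using RG RG' ER indep_over_subset[of H "R \<union> G" "(E - H) \<union> G"]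
        indep_over_subset[of H "R \<union> G'" "(E - H) \<union> G'"] unfolding basis_over_def by auto
    have img: "g ` ((E \<inter> H) \<union> F0) = (E \<inter> H) \<union> F0'" "g ` ((E - H) \<union> G) = (E - H) \<union> G'"
      unfolding image_Un gS using gE[of "E \<inter> H"] gE[of "E - H"] by simp_all
    show ?thesis
      unfolding h_iso_def ES img
    proof (intro conjI)
      show "E \<inter> H \<union> F0 \<subseteq> H" using F0(2) by blast
      show "E \<inter> H \<union> F0' \<subseteq> H" using F0'(1) by blast
      show "E - H \<union> G \<subseteq> univ M" "E - H \<union> G' \<subseteq> univ M" using E(2) WU Gfin(2) G'(1) by auto
    qed (use E(1) F0(1) Gfin(1) ind q im in simp_all)
  qed
  define T where "T = clo M (E0 \<union> S')"
  have TU: "E0 \<union> S' \<subseteq> univ M" using E0(2) WU SU by auto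
  have Tcnt: "countable T"
    unfolding T_def using E0(1) F0'(2) G'(2) TU by (intro qm3) (auto simp: S'_def)
  \<comment> \<open>The candidate \<open>cs\<close> is not refuted by the finite part \<open>E\<close>.\<close>
  define ok where "ok E cs \<longleftrightarrow> (\<exists>f. h_iso f ((E \<inter> H) \<union> F0) ((E - H) \<union> G) \<and> (\<forall>x\<in>clo M E. f x = x) \<and> map f as = cs)"
    for E cs
  \<comment> \<open>Parts that contain \<open>E0\<close>, so that \<open>as\<close> lies in the closure of \<open>E \<union> S\<close>.\<close>
  define \<E> where "\<E> = {E. finite E \<and> E0 \<subseteq> E \<and> E \<subseteq> W}"
  have "\<exists>cs\<in>lists T. \<forall>E\<in>\<E>. ok E cs"
  proof (rule ccontr)
    assume "\<not> (\<exists>cs\<in>lists T. \<forall>E\<in>\<E>. ok E cs)"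
    then have "\<forall>cs\<in>lists T. \<exists>E. E \<in> \<E> \<and> \<not> ok E cs"
      by (simp add: Bex_def)
    then obtain X where X': "\<forall>cs\<in>lists T. X cs \<in> \<E> \<and> \<not> ok (X cs) cs" using bchoice by metis
    then have X: "finite (X cs)" "E0 \<subseteq> X cs" "X cs \<subseteq> W" "\<not> ok (X cs) cs" if "cs \<in> lists T" for cs
      using that unfolding \<E>_def by auto
    \<comment> \<open>A countable part of \<open>W\<close> that contains a refutation of every candidate.\<close>
    define E' where "E' = E0 \<union> (\<Union>cs\<in>lists T. X cs)"
    have "countable E'"
      unfolding E'_def
      using countable_finite[OF E0(1)] countable_finite[OF X(1)] countable_lists[OF Tcnt]
      by (intro countable_Un countable_UN)
    moreover have E'W: "E' \<subseteq> W" using E0(2) X(3) unfolding E'_def by blast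
    ultimately obtain g where g: "qf_elem L M M (clo M (E' \<union> S)) g" "\<forall>x\<in>clo M E'. g x = x" "\<forall>x\<in>S. g x = p x"
      "g ` clo M (E' \<union> S) = clo M (E' \<union> S')" using ext[of E'] by blast
    let ?cs = "map g as"
    have "h_iso g ((E0 \<inter> H) \<union> F0) ((E0 - H) \<union> G)"
      by (rule restrict[OF E0(1,2) _ E'W g]) (simp add: E'_def)
    then have "g ` clo M (E0 \<union> S) = clo M (g ` (E0 \<union> S))"
      using h_isoD(10)[of g "(E0 \<inter> H) \<union> F0" "(E0 - H) \<union> G"] unfolding ES by blast
    moreover have "g ` (E0 \<union> S) = E0 \<union> S'"
    proof -
      have "g x = x" if "x \<in> E0" for x using g(2) that K_ext[of E'] unfolding E'_def by blast
      then have "g ` E0 = E0" by simp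
      moreover have "g ` S = S'" using g(3) pS by (simp cong: image_cong_simp)
      ultimately show ?thesis by (simp add: image_Un)
    qed
    ultimately have "g ` set as \<subseteq> T" using E0(3) unfolding T_def by (metis image_mono)
    then have cs: "?cs \<in> lists T" by (simp add: lists_eq_set)
    have "h_iso g ((X ?cs \<inter> H) \<union> F0) ((X ?cs - H) \<union> G)"
      by (rule restrict[OF _ _ _ E'W g]) (use X(1,3)[OF cs] cs in \<open>auto simp: E'_def\<close>)
    moreover have "clo M (X ?cs) \<subseteq> clo M E'" by (rule K_mono) (use cs in \<open>auto simp: E'_def\<close>)
    ultimately have "ok (X ?cs) ?cs" unfolding ok_def using g(2) by blast
    then show False using X(4)[OF cs] by blast
  qed
  then obtain cs where cs: "cs \<in> lists T" and ok': "\<forall>E\<in>\<E>. ok E cs" by blast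
  have ok: "ok E cs" if "finite E" "E0 \<subseteq> E" "E \<subseteq> W" for E using ok' that unfolding \<E>_def by simp
  have csT: "set cs \<subseteq> T" using cs by (auto simp: lists_eq_set)
  have "tp_H L M H cs B = tp_H L M H as B"
  proof (rule same_type_if_h_isos)
    show "length cs = length as" using ok[of E0] E0 unfolding ok_def by auto
    fix P assume P: "finite P" "P \<subseteq> B"
    then obtain E1 where E1: "finite E1" "E1 \<subseteq> W" "P \<subseteq> clo M E1"
      using K_finite_set[of P W "{}"] BW by auto
    then obtain f where f: "h_iso f (((E0 \<union> E1) \<inter> H) \<union> F0) (((E0 \<union> E1) - H) \<union> G)"
      "\<forall>x\<in>clo M (E0 \<union> E1). f x = x" "map f as = cs"
      using ok[of "E0 \<union> E1"] E0 unfolding ok_def by auto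
    note eq = ES[of "E0 \<union> E1"]
    have "clo M E1 \<subseteq> clo M (E0 \<union> E1)" "clo M E1 \<subseteq> clo M (E0 \<union> E1 \<union> S)" "clo M (E0 \<union> S) \<subseteq> clo M (E0 \<union> E1 \<union> S)"
      by (rule K_mono, blast)+
    then have "set as \<union> P \<subseteq> clo M (E0 \<union> E1 \<union> S)" "\<forall>x\<in>P. f x = x" using E1(3) E0(3) f(2) by blast+
    then show "\<exists>f h b. h_iso f h b \<and> set as \<union> P \<subseteq> clo M (h \<union> b) \<and> map f as = cs \<and> (\<forall>x\<in>P. f x = x)"
      using f(1,3) eq by metis
  qed
  moreover have "h_indep (set cs) B C"
    unfolding h_indep_def
  proof
    have EW: "E0 \<union> S' \<subseteq> (R \<union> G') \<union> (hbasis B \<union> F0')" using E0(2) unfolding W_def S'_def by blast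
    then have "T \<subseteq> clo M ((R \<union> G') \<union> (hbasis B \<union> F0'))" unfolding T_def by (rule K_mono)
    then have csW: "set cs \<subseteq> clo M ((R \<union> G') \<union> (hbasis B \<union> F0'))" using csT by blast
    have "clo M ((R \<union> G') \<union> (hbasis B \<union> F0')) \<subseteq> clo M (G' \<union> (B \<union> H))"
      by (rule K_mono) (use R'(1) hbasis_subset[of B] F0'(1) in blast)
    then have "set cs \<subseteq> clo M (G' \<union> (B \<union> H))" using csW by blast
    moreover have "indep_over (B \<union> H \<union> C) G'" using G'(4) by (rule indep_over_mono_base) (use B(1) in blast)
    ultimately show "orth (B \<union> H) (set cs) C" by (intro orth_spanned)
    have "clo M W \<subseteq> clo M ((R \<union> G') \<union> (hbasis B \<union> F0'))" unfolding W_def by (rule K_mono) blast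
    then have "B \<union> set cs \<subseteq> clo M ((R \<union> G') \<union> (hbasis B \<union> F0'))" using csW BW by blast
    then have "hbasis (B \<union> set cs) \<subseteq> hbasis B \<union> F0'"
      using hbasis_spanned[of "hbasis B \<union> F0'" "R \<union> G'"] RG' hbasis_subset[of B] F0'(1) by blast
    moreover have "B \<union> C = C" using B(1) by blast
    ultimately show "hbasis (B \<union> set cs) \<inter> hbasis (B \<union> C) \<subseteq> hbasis B" using F0'(1) by auto
  qed
  moreover have "set cs \<subseteq> univ M" using csT clo_univ[OF TU] unfolding T_def by blast
  ultimately show ?thesis by blast
qed

end

section \<open>Independence in terms of supports\<close>

lemma finite_card_of_less:
  assumes "finite A" "Well_order r" "infinite (Field r)"
  shows "|A| <o r"
  using finite_ordLess_infinite[OF card_of_Well_order assms(2)] assms by (simp add: Field_card_of)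

lemma card_UN_finite_less:
  assumes \<kappa>: "Card_order \<kappa>" "cinfinite \<kappa>" and C: "|C| <o \<kappa>" and F: "\<And>x. x \<in> C \<Longrightarrow> finite (F x)"
  shows "|\<Union>x\<in>C. F x| <o \<kappa>"
proof (cases "finite C")
  case True
  then have "finite (\<Union>x\<in>C. F x)" using F by blast
  then show ?thesis
    using \<kappa> card_order_on_well_order_on by (intro finite_card_of_less) (auto simp: cinfinite_def)
next
  case False
  have "|F x| \<le>o |C|" if "x \<in> C" for x
    using False by (intro ordLess_imp_ordLeq finite_card_of_less F that) (simp_all add: Field_card_of card_of_well_order_on)
  then have "|\<Union>x\<in>C. F x| \<le>o |C|"
    using card_of_UNION_ordLeq_infinite[OF False ordIso_imp_ordLeq[OF card_of_refl]] by blast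
  then show ?thesis using C ordLeq_ordLess_trans by blast
qed

lemma infinite_Diff_if_card_less:
  assumes \<kappa>: "Card_order \<kappa>" "cinfinite \<kappa>" and A: "|A| =o \<kappa>" and B: "|B| <o \<kappa>"
  shows "infinite (A - B)"
proof
  assume fin: "finite (A - B)"
  have infA: "infinite A"
    using A \<kappa>(2) card_of_ordIso_finite_Field[OF \<kappa>(1), of A] ordIso_symmetric
    unfolding cinfinite_def by blast
  have "|B| <o |A|" using B A ordLess_ordIso_trans ordIso_symmetric by blast
  moreover have "|A - B| <o |A|" 
    using infA by (intro finite_card_of_less fin) (simp_all add: Field_card_of card_of_well_order_on)
  ultimately have "|(A - B) \<union> B| <o |A|" using card_of_Un_ordLess_infinite[OF infA] by blast
  moreover have "|A| \<le>o |(A - B) \<union> B|" by (rule card_of_mono1) blast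
  ultimately show False using not_ordLess_ordLeq by blast
qed

text \<open>
  Each element of \<open>C\<close> depends on finitely many elements of \<open>J\<close> over \<open>D\<close>. Their union has fewer than \<open>\<kappa>\<close> elements,
  also for \<open>\<kappa> = \<aleph>\<^sub>0\<close>, because \<open>C\<close> is finite then.
\<close>

lemma (in total_pregeometry) few_generators:
  assumes \<kappa>: "Card_order \<kappa>" "cinfinite \<kappa>" "|J| =o \<kappa>" "|C| <o \<kappa>" and C: "C \<subseteq> K (J \<union> D)"
  obtains J0 where "J0 \<subseteq> J" "infinite (J - J0)" "C \<subseteq> K (J0 \<union> D)"
proof -
  have "\<exists>F. finite F \<and> F \<subseteq> J \<and> x \<in> K (F \<union> D)" if "x \<in> C" for x
    using K_finite_set[of "{x}" J D] C that by auto
  then obtain F where F: "\<And>x. x \<in> C \<Longrightarrow> finite (F x) \<and> F x \<subseteq> J \<and> x \<in> K (F x \<union> D)" by metis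
  let ?F = "\<Union>x\<in>C. F x"
  have "|?F| <o \<kappa>" using card_UN_finite_less[OF \<kappa>(1,2,4)] F by blast
  then have "infinite (J - ?F)" using infinite_Diff_if_card_less[OF \<kappa>(1-3)] by blast
  moreover have "x \<in> K (?F \<union> D)" if x: "x \<in> C" for x
  proof -
    have "K (F x \<union> D) \<subseteq> K (?F \<union> D)" by (rule K_mono) (use x in blast)
    then show ?thesis using F[OF x] by blast
  qed
  moreover have "?F \<subseteq> J" using F by blast
  ultimately show thesis using that[of ?F] by blast
qed

context h_structure
begin

text \<open>
  Twice \<open>few_generators\<close>: for \<open>H\<close> over a basis of \<open>C\<close> over \<open>H\<close>, and for a basis \<open>J\<close> of the universe over \<open>H\<close>.
\<close>

lemma room_if_large:
  assumes \<kappa>: "Card_order \<kappa>" "cinfinite \<kappa>"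
    and H: "pgdim (cl M) H =o \<kappa>" and MH: "dim_over (cl M) (univ M) H =o \<kappa>"
    and C: "C \<subseteq> univ M" "|C| <o \<kappa>"
  shows "infinite (H - hbasis C)" "\<exists>T\<subseteq>univ M. finite T \<and> card T = n \<and> indep_over (C \<union> H) T"
proof -
  obtain I where I: "basis_over {} H I" "dim_over (cl M) H {} = |I|"
    using dim_over_basis[OF H_univ, of "{}"] by auto
  have "I = H"
  proof (rule ccontr)
    assume "I \<noteq> H"
    then obtain y where y: "y \<in> H" "y \<notin> I" using I(1) unfolding basis_over_def by blast
    then have "I \<subseteq> H - {y}" using I(1) unfolding basis_over_def by blast
    then have "clo M (I \<union> {}) \<subseteq> clo M (H - {y} \<union> {})" by (intro K_mono) blast
    then show False using I(1) y(1) indep_H unfolding basis_over_def indep_over_iff by blast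
  qed
  then have cardH: "|H| =o \<kappa>" using H I(2) unfolding pgdim_eq by simp
  obtain \<beta> where \<beta>: "basis_over H C \<beta>" using basis_over_exists by blast
  have "C \<subseteq> clo M (H \<union> \<beta>)" using \<beta> unfolding basis_over_def by (simp add: Un_commute)
  then obtain H0 where H0: "H0 \<subseteq> H" "infinite (H - H0)" "C \<subseteq> clo M (H0 \<union> \<beta>)"
    using few_generators[OF \<kappa> cardH C(2)] by blast
  then have "hbasis C \<subseteq> H0" using basis_span_iff[OF \<beta> H0(1)] by (simp add: Un_commute)
  then have "H - H0 \<subseteq> H - hbasis C" by blast
  then show "infinite (H - hbasis C)" using H0(2) finite_subset by blast
  obtain J where J: "basis_over H (univ M) J" "dim_over (cl M) (univ M) H = |J|"
    using dim_over_basis[OF subset_refl H_univ] by blast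
  have "C \<subseteq> clo M (J \<union> H)" "|J| =o \<kappa>" using J C(1) MH unfolding basis_over_def by auto
  then obtain J0 where J0: "J0 \<subseteq> J" "infinite (J - J0)" "C \<subseteq> clo M (J0 \<union> H)"
    using few_generators[OF \<kappa> _ C(2)] by blast
  obtain T where T: "T \<subseteq> J - J0" "finite T" "card T = n"
    using infinite_arbitrarily_large[OF J0(2)] by blast
  have "J0 \<union> T \<subseteq> J" "J0 \<inter> T = {}" using T(1) J0(1) by auto
  then have "indep_over (H \<union> J0) T"
    using J(1) indep_over_subset[of H J "J0 \<union> T"] indep_over_UnD[of H J0 T] unfolding basis_over_def by simp
  moreover have "C \<union> H \<subseteq> clo M (H \<union> J0)"
    using J0(3) K_ext[of "H \<union> J0"] by (auto simp: Un_commute)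
  ultimately have "indep_over (C \<union> H) T" by (rule indep_over_base)
  moreover have "T \<subseteq> univ M" using T(1) J(1) unfolding basis_over_def by blast
  ultimately show "\<exists>T\<subseteq>univ M. finite T \<and> card T = n \<and> indep_over (C \<union> H) T" using T by blast
qed

text \<open>
  Up to \<open>dim_over_eq_iff_orth\<close> and finite character, the condition on \<open>H0\<close> in \<open>HB_set\<close> is \<open>orth H0 X H\<close>.
\<close>

lemma HB_set_eq:
  assumes "X \<subseteq> univ M"
  shows "HB_set M H X = hbasis X"
proof -
  have iff: "(h \<subseteq> H \<and> (\<forall>as. set as \<subseteq> X \<longrightarrow> dim_over (cl M) (set as) h =o dim_over (cl M) (set as) H)) \<longleftrightarrow>
      h \<subseteq> H \<and> hbasis X \<subseteq> h" for h
  proof (cases "h \<subseteq> H")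
    case True
    have "dim_over (cl M) (set as) h =o dim_over (cl M) (set as) H \<longleftrightarrow> orth h (set as) H"
      if "set as \<subseteq> X" for as
    proof -
      have "set as \<subseteq> univ M" using that assms by blast
      then show ?thesis
        using dim_over_eq_iff_orth[OF finite_set, of as h H] True H_univ ordIso_symmetric by blast
    qed
    moreover have "(\<forall>as. set as \<subseteq> X \<longrightarrow> orth h (set as) H) \<longleftrightarrow> orth h X H"
    proof
      assume a: "\<forall>as. set as \<subseteq> X \<longrightarrow> orth h (set as) H"
      show "orth h X H"
      proof (rule orth_finiteI)
        fix F assume "finite F" "F \<subseteq> X"
        then show "orth h F H" using a finite_list[of F] by auto
      qed
    next
      assume "orth h X H"
      then have "orth h (set as) H" if "set as \<subseteq> X" for as by (rule orth_mono) (use that in auto)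
      then show "\<forall>as. set as \<subseteq> X \<longrightarrow> orth h (set as) H" by simp
    qed
    ultimately show ?thesis using orth_hbasis_iff[OF True] by blast
  qed simp
  show ?thesis unfolding HB_set_def iff by (rule Least_equality) (use hbasis_subset in auto)
qed

lemma HB_eq:
  assumes "X \<subseteq> univ M" "set as \<subseteq> univ M"
  shows "HB M H as X = hbasis (X \<union> set as) - hbasis X"
proof -
  let ?D = "cl M (X \<union> HB_set M H X)"
  have XU: "X \<union> hbasis X \<subseteq> univ M" using assms(1) hbasis_subset[of X] H_univ by blast
  have D: "?D = clo M (X \<union> hbasis X)" using HB_set_eq[OF assms(1)] clo_eq[OF XU] by simp
  have DU: "?D \<subseteq> univ M" unfolding D by (rule clo_univ[OF XU])
  have iff: "(finite h \<and> h \<subseteq> H \<and> dim_over (cl M) (set as) (?D \<union> H) =o dim_over (cl M) (set as) (?D \<union> h)) \<longleftrightarrow>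
      finite h \<and> h \<subseteq> H \<and> hbasis (X \<union> set as) - hbasis X \<subseteq> h" for h
  proof (cases "h \<subseteq> H")
    case True
    have "dim_over (cl M) (set as) (?D \<union> H) =o dim_over (cl M) (set as) (?D \<union> h) \<longleftrightarrow>
        orth (?D \<union> h) (set as) (?D \<union> H)"
      using True DU H_univ assms(2) by (intro dim_over_eq_iff_orth) auto
    also have "\<dots> \<longleftrightarrow> orth (?D \<union> h) (set as) H"
      using orth_mono[of "?D \<union> h" "set as" "?D \<union> H" "set as" H] orth_mono[of "?D \<union> h" "set as" H "set as" "?D \<union> H"]
      by blast
    also have "\<dots> \<longleftrightarrow> hbasis (X \<union> set as) - hbasis X \<subseteq> h" unfolding D by (rule orth_over_hbasis_iff[OF True])
    finally show ?thesis by blast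
  qed simp
  show ?thesis unfolding HB_def HB_closed_def iff
    by (rule Least_equality) (use hbasis_Un_finite_set[of "set as" X] hbasis_subset in auto)
qed

text \<open>
  \<open>HB_eq\<close> turns the \<open>H\<close>-bases in the definition of independence into the differences compared in
  \<open>h_indep_iff_hbasis_diff\<close>; passing to \<open>cl C\<close> does not change them by \<open>hbasis_K\<close>.
\<close>

lemma indep_tuple_iff_h_indep:
  assumes "set as \<subseteq> univ M" "B \<subseteq> univ M" "C \<subseteq> univ M"
  shows "indep_tuple M H as C B \<longleftrightarrow> h_indep (set as) C B"
proof -
  have "cl_indep (cl M) as (C \<union> H) B \<longleftrightarrow> orth (C \<union> H) (set as) (B \<union> (C \<union> H))"
    unfolding cl_indep_def using assms H_univ by (intro dim_over_eq_iff_orth) auto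
  also have "\<dots> \<longleftrightarrow> orth (C \<union> H) (set as) B"
    using orth_mono[of "C \<union> H" "set as" "B \<union> (C \<union> H)" "set as" B] orth_mono[of "C \<union> H" "set as" B "set as" "B \<union> (C \<union> H)"]
    by blast
  finally have 1: "cl_indep (cl M) as (C \<union> H) B \<longleftrightarrow> orth (C \<union> H) (set as) B" .
  have HB: "HB M H as (cl M X) = hbasis (X \<union> set as) - hbasis X" if "X \<subseteq> univ M" for X
    using HB_eq[OF clo_univ[OF that] assms(1)] clo_eq[OF that] hbasis_K[of X] hbasis_K_Un[of X "set as"] by simp
  have CB: "C \<union> B \<subseteq> univ M" using assms by simp
  show ?thesis
    unfolding indep_tuple_def 1 h_indep_def HB[OF assms(3)] HB[OF CB]
    using h_indep_iff_hbasis_diff[of C "set as" B] by blast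
qed

lemma indep_iff_h_indep:
  assumes "A \<subseteq> univ M" "B \<subseteq> univ M" "C \<subseteq> univ M"
  shows "indep M H A C B \<longleftrightarrow> h_indep A C B"
proof
  assume i: "indep M H A C B"
  show "h_indep A C B"
  proof (rule h_indep_finite_left)
    fix F assume F: "finite F" "F \<subseteq> A"
    then obtain as where "set as = F" using finite_list by blast
    then show "h_indep F C B" using i F assms indep_tuple_iff_h_indep[of as B C] unfolding indep_def by auto
  qed
next
  assume h: "h_indep A C B"
  show "indep M H A C B"
    unfolding indep_def
  proof (intro allI impI)
    fix as assume as: "set as \<subseteq> A"
    then have "h_indep (set as) C B" using h_indep_mono[OF h as, of B] by blast
    then show "indep_tuple M H as C B" using indep_tuple_iff_h_indep[of as B C] assms as by auto
  qed
qed

lemma fo_iso_reduct: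
  assumes "fo_iso (lang_H L) (expand_H M H) (expand_H M H) \<sigma>"
  shows "fo_embedding L M M \<sigma>" "\<sigma> ` univ M = univ M" "\<sigma> ` H = H"
proof -
  let ?N = "expand_H M H"
  have N: "univ ?N = univ M" "fint ?N = fint M" "argtuples ?N n = argtuples M n" for n
    by (simp_all add: expand_H_def argtuples_def)
  have LH: "fsyms (lang_H L) = fsyms L" "farity (lang_H L) = farity L" "None \<in> rsyms (lang_H L)"
    "rarity (lang_H L) None = 1" "R \<in> rsyms L \<Longrightarrow> Some R \<in> rsyms (lang_H L)"
    "rarity (lang_H L) (Some R) = rarity L R" for R by (simp_all add: lang_H_def)
  have e: "fo_embedding (lang_H L) ?N ?N \<sigma>" and im: "\<sigma> ` univ M = univ M"
    using assms N unfolding fo_iso_def by simp_all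
  have rel: "\<And>R xs. R \<in> rsyms (lang_H L) \<Longrightarrow> xs \<in> argtuples M (rarity (lang_H L) R) \<Longrightarrow>
      rint ?N R xs \<longleftrightarrow> rint ?N R (map \<sigma> xs)"
    using e unfolding fo_embedding_def N by blast
  have "rint M R xs \<longleftrightarrow> rint M R (map \<sigma> xs)" if "R \<in> rsyms L" "xs \<in> argtuples M (rarity L R)" for R xs
    using rel[of "Some R" xs] that LH by (simp add: rint_expand_H)
  then show "fo_embedding L M M \<sigma>"
    using e struct im unfolding fo_embedding_def N LH by blast
  show "\<sigma> ` univ M = univ M" by (rule im)
  have iff: "\<sigma> x \<in> H \<longleftrightarrow> x \<in> H" if "x \<in> univ M" for x
    using rel[of None "[x]"] that LH by (simp add: rint_expand_H argtuples_def)
  show "\<sigma> ` H = H"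
  proof
    show "\<sigma> ` H \<subseteq> H" using iff H_univ by blast
    show "H \<subseteq> \<sigma> ` H"
    proof
      fix y assume y: "y \<in> H"
      then obtain x where "x \<in> univ M" "y = \<sigma> x" using H_univ im by blast
      then show "y \<in> \<sigma> ` H" using iff y by blast
    qed
  qed
qed

text \<open>
  An automorphism preserves closures by QM1, and everything in \<open>h_indep\<close> is defined from closures and
  \<open>H\<close>.
\<close>

lemma h_indep_automorphism:
  assumes \<sigma>: "fo_embedding L M M \<sigma>" "\<sigma> ` univ M = univ M" "\<sigma> ` H = H"
    and ABC: "A \<subseteq> univ M" "B \<subseteq> univ M" "C \<subseteq> univ M"
  shows "h_indep (\<sigma> ` A) (\<sigma> ` C) (\<sigma> ` B) \<longleftrightarrow> h_indep A C B"
proof -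
  have q: "qf_elem L M M (univ M) \<sigma>" using qf_elem_fo_embedding[OF \<sigma>(1)] .
  have inj: "inj_on \<sigma> (univ M)" using q by (rule qf_elem_inj)
  have ind: "indep_over (\<sigma> ` D) (\<sigma> ` S) \<longleftrightarrow> indep_over D S" if "D \<subseteq> univ M" "S \<subseteq> univ M" for D S
  proof -
    have "\<sigma> x \<in> clo M ((\<sigma> ` S - {\<sigma> x}) \<union> \<sigma> ` D) \<longleftrightarrow> x \<in> clo M ((S - {x}) \<union> D)" if x: "x \<in> S" for x
    proof -
      have "\<sigma> ` S - {\<sigma> x} = \<sigma> ` (S - {x})"
        using inj_on_image_set_diff[OF inj, of S "{x}"] x \<open>S \<subseteq> univ M\<close> by auto
      then have "(\<sigma> ` S - {\<sigma> x}) \<union> \<sigma> ` D = \<sigma> ` ((S - {x}) \<union> D)" by (simp add: image_Un)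
      moreover have "(S - {x}) \<union> D \<subseteq> univ M" "x \<in> univ M" using that \<open>S \<subseteq> univ M\<close> \<open>D \<subseteq> univ M\<close> by auto
      ultimately show ?thesis using qm1[OF q subset_refl, of "(S - {x}) \<union> D" x] \<sigma>(2) by simp
    qed
    then show ?thesis unfolding indep_over_iff by blast
  qed
  have orth: "orth (\<sigma> ` D) (\<sigma> ` X) (\<sigma> ` E) \<longleftrightarrow> orth D X E"
    if "D \<subseteq> univ M" "X \<subseteq> univ M" "E \<subseteq> univ M" for D X E
  proof -
    have iffs: "indep_over (\<sigma> ` D \<union> \<sigma> ` E) (\<sigma> ` S) \<longleftrightarrow> indep_over (D \<union> E) S"
      "indep_over (\<sigma> ` D) (\<sigma> ` S) \<longleftrightarrow> indep_over D S" if "S \<subseteq> X" for S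
      using ind[of "D \<union> E" S] ind[of D S] that \<open>D \<subseteq> univ M\<close> \<open>X \<subseteq> univ M\<close> \<open>E \<subseteq> univ M\<close>
      by (simp_all add: image_Un)
    show ?thesis unfolding orth_def all_subset_image by (simp only: iffs cong: imp_cong)
  qed
  have hbasis: "hbasis (\<sigma> ` X) = \<sigma> ` hbasis X" if X: "X \<subseteq> univ M" for X
  proof -
    have "\<sigma> y \<in> hbasis (\<sigma> ` X) \<longleftrightarrow> y \<in> hbasis X" if y: "y \<in> H" for y
    proof -
      have "\<sigma> ` (H - {y}) = H - {\<sigma> y}"
        using inj_on_image_set_diff[OF inj, of H "{y}"] y H_univ \<sigma>(3) by auto
      moreover have "\<sigma> y \<in> H" using y \<sigma>(3) by blast
      ultimately show ?thesis using orth[of "H - {y}" X H] X H_univ \<sigma>(3) y unfolding hbasis_def by auto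
    qed
    moreover have "z \<in> \<sigma> ` H" if "z \<in> hbasis (\<sigma> ` X)" for z using that hbasis_subset \<sigma>(3) by blast
    ultimately show ?thesis using hbasis_subset[of X] by blast
  qed
  have h: "hbasis (\<sigma> ` X \<union> \<sigma> ` Y) = \<sigma> ` hbasis (X \<union> Y)" if "X \<subseteq> univ M" "Y \<subseteq> univ M" for X Y
    using hbasis[of "X \<union> Y"] that by (simp add: image_Un)
  have "\<sigma> ` hbasis (C \<union> A) \<inter> \<sigma> ` hbasis (C \<union> B) \<subseteq> \<sigma> ` hbasis C \<longleftrightarrow> hbasis (C \<union> A) \<inter> hbasis (C \<union> B) \<subseteq> hbasis C"
  proof -
    have sub: "hbasis X \<subseteq> univ M" for X using hbasis_subset[of X] H_univ by blast
    have "\<sigma> ` hbasis (C \<union> A) \<inter> \<sigma> ` hbasis (C \<union> B) = \<sigma> ` (hbasis (C \<union> A) \<inter> hbasis (C \<union> B))"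
      using inj_on_image_Int[OF inj sub sub] by simp
    moreover have "\<sigma> x \<in> \<sigma> ` hbasis C \<longleftrightarrow> x \<in> hbasis C" if "x \<in> hbasis (C \<union> A)" for x
      using inj_on_image_mem_iff[OF inj _ sub, of x C] that sub[of "C \<union> A"] by blast
    ultimately show ?thesis by (simp only: image_subset_iff) blast
  qed
  moreover have "orth (\<sigma> ` C \<union> H) (\<sigma> ` A) (\<sigma> ` B) \<longleftrightarrow> orth (C \<union> H) A B"
    using orth[of "C \<union> H" A B] ABC H_univ \<sigma>(3) by (simp add: image_Un)
  ultimately show ?thesis unfolding h_indep_def h[OF ABC(3,1)] h[OF ABC(3,2)] hbasis[OF ABC(3)] by simp
qed

end

theorem theorem5p4:
  fixes L :: "('f, 'r) lang" and M0 M :: "('f, 'r, 'u) pgstruct" and H :: "'u set"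
  assumes "countable_lang L"
    and "quasiminimal L M0"
    and "qm_class L M0 M"
    and "H_structure M H"
  shows
    \<comment> \<open>invariance\<close>
    "(\<forall>\<sigma> A B C. fo_iso (lang_H L) (expand_H M H) (expand_H M H) \<sigma> \<and>
        A \<subseteq> univ M \<and> B \<subseteq> univ M \<and> C \<subseteq> univ M \<longrightarrow>
        (indep M H A C B \<longleftrightarrow> indep M H (\<sigma> ` A) (\<sigma> ` C) (\<sigma> ` B))) \<and>
     \<comment> \<open>normality\<close>
     (\<forall>A B C. A \<subseteq> univ M \<and> B \<subseteq> univ M \<and> C \<subseteq> univ M \<and> indep M H A C B \<longrightarrow>
        indep M H A C (B \<union> C)) \<and>
     \<comment> \<open>monotonicity\<close>
     (\<forall>A A' B B' C. A \<subseteq> univ M \<and> B \<subseteq> univ M \<and> C \<subseteq> univ M \<and> A' \<subseteq> A \<and> B' \<subseteq> B \<and>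
        indep M H A C B \<longrightarrow> indep M H A' C B') \<and>
     \<comment> \<open>transitivity\<close>
     (\<forall>A B C D. A \<subseteq> univ M \<and> B \<subseteq> C \<and> C \<subseteq> D \<and> D \<subseteq> univ M \<longrightarrow>
        (indep M H A B D \<longleftrightarrow> indep M H A B C \<and> indep M H A C D)) \<and>
     \<comment> \<open>symmetry\<close>
     (\<forall>A B C. A \<subseteq> univ M \<and> B \<subseteq> univ M \<and> C \<subseteq> univ M \<and> indep M H A C B \<longrightarrow>
        indep M H B C A) \<and>
     \<comment> \<open>finite character\<close>
     (\<forall>A B C. A \<subseteq> univ M \<and> B \<subseteq> univ M \<and> C \<subseteq> univ M \<longrightarrow>
        (indep M H A C B \<longleftrightarrow>
          (\<forall>as bs. set as \<subseteq> A \<and> set bs \<subseteq> B \<longrightarrow> indep_tuple M H as C (set bs)))) \<and>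
     \<comment> \<open>extension\<close>
     (\<forall>(\<kappa> :: 'u rel) as B C. Card_order \<kappa> \<and> cinfinite \<kappa> \<and>
        pgdim (cl M) H =o \<kappa> \<and> dim_over (cl M) (univ M) H =o \<kappa> \<and>
        set as \<subseteq> univ M \<and> B \<subseteq> C \<and> C \<subseteq> univ M \<and> |B| <o \<kappa> \<and> |C| <o \<kappa> \<longrightarrow>
        (\<exists>cs. set cs \<subseteq> univ M \<and> tp_H L M H cs B = tp_H L M H as B \<and> indep_tuple M H cs B C))"
proof -
  have "h_structure L M H"
    using weak_qm_if_qm_class[OF assms(2,3)] assms(4)
    by (intro h_structure.intro h_structure_axioms.intro)
  then interpret h_structure L M H .
  show ?thesis
  proof (intro conjI allI impI; (elim conjE)?)
    fix \<sigma> A B C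
    assume \<sigma>: "fo_iso (lang_H L) (expand_H M H) (expand_H M H) \<sigma>"
      and ABC: "A \<subseteq> univ M" "B \<subseteq> univ M" "C \<subseteq> univ M"
    note \<sigma>' = fo_iso_reduct[OF \<sigma>]
    have "\<sigma> ` X \<subseteq> univ M" if "X \<subseteq> univ M" for X using image_mono[OF that, of \<sigma>] \<sigma>'(2) by simp
    then show "indep M H A C B \<longleftrightarrow> indep M H (\<sigma> ` A) (\<sigma> ` C) (\<sigma> ` B)"
      using indep_iff_h_indep h_indep_automorphism[OF \<sigma>' ABC] ABC by simp
  next
    fix A B C assume ABC: "A \<subseteq> univ M" "B \<subseteq> univ M" "C \<subseteq> univ M" and i: "indep M H A C B"
    have "h_indep A C B" using i indep_iff_h_indep[of A B C] ABC by simp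
    then have "h_indep A C (B \<union> C)" by (rule h_indep_mono) auto
    then show "indep M H A C (B \<union> C)" using indep_iff_h_indep[of A "B \<union> C" C] ABC by simp
  next
    fix A A' B B' C assume ABC: "A \<subseteq> univ M" "B \<subseteq> univ M" "C \<subseteq> univ M" "A' \<subseteq> A" "B' \<subseteq> B"
      and i: "indep M H A C B"
    have "h_indep A C B" using i indep_iff_h_indep[of A B C] ABC by simp
    then have "h_indep A' C B'" by (rule h_indep_mono) (use ABC in auto)
    then show "indep M H A' C B'" using indep_iff_h_indep[of A' B' C] ABC by auto
  next
    fix A B C D assume ABCD: "A \<subseteq> univ M" "B \<subseteq> C" "C \<subseteq> D" "D \<subseteq> univ M"
    then have "B \<subseteq> univ M" "C \<subseteq> univ M" by auto
    then show "indep M H A B D \<longleftrightarrow> indep M H A B C \<and> indep M H A C D"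
      using indep_iff_h_indep h_indep_trans[OF ABCD(2,3)] ABCD(1,4) by simp
  next
    fix A B C assume ABC: "A \<subseteq> univ M" "B \<subseteq> univ M" "C \<subseteq> univ M" and i: "indep M H A C B"
    have "h_indep A C B" using i indep_iff_h_indep[OF ABC] by simp
    then show "indep M H B C A" using indep_iff_h_indep[of B A C] ABC h_indep_sym by simp
  next
    fix A B C assume ABC: "A \<subseteq> univ M" "B \<subseteq> univ M" "C \<subseteq> univ M"
    show "indep M H A C B \<longleftrightarrow> (\<forall>as bs. set as \<subseteq> A \<and> set bs \<subseteq> B \<longrightarrow> indep_tuple M H as C (set bs))"
    proof
      assume "indep M H A C B"
      then have h: "h_indep A C B" using indep_iff_h_indep[OF ABC] by simp
      show "\<forall>as bs. set as \<subseteq> A \<and> set bs \<subseteq> B \<longrightarrow> indep_tuple M H as C (set bs)"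
      proof (intro allI impI)
        fix as bs :: "'u list" assume s: "set as \<subseteq> A \<and> set bs \<subseteq> B"
        then have "h_indep (set as) C (set bs)" using h_indep_mono[OF h, of "set as" "set bs"] by blast
        then show "indep_tuple M H as C (set bs)" using indep_tuple_iff_h_indep[of as "set bs" C] s ABC by auto
      qed
    next
      assume t: "\<forall>as bs. set as \<subseteq> A \<and> set bs \<subseteq> B \<longrightarrow> indep_tuple M H as C (set bs)"
      have "h_indep A C B"
      proof (rule h_indep_finite_left, rule h_indep_finite_right)
        fix F G assume F: "finite F" "F \<subseteq> A" and G: "finite G" "G \<subseteq> B"
        obtain as bs where "set as = F" "set bs = G" using finite_list F(1) G(1) by metis
        then show "h_indep F C G" using t F G ABC indep_tuple_iff_h_indep[of as G C] by auto
      qed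
      then show "indep M H A C B" using indep_iff_h_indep[OF ABC] by simp
    qed
  next
    fix \<kappa> :: "'u rel" and as B C
    assume \<kappa>: "Card_order \<kappa>" "cinfinite \<kappa>"
      and dims: "pgdim (cl M) H =o \<kappa>" "dim_over (cl M) (univ M) H =o \<kappa>"
      and as: "set as \<subseteq> univ M" and BC: "B \<subseteq> C" "C \<subseteq> univ M" and card: "|C| <o \<kappa>"
    note room = room_if_large[OF \<kappa> dims BC(2) card]
    obtain cs where cs: "set cs \<subseteq> univ M" "tp_H L M H cs B = tp_H L M H as B" "h_indep (set cs) B C"
      using h_indep_extension[OF as BC room] by (elim exE conjE)
    then show "\<exists>cs. set cs \<subseteq> univ M \<and> tp_H L M H cs B = tp_H L M H as B \<and> indep_tuple M H cs B C"
      using indep_tuple_iff_h_indep[of cs C B] BC by auto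
  qed
qed

end
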